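(* Let $A$ be a finite dimensional hereditary algebra over an algebraically closed field $k$, let $m\geq 1$ be an integer, and let $A^{(m)}$ be the $m$-replicated algebra of $A$. Then the dominant dimension of $A^{(m)}$ is at least $m$, i.e. $\mathrm{dom.dim}\, A^{(m)}\geq m$.
   Context: Modules are finitely generated right modules, and $D=\mathrm{Hom}_k(-,k)$. The $m$-replicated algebra. For a finite dimensional $k$-algebra $\Lambda$, the $m$-replicated algebra $\Lambda^{(m)}$ is the algebra of lower triangular $(m+1)\times(m+1)$ matrices (rows and columns indexed by $0,\dots,m$) $$\Lambda^{(m)}=\begin{pmatrix} \Lambda_{0} & & & & 0\\ Q_{1} & \Lambda_{1} & & & \\ & Q_{2} & \Lambda_{2} & & \\ & & \ddots & \ddots & \\ 0 & & & Q_{m} & \Lambda_{m}\end{pmatrix},$$ where $\Lambda_i=\Lambda$ for $0\le i\le m$ (the $(i,i)$ entries), $Q_i={}_\Lambda D\Lambda_\Lambda$ for $1\le i\le m$ (the $(i,i-1)$ entries), and all other entries are zero. Addition is entrywise. Multiplication is matrix multiplication induced from the canonical isomorphisms $\Lambda\otimes_\Lambda D\Lambda\cong D\Lambda\cong D\Lambda\otimes_\Lambda\Lambda$ (the bimodule actions) and the zero map $D\Lambda\otimes_\Lambda D\Lambda\to 0$. Dominant dimension. For a non-semisimple Artin algebra $\Lambda$, let $$0\to \Lambda\to I_1\to I_2\to\cdots\to I_n\to\cdots$$ be the minimal injective resolution of $\Lambda$ as a $\Lambda$-module (note that the indexing starts at $1$). Then $\mathrm{dom.dim}\,\Lambda$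 is the supremum of all $n\in\mathbb{N}$ such that $I_j$ is projective for all $j\leq n$. *)

theory Defs
  imports "HOL-Algebra.Algebra" "HOL-Library.Extended_Nat"
begin

section \<open>Algebras and their finitely generated right modules\<close>

text \<open>
  An algebra over a field is given by a record of type \<^typ>\<open>('k, 'a) module\<close>, which has both the
  ring operations and the scalar multiplication.
\<close>

definition field_algebra :: "'k ring \<Rightarrow> ('k, 'a) module \<Rightarrow> bool" where
  "field_algebra K A \<longleftrightarrow> field K \<and> ring A \<and> module K A \<and>
     (\<forall>c\<in>carrier K. \<forall>x\<in>carrier A. \<forall>y\<in>carrier A.
        (c \<odot>\<^bsub>A\<^esub> x) \<otimes>\<^bsub>A\<^esub> y = c \<odot>\<^bsub>A\<^esub> (x \<otimes>\<^bsub>A\<^esub> y) \<and>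
        x \<otimes>\<^bsub>A\<^esub> (c \<odot>\<^bsub>A\<^esub> y) = c \<odot>\<^bsub>A\<^esub> (x \<otimes>\<^bsub>A\<^esub> y))"

text \<open>
  Right modules reuse the record of left modules: \<open>r \<odot> x\<close> stands for \<open>x \<cdot> r\<close>, which shows in
  \<open>smult_assoc\<close>. The fields \<^const>\<open>monoid.mult\<close> and \<^const>\<open>monoid.one\<close> of a module are irrelevant.
\<close>

locale right_module = R?: ring R + M?: abelian_group M
  for R :: "('r, 'b) ring_scheme" (structure) and M :: "('r, 'x) module" (structure) +
  assumes smult_closed:
      "\<lbrakk>r \<in> carrier R; x \<in> carrier M\<rbrakk> \<Longrightarrow> r \<odot>\<^bsub>M\<^esub> x \<in> carrier M"
    and smult_add_ring:
      "\<lbrakk>r \<in> carrier R; s \<in> carrier R; x \<in> carrier M\<rbrakk> \<Longrightarrow>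
       (r \<oplus>\<^bsub>R\<^esub> s) \<odot>\<^bsub>M\<^esub> x = (r \<odot>\<^bsub>M\<^esub> x) \<oplus>\<^bsub>M\<^esub> (s \<odot>\<^bsub>M\<^esub> x)"
    and smult_add_module:
      "\<lbrakk>r \<in> carrier R; x \<in> carrier M; y \<in> carrier M\<rbrakk> \<Longrightarrow>
       r \<odot>\<^bsub>M\<^esub> (x \<oplus>\<^bsub>M\<^esub> y) = (r \<odot>\<^bsub>M\<^esub> x) \<oplus>\<^bsub>M\<^esub> (r \<odot>\<^bsub>M\<^esub> y)"
    and smult_assoc:
      "\<lbrakk>r \<in> carrier R; s \<in> carrier R; x \<in> carrier M\<rbrakk> \<Longrightarrow>
       (r \<otimes>\<^bsub>R\<^esub> s) \<odot>\<^bsub>M\<^esub> x = s \<odot>\<^bsub>M\<^esub> (r \<odot>\<^bsub>M\<^esub> x)"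
    and smult_one:
      "x \<in> carrier M \<Longrightarrow> \<one>\<^bsub>R\<^esub> \<odot>\<^bsub>M\<^esub> x = x"

text \<open>
  Over a field, and with \<open>M\<close> an algebra or a vector space, the following says that \<open>M\<close> is finite
  dimensional.
\<close>

definition finitely_generated :: "('r, 'b) ring_scheme \<Rightarrow> ('r, 'x) module \<Rightarrow> bool" where
  "finitely_generated R M \<longleftrightarrow>
     (\<exists>S. finite S \<and> S \<subseteq> carrier M \<and> (\<forall>H. submodule H R M \<and> S \<subseteq> H \<longrightarrow> H = carrier M))"

definition fg_right_module :: "('r, 'b) ring_scheme \<Rightarrow> ('r, 'x) module \<Rightarrow> bool" where
  "fg_right_module R M \<longleftrightarrow> right_module R M \<and> finitely_generated R M"

definition mod_hom ::
  "('r, 'b) ring_scheme \<Rightarrow> ('r, 'x) module \<Rightarrow> ('r, 'y) module \<Rightarrow> ('x \<Rightarrow> 'y) set" where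
  "mod_hom R M N = {f \<in> carrier M \<rightarrow> carrier N.
     (\<forall>x\<in>carrier M. \<forall>y\<in>carrier M. f (x \<oplus>\<^bsub>M\<^esub> y) = f x \<oplus>\<^bsub>N\<^esub> f y) \<and>
     (\<forall>r\<in>carrier R. \<forall>x\<in>carrier M. f (r \<odot>\<^bsub>M\<^esub> x) = r \<odot>\<^bsub>N\<^esub> f x)}"

definition regular_module :: "('r, 'b) ring_scheme \<Rightarrow> ('r, 'r) module" where
  "regular_module R =
     \<lparr>carrier = carrier R, monoid.mult = monoid.mult R, one = one R, ring.zero = ring.zero R, add = add R,
      smult = (\<lambda>r x. x \<otimes>\<^bsub>R\<^esub> r)\<rparr>"

text \<open>
  The next two definitions quantify over the finitely generated modules with carrier in the type
  \<^typ>\<open>nat \<Rightarrow> 'k\<close>, where \<^typ>\<open>'k\<close> is the type of the scalars of the algebra \<open>L\<close>. If \<open>L\<close> is finite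
  dimensional over a field \<open>K\<close> of this type, a finitely generated \<open>L\<close>-module is in bijection with
  some \<open>K\<^sup>n\<close>, hence isomorphic to a module of this kind, so that there is no loss of generality.
\<close>

definition projective_module :: "('k, 'a) module \<Rightarrow> ('a, 'x) module \<Rightarrow> bool" where
  "projective_module L P \<longleftrightarrow> fg_right_module L P \<and>
     (\<forall>(M :: ('a, nat \<Rightarrow> 'k) module) (N :: ('a, nat \<Rightarrow> 'k) module) f g.
        fg_right_module L M \<and> fg_right_module L N \<and>
        f \<in> mod_hom L M N \<and> f ` carrier M = carrier N \<and> g \<in> mod_hom L P N \<longrightarrow>
        (\<exists>h\<in>mod_hom L P M. \<forall>x\<in>carrier P. f (h x) = g x))"

definition injective_module :: "('k, 'a) module \<Rightarrow> ('a, 'x) module \<Rightarrow> bool" where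
  "injective_module L E \<longleftrightarrow> fg_right_module L E \<and>
     (\<forall>(M :: ('a, nat \<Rightarrow> 'k) module) (N :: ('a, nat \<Rightarrow> 'k) module) f g.
        fg_right_module L M \<and> fg_right_module L N \<and>
        f \<in> mod_hom L M N \<and> inj_on f (carrier M) \<and> g \<in> mod_hom L M E \<longrightarrow>
        (\<exists>h\<in>mod_hom L N E. \<forall>x\<in>carrier M. h (f x) = g x))"

text \<open>
  This is right hereditary; finite dimensional algebras that are hereditary on one side are so on the
  other.
\<close>

definition hereditary :: "('k, 'a) module \<Rightarrow> bool" where
  "hereditary A \<longleftrightarrow>
     (\<forall>H. submodule H A (regular_module A) \<longrightarrow>
        projective_module A (regular_module A\<lparr>carrier := H\<rparr>))"


section \<open>Dominant dimension\<close>

definition essential_submodule ::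
  "('r, 'b) ring_scheme \<Rightarrow> 'x set \<Rightarrow> ('r, 'x) module \<Rightarrow> bool" where
  "essential_submodule R H M \<longleftrightarrow> submodule H R M \<and>
     (\<forall>N. submodule N R M \<and> N \<inter> H = {\<zero>\<^bsub>M\<^esub>} \<longrightarrow> N = {\<zero>\<^bsub>M\<^esub>})"

text \<open>
  The resolution is \<open>0 \<rightarrow> U \<rightarrow> I 1 \<rightarrow> I 2 \<rightarrow> \<dots>\<close> with maps \<open>e : U \<rightarrow> I 1\<close> and \<open>d j : I j \<rightarrow> I (j + 1)\<close> for
  \<open>j \<ge> 1\<close>; \<open>I 0\<close> and \<open>d 0\<close> play no role. Minimality means that each term is an injective envelope of
  the image of the map that ends there.
\<close>

definition minimal_injective_resolution ::
  "('k, 'a) module \<Rightarrow> ('a, 'x) module \<Rightarrow> (nat \<Rightarrow> ('a, 'y) module) \<Rightarrow>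
   ('x \<Rightarrow> 'y) \<Rightarrow> (nat \<Rightarrow> 'y \<Rightarrow> 'y) \<Rightarrow> bool" where
  "minimal_injective_resolution L U I e d \<longleftrightarrow>
     (\<forall>j\<ge>1. injective_module L (I j)) \<and>
     e \<in> mod_hom L U (I 1) \<and>
     (\<forall>j\<ge>1. d j \<in> mod_hom L (I j) (I (j + 1))) \<and>
     inj_on e (carrier U) \<and>
     e ` carrier U = {x \<in> carrier (I 1). d 1 x = \<zero>\<^bsub>I 2\<^esub>} \<and>
     (\<forall>j\<ge>1. d j ` carrier (I j) = {x \<in> carrier (I (j + 1)). d (j + 1) x = \<zero>\<^bsub>I (j + 2)\<^esub>}) \<and>
     essential_submodule L (e ` carrier U) (I 1) \<and>
     (\<forall>j\<ge>1. essential_submodule L (d j ` carrier (I j)) (I (j + 1)))"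

text \<open>
  Minimal injective resolutions are unique up to isomorphism, so the choice of the resolution does
  not matter; its terms are taken in the type of the test modules above. For a semisimple algebra the
  value is infinity.
\<close>

definition dom_dim :: "('k, 'a) module \<Rightarrow> enat" where
  "dom_dim L = Sup {enat n | n.
     \<exists>(I :: nat \<Rightarrow> ('a, nat \<Rightarrow> 'k) module) e d.
       minimal_injective_resolution L (regular_module L) I e d \<and>
       (\<forall>j. 1 \<le> j \<and> j \<le> n \<longrightarrow> projective_module L (I j))}"


section \<open>Replicated algebras\<close>

definition dual_space :: "'k ring \<Rightarrow> ('k, 'a) module \<Rightarrow> ('k, 'a \<Rightarrow> 'k) module" where
  "dual_space K A =
     \<lparr>carrier = {f \<in> carrier A \<rightarrow>\<^sub>E carrier K.
        (\<forall>x\<in>carrier A. \<forall>y\<in>carrier A. f (x \<oplus>\<^bsub>A\<^esub> y) = f x \<oplus>\<^bsub>K\<^esub> f y) \<and>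
        (\<forall>c\<in>carrier K. \<forall>x\<in>carrier A. f (c \<odot>\<^bsub>A\<^esub> x) = c \<otimes>\<^bsub>K\<^esub> f x)},
      monoid.mult = undefined, one = undefined,
      ring.zero = (\<lambda>x\<in>carrier A. \<zero>\<^bsub>K\<^esub>),
      add = (\<lambda>f g. \<lambda>x\<in>carrier A. f x \<oplus>\<^bsub>K\<^esub> g x),
      smult = (\<lambda>c f. \<lambda>x\<in>carrier A. c \<otimes>\<^bsub>K\<^esub> f x)\<rparr>"

definition dual_left :: "('k, 'a) module \<Rightarrow> 'a \<Rightarrow> ('a \<Rightarrow> 'k) \<Rightarrow> ('a \<Rightarrow> 'k)" where
  "dual_left A a f = (\<lambda>x\<in>carrier A. f (x \<otimes>\<^bsub>A\<^esub> a))"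

definition dual_right :: "('k, 'a) module \<Rightarrow> ('a \<Rightarrow> 'k) \<Rightarrow> 'a \<Rightarrow> ('a \<Rightarrow> 'k)" where
  "dual_right A f a = (\<lambda>x\<in>carrier A. f (a \<otimes>\<^bsub>A\<^esub> x))"

text \<open>
  A matrix is stored as the pair \<open>(a, q)\<close> of its possibly nonzero entries: \<open>a i\<close> is the entry
  \<open>(i, i)\<close> for \<open>i \<le> m\<close>, and \<open>q i\<close> is the entry \<open>(i, i - 1)\<close> for \<open>1 \<le> i \<le> m\<close>. Products of two
  subdiagonal entries, which would contribute to the position \<open>(i, i - 2)\<close>, are zero.
\<close>

definition replicated_algebra ::
  "'k ring \<Rightarrow> nat \<Rightarrow> ('k, 'a) module \<Rightarrow> ('k, (nat \<Rightarrow> 'a) \<times> (nat \<Rightarrow> 'a \<Rightarrow> 'k)) module" where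
  "replicated_algebra K m A = (let D = dual_space K A in
     \<lparr>carrier = ({..m} \<rightarrow>\<^sub>E carrier A) \<times> ({1..m} \<rightarrow>\<^sub>E carrier D),
      monoid.mult = (\<lambda>(a, q) (b, r).
        (\<lambda>i\<in>{..m}. a i \<otimes>\<^bsub>A\<^esub> b i,
         \<lambda>i\<in>{1..m}. dual_right A (q i) (b (i - 1)) \<oplus>\<^bsub>D\<^esub> dual_left A (a i) (r i))),
      one = (\<lambda>i\<in>{..m}. \<one>\<^bsub>A\<^esub>, \<lambda>i\<in>{1..m}. \<zero>\<^bsub>D\<^esub>),
      ring.zero = (\<lambda>i\<in>{..m}. \<zero>\<^bsub>A\<^esub>, \<lambda>i\<in>{1..m}. \<zero>\<^bsub>D\<^esub>),
      add = (\<lambda>(a, q) (b, r).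
        (\<lambda>i\<in>{..m}. a i \<oplus>\<^bsub>A\<^esub> b i, \<lambda>i\<in>{1..m}. q i \<oplus>\<^bsub>D\<^esub> r i)),
      smult = (\<lambda>c (a, q).
        (\<lambda>i\<in>{..m}. c \<odot>\<^bsub>A\<^esub> a i, \<lambda>i\<in>{1..m}. c \<odot>\<^bsub>D\<^esub> q i))\<rparr>)"

end

theory Submission
  imports Defs
begin

text \<open>
  Write \<open>L\<close> for the replicated algebra, \<open>e\<^sub>0, \<dots>, e\<^sub>m\<close> for its diagonal idempotents and
  \<open>f\<^sub>i = e\<^sub>i\<^sub>+\<^sub>1 + \<dots> + e\<^sub>m\<close>. The module \<open>W = f\<^sub>0 L\<close> is projective, and it is isomorphic to the dual
  of the left module \<open>L (1 - e\<^sub>m)\<close>; hence it is injective, and it cogenerates the modules \<open>M\<close> with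
  \<open>M e\<^sub>m = 0\<close>. So the injective envelopes of these are direct summands of powers of \<open>W\<close>, and
  projective. Since \<open>f\<^sub>i\<^sub>+\<^sub>1 L f\<^sub>i = f\<^sub>i\<^sub>+\<^sub>1 L\<close>, an envelope of a module killed by \<open>f\<^sub>i\<close> is killed by
  \<open>f\<^sub>i\<^sub>+\<^sub>1\<close>. Now \<open>L\<close> is the direct sum of \<open>W\<close> and \<open>e\<^sub>0 L\<close>, and \<open>e\<^sub>0 L f\<^sub>0 = 0\<close>. By
  induction the \<open>j\<close>-th cosyzygy of \<open>e\<^sub>0 L\<close> is killed by \<open>f\<^sub>j\<close>, so that its envelope is projective
  for \<open>j < m\<close>.
\<close>

section \<open>Right modules\<close>

text \<open>\<open>W\<close> is a dual for the following reason. Row \<open>i \<ge> 1\<close> of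
  \<open>L\<close> has the entries \<open>DA\<close> and \<open>A\<close>, in columns
  \<open>i - 1\<close> and \<open>i\<close>; column \<open>i - 1\<close> has the entries
  \<open>A\<close> and \<open>DA\<close>, in rows \<open>i - 1\<close> and \<open>i\<close>. As
  \<open>A\<close> is finite dimensional, it is also the dual of \<open>DA\<close>, so row
  \<open>i\<close> is the dual of column \<open>i - 1\<close>: all rows but row \<open>0\<close>
  match all columns but column \<open>m\<close>. The bound is \<open>m\<close> because an envelope
  is known to be projective as long as the module is killed by \<open>e\<^sub>m\<close>, which is
  \<open>f\<^sub>i\<close> for \<open>i = m - 1\<close>, and each cosyzygy raises the index by one.
  A minimal resolution is infinite, so it has to be continued after its projective terms. There
  \<open>DL\<close> replaces \<open>W\<close>; both are duals of left modules
  \<open>L \<epsilon>\<close>, with \<open>\<epsilon> = 1\<close> and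
  \<open>\<epsilon> = 1 - e\<^sub>m\<close>, and one argument treats both. Envelopes come from
  minimising dimensions, so linear algebra over \<open>K\<close> stands in for Zorn's lemma. A
  further obstacle is that injectivity and projectivity are tested in one fixed type, whereas
  \<open>L\<close>, \<open>W\<close> and \<open>DL\<close> live in others; hence the care about
  copies, quotients and biproducts in prescribed types.\<close>

lemma right_moduleI:
  assumes "ring R"
    and "\<zero>\<^bsub>M\<^esub> \<in> carrier M"
    and "\<And>x y. x \<in> carrier M \<Longrightarrow> y \<in> carrier M \<Longrightarrow> x \<oplus>\<^bsub>M\<^esub> y \<in> carrier M"
    and "\<And>x y z. x \<in> carrier M \<Longrightarrow> y \<in> carrier M \<Longrightarrow> z \<in> carrier M \<Longrightarrow>
      (x \<oplus>\<^bsub>M\<^esub> y) \<oplus>\<^bsub>M\<^esub> z = x \<oplus>\<^bsub>M\<^esub> (y \<oplus>\<^bsub>M\<^esub> z)"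
    and "\<And>x y. x \<in> carrier M \<Longrightarrow> y \<in> carrier M \<Longrightarrow> x \<oplus>\<^bsub>M\<^esub> y = y \<oplus>\<^bsub>M\<^esub> x"
    and "\<And>x. x \<in> carrier M \<Longrightarrow> \<zero>\<^bsub>M\<^esub> \<oplus>\<^bsub>M\<^esub> x = x"
    and "\<And>x. x \<in> carrier M \<Longrightarrow> \<exists>y\<in>carrier M. y \<oplus>\<^bsub>M\<^esub> x = \<zero>\<^bsub>M\<^esub>"
    and "\<And>r x. r \<in> carrier R \<Longrightarrow> x \<in> carrier M \<Longrightarrow> r \<odot>\<^bsub>M\<^esub> x \<in> carrier M"
    and "\<And>r s x. r \<in> carrier R \<Longrightarrow> s \<in> carrier R \<Longrightarrow> x \<in> carrier M \<Longrightarrow>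
      (r \<oplus>\<^bsub>R\<^esub> s) \<odot>\<^bsub>M\<^esub> x = (r \<odot>\<^bsub>M\<^esub> x) \<oplus>\<^bsub>M\<^esub> (s \<odot>\<^bsub>M\<^esub> x)"
    and "\<And>r x y. r \<in> carrier R \<Longrightarrow> x \<in> carrier M \<Longrightarrow> y \<in> carrier M \<Longrightarrow>
      r \<odot>\<^bsub>M\<^esub> (x \<oplus>\<^bsub>M\<^esub> y) = (r \<odot>\<^bsub>M\<^esub> x) \<oplus>\<^bsub>M\<^esub> (r \<odot>\<^bsub>M\<^esub> y)"
    and "\<And>r s x. r \<in> carrier R \<Longrightarrow> s \<in> carrier R \<Longrightarrow> x \<in> carrier M \<Longrightarrow>
      (r \<otimes>\<^bsub>R\<^esub> s) \<odot>\<^bsub>M\<^esub> x = s \<odot>\<^bsub>M\<^esub> (r \<odot>\<^bsub>M\<^esub> x)"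
    and "\<And>x. x \<in> carrier M \<Longrightarrow> \<one>\<^bsub>R\<^esub> \<odot>\<^bsub>M\<^esub> x = x"
  shows "right_module R M"
  by (intro right_module.intro right_module_axioms.intro abelian_groupI) (use assms in auto)

lemma right_module_of_module:
  assumes "module R M" shows "right_module R M"
proof -
  interpret module R M by fact
  show ?thesis
  proof (rule right_moduleI)
    show "(c \<otimes>\<^bsub>R\<^esub> d) \<odot>\<^bsub>M\<^esub> x = d \<odot>\<^bsub>M\<^esub> (c \<odot>\<^bsub>M\<^esub> x)"
      if "c \<in> carrier R" "d \<in> carrier R" "x \<in> carrier M" for c d x
      using that by (metis R.m_comm smult_assoc1)
    show "\<exists>y\<in>carrier M. y \<oplus>\<^bsub>M\<^esub> x = \<zero>\<^bsub>M\<^esub>" if "x \<in> carrier M" for x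
      using M.l_neg[OF that] M.a_inv_closed[OF that] by (rule bexI)
  qed (auto simp: R.ring_axioms M.a_ac smult_l_distr smult_r_distr)
qed

lemma (in right_module) smult_zero_ring:
  assumes "x \<in> carrier M" shows "\<zero>\<^bsub>R\<^esub> \<odot>\<^bsub>M\<^esub> x = \<zero>\<^bsub>M\<^esub>"
proof -
  have "\<zero>\<^bsub>R\<^esub> \<odot>\<^bsub>M\<^esub> x \<oplus>\<^bsub>M\<^esub> \<zero>\<^bsub>R\<^esub> \<odot>\<^bsub>M\<^esub> x = \<zero>\<^bsub>R\<^esub> \<odot>\<^bsub>M\<^esub> x"
    using smult_add_ring[of "\<zero>\<^bsub>R\<^esub>" "\<zero>\<^bsub>R\<^esub>" x] assms by simp
  then show ?thesis using assms smult_closed[of "\<zero>\<^bsub>R\<^esub>" x] by (metis M.add.r_cancel_one' R.zero_closed)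
qed

lemma (in right_module) smult_zero_module:
  assumes "r \<in> carrier R" shows "r \<odot>\<^bsub>M\<^esub> \<zero>\<^bsub>M\<^esub> = \<zero>\<^bsub>M\<^esub>"
proof -
  have "r \<odot>\<^bsub>M\<^esub> \<zero>\<^bsub>M\<^esub> \<oplus>\<^bsub>M\<^esub> r \<odot>\<^bsub>M\<^esub> \<zero>\<^bsub>M\<^esub> = r \<odot>\<^bsub>M\<^esub> \<zero>\<^bsub>M\<^esub>"
    using smult_add_module[of r "\<zero>\<^bsub>M\<^esub>" "\<zero>\<^bsub>M\<^esub>"] assms by simp
  then show ?thesis using assms smult_closed[of r "\<zero>\<^bsub>M\<^esub>"] by (metis M.add.r_cancel_one' M.zero_closed)
qed

lemma (in right_module) smult_minus_one:
  assumes "x \<in> carrier M" shows "(\<ominus>\<^bsub>R\<^esub> \<one>\<^bsub>R\<^esub>) \<odot>\<^bsub>M\<^esub> x = \<ominus>\<^bsub>M\<^esub> x"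
proof -
  have "(\<ominus>\<^bsub>R\<^esub> \<one>\<^bsub>R\<^esub>) \<odot>\<^bsub>M\<^esub> x \<oplus>\<^bsub>M\<^esub> x = \<zero>\<^bsub>M\<^esub>"
    using smult_add_ring[of "\<ominus>\<^bsub>R\<^esub> \<one>\<^bsub>R\<^esub>" "\<one>\<^bsub>R\<^esub>" x] assms
    by (simp add: R.l_neg smult_zero_ring smult_one)
  then show ?thesis using assms smult_closed[of "\<ominus>\<^bsub>R\<^esub> \<one>\<^bsub>R\<^esub>" x]
    by (metis M.minus_equality R.add.inv_closed R.one_closed)
qed

text \<open>Closure under negatives is automatic, being closure under the action of -1. The
  predicate \<open>submodule\<close> asks only for an additive subgroup closed under the action, so
  it suits right modules as well as left ones.\<close>

lemma (in right_module) submodule_iff: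
  "submodule H R M \<longleftrightarrow> H \<subseteq> carrier M \<and> \<zero>\<^bsub>M\<^esub> \<in> H \<and> (\<forall>x\<in>H. \<forall>y\<in>H. x \<oplus>\<^bsub>M\<^esub> y \<in> H) \<and>
     (\<forall>r\<in>carrier R. \<forall>x\<in>H. r \<odot>\<^bsub>M\<^esub> x \<in> H)"
proof
  assume "submodule H R M"
  then interpret submodule H R M .
  show "H \<subseteq> carrier M \<and> \<zero>\<^bsub>M\<^esub> \<in> H \<and> (\<forall>x\<in>H. \<forall>y\<in>H. x \<oplus>\<^bsub>M\<^esub> y \<in> H) \<and>
     (\<forall>r\<in>carrier R. \<forall>x\<in>H. r \<odot>\<^bsub>M\<^esub> x \<in> H)"
    using subset one_closed m_closed smult_closed by auto
next
  assume H: "H \<subseteq> carrier M \<and> \<zero>\<^bsub>M\<^esub> \<in> H \<and> (\<forall>x\<in>H. \<forall>y\<in>H. x \<oplus>\<^bsub>M\<^esub> y \<in> H) \<and>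
     (\<forall>r\<in>carrier R. \<forall>x\<in>H. r \<odot>\<^bsub>M\<^esub> x \<in> H)"
  have "\<ominus>\<^bsub>M\<^esub> x \<in> H" if "x \<in> H" for x
    using H that smult_minus_one[of x] by (metis R.add.inv_closed R.one_closed subsetD)
  then show "submodule H R M"
    using H by (intro submodule.intro subgroup.intro submodule_axioms.intro) (auto simp: a_inv_def)
qed

lemma (in right_module) submoduleD:
  assumes "submodule H R M"
  shows "H \<subseteq> carrier M" "\<And>x. x \<in> H \<Longrightarrow> x \<in> carrier M" "\<zero>\<^bsub>M\<^esub> \<in> H"
    "\<And>x y. x \<in> H \<Longrightarrow> y \<in> H \<Longrightarrow> x \<oplus>\<^bsub>M\<^esub> y \<in> H"
    "\<And>r x. r \<in> carrier R \<Longrightarrow> x \<in> H \<Longrightarrow> r \<odot>\<^bsub>M\<^esub> x \<in> H"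
    "\<And>x. x \<in> H \<Longrightarrow> \<ominus>\<^bsub>M\<^esub> x \<in> H"
    "\<And>x y. x \<in> H \<Longrightarrow> y \<in> H \<Longrightarrow> x \<ominus>\<^bsub>M\<^esub> y \<in> H"
proof -
  note * = assms[unfolded submodule_iff]
  show 1: "H \<subseteq> carrier M" "\<And>x. x \<in> H \<Longrightarrow> x \<in> carrier M" "\<zero>\<^bsub>M\<^esub> \<in> H"
    and 2: "\<And>x y. x \<in> H \<Longrightarrow> y \<in> H \<Longrightarrow> x \<oplus>\<^bsub>M\<^esub> y \<in> H"
    and 3: "\<And>r x. r \<in> carrier R \<Longrightarrow> x \<in> H \<Longrightarrow> r \<odot>\<^bsub>M\<^esub> x \<in> H"
    using * by auto
  show 4: "\<ominus>\<^bsub>M\<^esub> x \<in> H" if "x \<in> H" for x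
    using 3[of "\<ominus>\<^bsub>R\<^esub> \<one>\<^bsub>R\<^esub>" x] 1 that smult_minus_one[of x] by auto
  show "\<And>x y. x \<in> H \<Longrightarrow> y \<in> H \<Longrightarrow> x \<ominus>\<^bsub>M\<^esub> y \<in> H"
    using 2 4 by (simp add: a_minus_def)
qed

lemma (in right_module) submodule_carrier: "submodule (carrier M) R M"
  by (auto simp: submodule_iff smult_closed)

lemma (in right_module) submodule_zero: "submodule {\<zero>\<^bsub>M\<^esub>} R M"
  by (auto simp: submodule_iff smult_zero_module)

lemma (in right_module) right_module_sub:
  assumes "submodule H R M"
  shows "right_module R (M\<lparr>carrier := H\<rparr>)"
proof (rule right_moduleI)
  note H = submoduleD[OF assms]
  show "\<exists>y\<in>carrier (M\<lparr>carrier := H\<rparr>). y \<oplus>\<^bsub>M\<lparr>carrier := H\<rparr>\<^esub> x = \<zero>\<^bsub>M\<lparr>carrier := H\<rparr>\<^esub>"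
    if "x \<in> carrier (M\<lparr>carrier := H\<rparr>)" for x
    using that H(2,6) M.l_neg by auto
qed (use submoduleD[OF assms] R.ring_axioms in
      \<open>auto simp: M.a_ac smult_one smult_add_ring smult_add_module smult_assoc\<close>)

lemma (in right_module) submodule_sub:
  assumes "submodule H R M"
  shows "submodule N R (M\<lparr>carrier := H\<rparr>) \<longleftrightarrow> submodule N R M \<and> N \<subseteq> H"
  using right_module.submodule_iff[OF right_module_sub[OF assms], of N]
    submodule_iff[of N] submoduleD(1)[OF assms] by auto

lemma (in right_module) minus_eq_zero:
  assumes "x \<in> carrier M" "y \<in> carrier M"
  shows "x \<ominus>\<^bsub>M\<^esub> y = \<zero>\<^bsub>M\<^esub> \<longleftrightarrow> x = y"
  using assms M.add.inv_solve_right'[of "\<zero>\<^bsub>M\<^esub>" x y] by (auto simp: a_minus_def)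

lemma (in right_module) minus_zero_right:
  assumes "x \<in> carrier M" shows "x \<ominus>\<^bsub>M\<^esub> \<zero>\<^bsub>M\<^esub> = x"
  using assms M.add.inv_one by (simp add: a_minus_def)

lemma (in right_module) diff_add_cancel:
  assumes "x \<in> carrier M" "y \<in> carrier M"
  shows "(x \<ominus>\<^bsub>M\<^esub> y) \<oplus>\<^bsub>M\<^esub> y = x"
  using assms by (simp add: a_minus_def M.a_assoc M.l_neg)

lemma right_module_product:
  assumes "right_module R M" "right_module R N"
  shows "right_module R \<lparr>carrier = carrier M \<times> carrier N, monoid.mult = undefined, one = undefined,
    ring.zero = (\<zero>\<^bsub>M\<^esub>, \<zero>\<^bsub>N\<^esub>), add = (\<lambda>p q. (fst p \<oplus>\<^bsub>M\<^esub> fst q, snd p \<oplus>\<^bsub>N\<^esub> snd q)),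
    smult = (\<lambda>r p. (r \<odot>\<^bsub>M\<^esub> fst p, r \<odot>\<^bsub>N\<^esub> snd p))\<rparr>" (is "right_module R ?P")
proof -
  interpret M: right_module R M by fact
  interpret N: right_module R N by fact
  show ?thesis
  proof (rule right_moduleI)
    fix x assume "x \<in> carrier ?P"
    then show "\<exists>y\<in>carrier ?P. y \<oplus>\<^bsub>?P\<^esub> x = \<zero>\<^bsub>?P\<^esub>"
      by (intro bexI[of _ "(\<ominus>\<^bsub>M\<^esub> fst x, \<ominus>\<^bsub>N\<^esub> snd x)"]) (auto simp: M.M.l_neg N.M.l_neg)
  qed (auto simp: M.M.a_ac N.M.a_ac M.smult_closed N.smult_closed
      M.smult_add_ring N.smult_add_ring M.smult_add_module N.smult_add_module
      M.smult_assoc N.smult_assoc M.smult_one N.smult_one M.R.ring_axioms)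
qed


subsection \<open>Homomorphisms\<close>

lemma mod_homI:
  assumes "\<And>x. x \<in> carrier M \<Longrightarrow> f x \<in> carrier N"
    and "\<And>x y. x \<in> carrier M \<Longrightarrow> y \<in> carrier M \<Longrightarrow> f (x \<oplus>\<^bsub>M\<^esub> y) = f x \<oplus>\<^bsub>N\<^esub> f y"
    and "\<And>r x. r \<in> carrier R \<Longrightarrow> x \<in> carrier M \<Longrightarrow> f (r \<odot>\<^bsub>M\<^esub> x) = r \<odot>\<^bsub>N\<^esub> f x"
  shows "f \<in> mod_hom R M N"
  using assms by (auto simp: mod_hom_def)

lemma mod_homD:
  assumes "f \<in> mod_hom R M N"
  shows "\<And>x. x \<in> carrier M \<Longrightarrow> f x \<in> carrier N"
    and "\<And>x y. x \<in> carrier M \<Longrightarrow> y \<in> carrier M \<Longrightarrow> f (x \<oplus>\<^bsub>M\<^esub> y) = f x \<oplus>\<^bsub>N\<^esub> f y"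
    and "\<And>r x. r \<in> carrier R \<Longrightarrow> x \<in> carrier M \<Longrightarrow> f (r \<odot>\<^bsub>M\<^esub> x) = r \<odot>\<^bsub>N\<^esub> f x"
  using assms by (auto simp: mod_hom_def)

lemma mod_hom_comp:
  assumes "f \<in> mod_hom R M N" "g \<in> mod_hom R N P"
  shows "(\<lambda>x. g (f x)) \<in> mod_hom R M P"
  using mod_homD[OF assms(1)] mod_homD[OF assms(2)] by (intro mod_homI) auto

lemma mod_hom_cong:
  assumes "f \<in> mod_hom R M N" "\<And>x. x \<in> carrier M \<Longrightarrow> f x = g x"
    "right_module R M"
  shows "g \<in> mod_hom R M N"
proof -
  interpret right_module R M by fact
  show ?thesis
    using mod_homD[OF assms(1)] by (intro mod_homI) (auto simp flip: assms(2) simp: smult_closed)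
qed

lemma mod_hom_restrict:
  assumes "f \<in> mod_hom R M N" "H \<subseteq> carrier M"
  shows "f \<in> mod_hom R (M\<lparr>carrier := H\<rparr>) N"
  using assms by (auto simp: mod_hom_def subset_iff)

lemma mod_hom_codomain_sub:
  "f \<in> mod_hom R M (N\<lparr>carrier := H\<rparr>) \<Longrightarrow> H \<subseteq> carrier N \<Longrightarrow> f \<in> mod_hom R M N"
  "f \<in> mod_hom R M N \<Longrightarrow> f ` carrier M \<subseteq> H \<Longrightarrow> f \<in> mod_hom R M (N\<lparr>carrier := H\<rparr>)"
  by (auto simp: mod_hom_def Pi_iff)

lemma mod_hom_sub_id: "H \<subseteq> carrier M \<Longrightarrow> (\<lambda>x. x) \<in> mod_hom R (M\<lparr>carrier := H\<rparr>) M"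
  by (auto simp: mod_hom_def)

locale right_module_hom = dom: right_module R M + cod: right_module R N
  for R (structure) and M :: "('r, 'x) module" and N :: "('r, 'y) module" +
  fixes f assumes hom: "f \<in> mod_hom R M N"
begin

lemma closed: "x \<in> carrier M \<Longrightarrow> f x \<in> carrier N"
  and add: "x \<in> carrier M \<Longrightarrow> y \<in> carrier M \<Longrightarrow> f (x \<oplus>\<^bsub>M\<^esub> y) = f x \<oplus>\<^bsub>N\<^esub> f y"
  and smult: "r \<in> carrier R \<Longrightarrow> x \<in> carrier M \<Longrightarrow> f (r \<odot>\<^bsub>M\<^esub> x) = r \<odot>\<^bsub>N\<^esub> f x"
  using mod_homD[OF hom] by auto

lemma zero: "f \<zero>\<^bsub>M\<^esub> = \<zero>\<^bsub>N\<^esub>"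
  using smult[of "\<zero>\<^bsub>R\<^esub>" "\<zero>\<^bsub>M\<^esub>"] closed[of "\<zero>\<^bsub>M\<^esub>"]
  by (simp add: dom.smult_zero_ring cod.smult_zero_ring)

lemma uminus: "x \<in> carrier M \<Longrightarrow> f (\<ominus>\<^bsub>M\<^esub> x) = \<ominus>\<^bsub>N\<^esub> f x"
  using smult[of "\<ominus>\<^bsub>R\<^esub> \<one>\<^bsub>R\<^esub>" x] closed[of x] by (simp add: dom.smult_minus_one cod.smult_minus_one)

lemma minus: "x \<in> carrier M \<Longrightarrow> y \<in> carrier M \<Longrightarrow> f (x \<ominus>\<^bsub>M\<^esub> y) = f x \<ominus>\<^bsub>N\<^esub> f y"
  by (simp add: a_minus_def add uminus)

lemma submodule_vimage:
  assumes "submodule H R N" shows "submodule {x \<in> carrier M. f x \<in> H} R M"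
  using cod.submoduleD[OF assms] by (auto simp: dom.submodule_iff closed add smult zero dom.smult_closed)

lemma submodule_kernel: "submodule {x \<in> carrier M. f x = \<zero>\<^bsub>N\<^esub>} R M"
  using submodule_vimage[OF cod.submodule_zero] by simp

lemma submodule_image:
  assumes "submodule H R M" shows "submodule (f ` H) R N"
  unfolding cod.submodule_iff
proof (intro conjI ballI)
  note H = dom.submoduleD[OF assms]
  show "f ` H \<subseteq> carrier N" using H closed by auto
  show "\<zero>\<^bsub>N\<^esub> \<in> f ` H" using H(3) zero by force
  show "x \<oplus>\<^bsub>N\<^esub> y \<in> f ` H" if "x \<in> f ` H" "y \<in> f ` H" for x y
    using that H add by (force simp flip: add)
  show "r \<odot>\<^bsub>N\<^esub> x \<in> f ` H" if "r \<in> carrier R" "x \<in> f ` H" for r x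
    using that H smult by (force simp flip: smult)
qed

lemma inj_on_iff:
  assumes "submodule H R M"
  shows "inj_on f H \<longleftrightarrow> (\<forall>x\<in>H. f x = \<zero>\<^bsub>N\<^esub> \<longrightarrow> x = \<zero>\<^bsub>M\<^esub>)"
proof
  assume "inj_on f H"
  then show "\<forall>x\<in>H. f x = \<zero>\<^bsub>N\<^esub> \<longrightarrow> x = \<zero>\<^bsub>M\<^esub>"
    using zero dom.submoduleD(3)[OF assms] by (metis inj_onD)
next
  assume *: "\<forall>x\<in>H. f x = \<zero>\<^bsub>N\<^esub> \<longrightarrow> x = \<zero>\<^bsub>M\<^esub>"
  note H = dom.submoduleD[OF assms]
  show "inj_on f H"
  proof (rule inj_onI)
    fix x y assume xy: "x \<in> H" "y \<in> H" "f x = f y"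
    then have "f (x \<ominus>\<^bsub>M\<^esub> y) = \<zero>\<^bsub>N\<^esub>"
      using H(2) closed by (simp add: minus cod.minus_eq_zero)
    then show "x = y" using * xy H(2,7) dom.minus_eq_zero by blast
  qed
qed

lemma inj_iff: "inj_on f (carrier M) \<longleftrightarrow> (\<forall>x\<in>carrier M. f x = \<zero>\<^bsub>N\<^esub> \<longrightarrow> x = \<zero>\<^bsub>M\<^esub>)"
  by (rule inj_on_iff[OF dom.submodule_carrier])

lemma finsum:
  assumes "g \<in> S \<rightarrow> carrier M" "finite S"
  shows "f (finsum M g S) = finsum N (\<lambda>s. f (g s)) S"
  using assms(2,1) by induction (auto simp: zero add closed Pi_iff)

end

lemma right_module_hom_intro:
  "right_module R M \<Longrightarrow> right_module R N \<Longrightarrow> f \<in> mod_hom R M N \<Longrightarrow> right_module_hom R M N f"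
  by (simp add: right_module_hom_def right_module_hom_axioms_def)

lemma mod_hom_inv_into:
  assumes "right_module R M" "f \<in> mod_hom R M N" "inj_on f (carrier M)"
  shows "inv_into (carrier M) f \<in> mod_hom R (N\<lparr>carrier := f ` carrier M\<rparr>) M"
proof -
  interpret right_module R M by fact
  note f = mod_homD[OF assms(2)] and inv = inv_into_f_f[OF assms(3)]
  show ?thesis
    by (rule mod_homI) (auto simp: inv smult_closed simp flip: f(2,3))
qed

text \<open>Realises a quotient of \<open>M\<close> on any set that is the image of a map with the right fibres: with
  representatives as values this gives quotients in the type of \<open>M\<close>, and with an injective map
  isomorphic copies of \<open>M\<close> in other types.\<close>

lemma (in right_module) quotient_along:
  fixes g :: "'x \<Rightarrow> 'y"
  assumes H: "submodule H R M"
    and g: "\<And>x y. x \<in> carrier M \<Longrightarrow> y \<in> carrier M \<Longrightarrow> g x = g y \<longleftrightarrow> x \<ominus>\<^bsub>M\<^esub> y \<in> H"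
  obtains N where "right_module R N" "g \<in> mod_hom R M N" "g ` carrier M = carrier N"
    "{x \<in> carrier M. g x = \<zero>\<^bsub>N\<^esub>} = H"
proof -
  note HD = submoduleD[OF H]
  define s where "s = inv_into (carrier M) g"
  define N :: "('r, 'y) module" where "N = \<lparr>carrier = g ` carrier M, monoid.mult = undefined, one = undefined,
    ring.zero = g \<zero>\<^bsub>M\<^esub>, add = (\<lambda>u v. g (s u \<oplus>\<^bsub>M\<^esub> s v)), smult = (\<lambda>r u. g (r \<odot>\<^bsub>M\<^esub> s u))\<rparr>"
  \<comment> \<open>The chosen preimage of \<open>g x\<close> differs from \<open>x\<close> by an
    element of \<open>H\<close>, so the transported operations do not depend on the choice.\<close>
  have s: "s (g x) \<in> carrier M" "s (g x) \<ominus>\<^bsub>M\<^esub> x \<in> H" if "x \<in> carrier M" for x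
    using that g[of "s (g x)" x] unfolding s_def
    by (auto simp: inv_into_into f_inv_into_f)
  have add: "g x \<oplus>\<^bsub>N\<^esub> g y = g (x \<oplus>\<^bsub>M\<^esub> y)" if xy: "x \<in> carrier M" "y \<in> carrier M" for x y
  proof -
    have "(s (g x) \<oplus>\<^bsub>M\<^esub> s (g y)) \<ominus>\<^bsub>M\<^esub> (x \<oplus>\<^bsub>M\<^esub> y) = (s (g x) \<ominus>\<^bsub>M\<^esub> x) \<oplus>\<^bsub>M\<^esub> (s (g y) \<ominus>\<^bsub>M\<^esub> y)"
      using xy s(1) by (simp add: a_minus_def M.minus_add M.a_ac)
    then show ?thesis using xy s HD(4) by (simp add: N_def g)
  qed
  have smult: "r \<odot>\<^bsub>N\<^esub> g x = g (r \<odot>\<^bsub>M\<^esub> x)" if xy: "r \<in> carrier R" "x \<in> carrier M" for r x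
  proof -
    have "(r \<odot>\<^bsub>M\<^esub> (s (g x) \<ominus>\<^bsub>M\<^esub> x)) \<oplus>\<^bsub>M\<^esub> (r \<odot>\<^bsub>M\<^esub> x) = r \<odot>\<^bsub>M\<^esub> s (g x)"
      using xy s(1)[of x] diff_add_cancel[of "s (g x)" x] by (simp flip: smult_add_module)
    then have "(r \<odot>\<^bsub>M\<^esub> s (g x)) \<ominus>\<^bsub>M\<^esub> (r \<odot>\<^bsub>M\<^esub> x) = r \<odot>\<^bsub>M\<^esub> (s (g x) \<ominus>\<^bsub>M\<^esub> x)"
      using xy s(1)[of x] smult_closed
      by (metis M.add.inv_solve_right' M.minus_closed a_minus_def)
    then show ?thesis using xy s HD(5) smult_closed by (simp add: N_def g)
  qed
  have carN: "carrier N = g ` carrier M" and zN: "\<zero>\<^bsub>N\<^esub> = g \<zero>\<^bsub>M\<^esub>" by (simp_all add: N_def)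
  have N: "right_module R N"
  proof (rule right_moduleI)
    show "ring R" by (rule R.ring_axioms)
    fix x assume "x \<in> carrier N"
    then obtain x' where "x' \<in> carrier M" "x = g x'" by (auto simp: carN)
    then show "\<exists>y\<in>carrier N. y \<oplus>\<^bsub>N\<^esub> x = \<zero>\<^bsub>N\<^esub>"
      by (intro bexI[of _ "g (\<ominus>\<^bsub>M\<^esub> x')"]) (auto simp: add zN M.l_neg carN)
  qed (auto simp: carN zN add smult smult_closed M.a_ac smult_one
      smult_add_ring smult_add_module smult_assoc)
  have "{x \<in> carrier M. g x = \<zero>\<^bsub>N\<^esub>} = H"
    using g[of _ "\<zero>\<^bsub>M\<^esub>"] HD(2) by (auto simp: zN minus_zero_right)
  moreover have "g \<in> mod_hom R M N"
    by (intro mod_homI) (auto simp: carN add smult)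
  ultimately show ?thesis using that N carN by simp
qed

text \<open>Cosets are replaced by chosen representatives, so that a quotient stays in the type of
  \<open>M\<close>. This keeps all terms of a resolution in one type.\<close>

lemma (in right_module) obtain_quotient:
  assumes H: "submodule H R M"
  obtains g :: "'x \<Rightarrow> 'x" and N :: "('r, 'x) module" where "right_module R N" "g \<in> mod_hom R M N" "g ` carrier M = carrier N"
    "{x \<in> carrier M. g x = \<zero>\<^bsub>N\<^esub>} = H"
proof -
  note HD = submoduleD[OF H]
  define g where "g x = (SOME y. y \<in> carrier M \<and> x \<ominus>\<^bsub>M\<^esub> y \<in> H)" for x
  have gx: "g x \<in> carrier M \<and> x \<ominus>\<^bsub>M\<^esub> g x \<in> H" if "x \<in> carrier M" for x
    unfolding g_def by (rule someI[of _ x]) (use that HD(3) minus_eq_zero[of x x] in simp)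
  have tri: "a \<ominus>\<^bsub>M\<^esub> c = (a \<ominus>\<^bsub>M\<^esub> b) \<oplus>\<^bsub>M\<^esub> (b \<ominus>\<^bsub>M\<^esub> c)"
    if "a \<in> carrier M" "b \<in> carrier M" "c \<in> carrier M" for a b c
    using that by (simp add: a_minus_def M.a_assoc[symmetric]) (simp add: M.a_assoc M.l_neg)
  have sym: "b \<ominus>\<^bsub>M\<^esub> a \<in> H" if "a \<ominus>\<^bsub>M\<^esub> b \<in> H" "a \<in> carrier M" "b \<in> carrier M" for a b
    using HD(6)[OF that(1)] that(2,3) by (simp add: a_minus_def M.minus_add M.a_comm)
  have "g x = g y \<longleftrightarrow> x \<ominus>\<^bsub>M\<^esub> y \<in> H" if xy: "x \<in> carrier M" "y \<in> carrier M" for x y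
  proof
    assume "g x = g y"
    then show "x \<ominus>\<^bsub>M\<^esub> y \<in> H"
      using tri[of x "g x" y] gx[of x] gx[of y] sym[of y "g y"] xy HD(4) by auto
  next
    assume *: "x \<ominus>\<^bsub>M\<^esub> y \<in> H"
    \<comment> \<open>Congruent elements satisfy the same predicate under \<open>SOME\<close>, hence
      have the same representative.\<close>
    have "x \<ominus>\<^bsub>M\<^esub> z \<in> H \<longleftrightarrow> y \<ominus>\<^bsub>M\<^esub> z \<in> H" if "z \<in> carrier M" for z
      using tri[of x y z] tri[of y x z] * sym[OF *] xy that HD(4) by metis
    then show "g x = g y" unfolding g_def by meson
  qed
  from quotient_along[OF H this] obtain N where "right_module R N" "g \<in> mod_hom R M N"
    "g ` carrier M = carrier N" "{x \<in> carrier M. g x = \<zero>\<^bsub>N\<^esub>} = H" by blast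
  then show ?thesis by (rule that)
qed

lemma (in right_module) obtain_copy:
  assumes "inj_on g (carrier M)"
  obtains N where "right_module R N" "g \<in> mod_hom R M N" "g ` carrier M = carrier N"
proof -
  have "g x = g y \<longleftrightarrow> x \<ominus>\<^bsub>M\<^esub> y \<in> {\<zero>\<^bsub>M\<^esub>}" if "x \<in> carrier M" "y \<in> carrier M" for x y
    using assms that by (auto simp: minus_eq_zero inj_on_eq_iff)
  from quotient_along[OF submodule_zero this] obtain N where "right_module R N"
    "g \<in> mod_hom R M N" "g ` carrier M = carrier N" by (metis (no_types, lifting))
  then show ?thesis by (rule that)
qed


subsection \<open>Finite generation\<close>

text \<open>Spanning without linear combinations: a property holds on all of \<open>M\<close> as
  soon as the elements having it form a submodule that contains \<open>S\<close>. Arguments on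
  generators below use this as an induction principle.\<close>

definition generates :: "('r, 'b) ring_scheme \<Rightarrow> ('r, 'x) module \<Rightarrow> 'x set \<Rightarrow> bool" where
  "generates R M S \<longleftrightarrow> S \<subseteq> carrier M \<and> (\<forall>H. submodule H R M \<and> S \<subseteq> H \<longrightarrow> H = carrier M)"

lemma generatesD:
  "generates R M S \<Longrightarrow> S \<subseteq> carrier M"
  "generates R M S \<Longrightarrow> submodule H R M \<Longrightarrow> S \<subseteq> H \<Longrightarrow> H = carrier M"
  by (auto simp: generates_def)

lemma finitely_generated_iff: "finitely_generated R M \<longleftrightarrow> (\<exists>S. finite S \<and> generates R M S)"
  by (auto simp: finitely_generated_def generates_def)

lemma (in right_module_hom) generates_image:
  assumes "generates R M S" "f ` carrier M = carrier N"
  shows "generates R N (f ` S)"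
  unfolding generates_def
proof (intro conjI allI impI)
  show "f ` S \<subseteq> carrier N" using assms by (auto simp: generates_def)
  fix H assume H: "submodule H R N \<and> f ` S \<subseteq> H"
  have "{x \<in> carrier M. f x \<in> H} = carrier M"
    by (rule generatesD(2)[OF assms(1) submodule_vimage]) (use H generatesD(1)[OF assms(1)] in auto)
  then have "f ` carrier M \<subseteq> H" by auto
  moreover have "H \<subseteq> carrier N" using H cod.submoduleD(1) by simp
  ultimately show "H = carrier N" using assms(2) by simp
qed

lemma (in right_module_hom) finitely_generated_image:
  assumes "finitely_generated R M" "f ` carrier M = carrier N"
  shows "finitely_generated R N"
  using assms generates_image unfolding finitely_generated_iff by (meson finite_imageI)

lemma regular_module_simps [simp]:
  "carrier (regular_module R) = carrier R" "\<zero>\<^bsub>regular_module R\<^esub> = \<zero>\<^bsub>R\<^esub>"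
  "x \<oplus>\<^bsub>regular_module R\<^esub> y = x \<oplus>\<^bsub>R\<^esub> y" "r \<odot>\<^bsub>regular_module R\<^esub> x = x \<otimes>\<^bsub>R\<^esub> r"
  by (simp_all add: regular_module_def)

lemma (in ring) right_module_regular: "right_module R (regular_module R)"
proof (rule right_moduleI)
  show "\<exists>y\<in>carrier (regular_module R). y \<oplus>\<^bsub>regular_module R\<^esub> x = \<zero>\<^bsub>regular_module R\<^esub>"
    if "x \<in> carrier (regular_module R)" for x
    using that l_neg[of x] by auto
qed (auto simp: a_ac m_assoc l_distr r_distr ring_axioms)

lemma (in right_module) submodule_finsum:
  assumes "submodule H R M" "g \<in> S \<rightarrow> H"
  shows "finsum M g S \<in> H"
  using assms(2)
proof (induction S rule: infinite_finite_induct)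
  case (insert s S)
  note H = submoduleD[OF assms(1)]
  have "g \<in> S \<rightarrow> carrier M" "g s \<in> carrier M" using insert.prems H(2) by auto
  then show ?case using insert H(4) by (auto simp: M.finsum_insert)
qed (auto simp: submoduleD(3)[OF assms(1)])

lemma (in right_module) submodule_Inter:
  assumes "\<H> \<noteq> {}" "\<And>H. H \<in> \<H> \<Longrightarrow> submodule H R M"
  shows "submodule (\<Inter>\<H>) R M"
proof -
  note H = submoduleD[OF assms(2)]
  show ?thesis
    unfolding submodule_iff using assms(1) by (auto intro: H(3,4,5)) (use H(2) in blast)
qed

section \<open>Finite dimensional vector spaces\<close>

text \<open>As \<open>K\<close> is commutative, a vector space is in particular a right module.\<close>

locale vspace = K: field K + right_module K V
  for K :: "'k ring" (structure) and V :: "('k, 'v) module"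
begin

lemma smult_comm:
  assumes "c \<in> carrier K" "d \<in> carrier K" "x \<in> carrier V"
  shows "c \<odot>\<^bsub>V\<^esub> (d \<odot>\<^bsub>V\<^esub> x) = d \<odot>\<^bsub>V\<^esub> (c \<odot>\<^bsub>V\<^esub> x)"
  using assms smult_assoc[of c d x] smult_assoc[of d c x] by (simp add: K.m_comm)

lemma smult_hom: "c \<in> carrier K \<Longrightarrow> (\<lambda>x. c \<odot>\<^bsub>V\<^esub> x) \<in> mod_hom K V V"
  by (intro mod_homI) (auto simp: smult_closed smult_add_module smult_comm)

text \<open>If \<open>x\<close> is not in \<open>U\<close>, then \<open>u + c x\<close> determines
  \<open>u\<close> and \<open>c\<close>, because differences of coefficients can be inverted in
  \<open>K\<close>; so the value \<open>t\<close> at \<open>x\<close> can be prescribed. The target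
  is an arbitrary module, which covers functionals as well as retractions onto subspaces.\<close>

lemma extend_linear_one:
  assumes T: "right_module K T" and U: "submodule U K V" and f: "f \<in> mod_hom K (V\<lparr>carrier := U\<rparr>) T"
    and x: "x \<in> carrier V" and t: "t \<in> carrier T"
  obtains U' g where "submodule U' K V" "U \<subseteq> U'" "x \<in> U'" "g \<in> mod_hom K (V\<lparr>carrier := U'\<rparr>) T"
    "\<And>u. u \<in> U \<Longrightarrow> g u = f u" "x \<notin> U \<Longrightarrow> g x = t"
proof (cases "x \<in> U")
  case True
  then show ?thesis using that[of U f] U f by simp
next
  case False
  interpret T: right_module K T by fact
  note UD = submoduleD[OF U] and fD = mod_homD[OF f, simplified]
  define U' where "U' = {u \<oplus>\<^bsub>V\<^esub> c \<odot>\<^bsub>V\<^esub> x | u c. u \<in> U \<and> c \<in> carrier K}"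
  have unique: "u = u' \<and> c = c'"
    if "u \<in> U" "u' \<in> U" "c \<in> carrier K" "c' \<in> carrier K" and eq: "u \<oplus>\<^bsub>V\<^esub> c \<odot>\<^bsub>V\<^esub> x = u' \<oplus>\<^bsub>V\<^esub> c' \<odot>\<^bsub>V\<^esub> x"
    for u u' c c'
  proof -
    have cx: "c \<odot>\<^bsub>V\<^esub> x \<in> carrier V" "c' \<odot>\<^bsub>V\<^esub> x \<in> carrier V" using that x by (auto simp: smult_closed)
    have "c = c'"
    proof (rule ccontr)
      assume ne: "c \<noteq> c'"
      define d where "d = c \<ominus>\<^bsub>K\<^esub> c'"
      have d: "d \<in> carrier K" "d \<noteq> \<zero>\<^bsub>K\<^esub>" using that ne by (auto simp: d_def)
      have "d \<odot>\<^bsub>V\<^esub> x \<oplus>\<^bsub>V\<^esub> (c' \<odot>\<^bsub>V\<^esub> x) = c \<odot>\<^bsub>V\<^esub> x"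
        using that x d by (simp flip: smult_add_ring add: d_def a_minus_def K.a_assoc K.l_neg)
      then have "u \<oplus>\<^bsub>V\<^esub> d \<odot>\<^bsub>V\<^esub> x = u'"
        using eq cx that UD(2) d(1) x by (metis M.add.m_assoc M.add.right_cancel M.add.m_closed smult_closed)
      then have "d \<odot>\<^bsub>V\<^esub> x = u' \<ominus>\<^bsub>V\<^esub> u"
        using that UD(2) d x by (metis M.a_comm M.add.inv_solve_right a_minus_def smult_closed)
      then have "d \<odot>\<^bsub>V\<^esub> x \<in> U" using UD(7) that by simp
      then have "(inv\<^bsub>K\<^esub> d) \<odot>\<^bsub>V\<^esub> (d \<odot>\<^bsub>V\<^esub> x) \<in> U" using UD(5) d K.field_Units by simp
      moreover have "(inv\<^bsub>K\<^esub> d) \<odot>\<^bsub>V\<^esub> (d \<odot>\<^bsub>V\<^esub> x) = x"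
        using d x K.field_Units by (simp flip: smult_assoc add: smult_one)
      ultimately show False using False by simp
    qed
    then show ?thesis using eq that UD(2) cx by (metis M.add.right_cancel)
  qed
  define dec where "dec y = (SOME p. fst p \<in> U \<and> snd p \<in> carrier K \<and> y = fst p \<oplus>\<^bsub>V\<^esub> snd p \<odot>\<^bsub>V\<^esub> x)" for y
  have dec: "dec (u \<oplus>\<^bsub>V\<^esub> c \<odot>\<^bsub>V\<^esub> x) = (u, c)" if "u \<in> U" "c \<in> carrier K" for u c
    unfolding dec_def by (rule some_equality) (use that unique in auto)
  define g where "g y = f (fst (dec y)) \<oplus>\<^bsub>T\<^esub> snd (dec y) \<odot>\<^bsub>T\<^esub> t" for y
  have g: "g (u \<oplus>\<^bsub>V\<^esub> c \<odot>\<^bsub>V\<^esub> x) = f u \<oplus>\<^bsub>T\<^esub> c \<odot>\<^bsub>T\<^esub> t" if "u \<in> U" "c \<in> carrier K" for u c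
    using that by (simp add: g_def dec)
  have sm: "c \<odot>\<^bsub>V\<^esub> (u \<oplus>\<^bsub>V\<^esub> d \<odot>\<^bsub>V\<^esub> x) = c \<odot>\<^bsub>V\<^esub> u \<oplus>\<^bsub>V\<^esub> (d \<otimes>\<^bsub>K\<^esub> c) \<odot>\<^bsub>V\<^esub> x"
    if "u \<in> U" "c \<in> carrier K" "d \<in> carrier K" for u c d
    using that x UD(2) by (simp add: smult_add_module smult_closed smult_assoc)
  have ad: "(u \<oplus>\<^bsub>V\<^esub> c \<odot>\<^bsub>V\<^esub> x) \<oplus>\<^bsub>V\<^esub> (u' \<oplus>\<^bsub>V\<^esub> c' \<odot>\<^bsub>V\<^esub> x) = (u \<oplus>\<^bsub>V\<^esub> u') \<oplus>\<^bsub>V\<^esub> (c \<oplus>\<^bsub>K\<^esub> c') \<odot>\<^bsub>V\<^esub> x"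
    if "u \<in> U" "u' \<in> U" "c \<in> carrier K" "c' \<in> carrier K" for u u' c c'
    using that x UD(2) by (simp add: smult_add_ring smult_closed M.a_ac)
  have U'I: "u \<oplus>\<^bsub>V\<^esub> c \<odot>\<^bsub>V\<^esub> x \<in> U'" if "u \<in> U" "c \<in> carrier K" for u c
    using that by (auto simp: U'_def)
  have U'E: "\<exists>u c. u \<in> U \<and> c \<in> carrier K \<and> y = u \<oplus>\<^bsub>V\<^esub> c \<odot>\<^bsub>V\<^esub> x" if "y \<in> U'" for y
    using that by (auto simp: U'_def)
  have U_eq: "u \<oplus>\<^bsub>V\<^esub> \<zero>\<^bsub>K\<^esub> \<odot>\<^bsub>V\<^esub> x = u" if "u \<in> U" for u
    using that x UD(2) by (simp add: smult_zero_ring)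
  have x_eq: "\<zero>\<^bsub>V\<^esub> \<oplus>\<^bsub>V\<^esub> \<one>\<^bsub>K\<^esub> \<odot>\<^bsub>V\<^esub> x = x"
    using x by (simp add: smult_one)
  have sub: "U \<subseteq> U'" using U'I[of _ "\<zero>\<^bsub>K\<^esub>"] U_eq by (metis K.zero_closed subsetI)
  have xU': "x \<in> U'" using U'I[of "\<zero>\<^bsub>V\<^esub>" "\<one>\<^bsub>K\<^esub>"] x_eq UD(3) by simp
  have sU': "submodule U' K V"
    unfolding submodule_iff
  proof (intro conjI ballI)
    show "U' \<subseteq> carrier V" using UD(2) x by (auto simp: U'_def smult_closed)
    show "\<zero>\<^bsub>V\<^esub> \<in> U'" using sub UD(3) by auto
  next
    fix y z assume "y \<in> U'" "z \<in> U'"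
    then show "y \<oplus>\<^bsub>V\<^esub> z \<in> U'" using U'E[of y] U'E[of z] ad U'I UD(4) by force
  next
    fix r y assume "r \<in> carrier K" "y \<in> U'"
    then show "r \<odot>\<^bsub>V\<^esub> y \<in> U'" using U'E[of y] sm U'I UD(5) by force
  qed
  have hg: "g \<in> mod_hom K (V\<lparr>carrier := U'\<rparr>) T"
  proof (rule mod_homI; simp)
    fix y assume "y \<in> U'"
    then show "g y \<in> carrier T" using U'E[of y] g fD(1) t T.smult_closed by force
  next
    fix y z assume "y \<in> U'" "z \<in> U'"
    then obtain u c u' c' where y: "u \<in> U" "c \<in> carrier K" "y = u \<oplus>\<^bsub>V\<^esub> c \<odot>\<^bsub>V\<^esub> x"
      and z: "u' \<in> U" "c' \<in> carrier K" "z = u' \<oplus>\<^bsub>V\<^esub> c' \<odot>\<^bsub>V\<^esub> x" using U'E by meson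
    show "g (y \<oplus>\<^bsub>V\<^esub> z) = g y \<oplus>\<^bsub>T\<^esub> g z"
      using y(1,2) z(1,2) unfolding y(3) z(3)
      by (simp add: ad g UD(4) fD t T.smult_add_ring T.smult_closed T.M.a_ac)
  next
    fix r y assume r: "r \<in> carrier K" and "y \<in> U'"
    then obtain u c where y: "u \<in> U" "c \<in> carrier K" "y = u \<oplus>\<^bsub>V\<^esub> c \<odot>\<^bsub>V\<^esub> x" using U'E by meson
    show "g (r \<odot>\<^bsub>V\<^esub> y) = r \<odot>\<^bsub>T\<^esub> g y"
      using y(1,2) r unfolding y(3)
      by (simp add: sm g UD(5) fD t T.smult_add_module T.smult_closed T.smult_assoc)
  qed
  have "g u = f u" if "u \<in> U" for u
    using that g[of u "\<zero>\<^bsub>K\<^esub>"] U_eq[of u] fD(1) t by (simp add: T.smult_zero_ring)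
  moreover have "g x = t"
  proof -
    interpret right_module_hom K "V\<lparr>carrier := U\<rparr>" T f
      by (intro right_module_hom_intro right_module_sub U T f)
    show ?thesis using g[of "\<zero>\<^bsub>V\<^esub>" "\<one>\<^bsub>K\<^esub>"] x_eq zero UD(3) t by (simp add: T.smult_one)
  qed
  ultimately show ?thesis using that[OF sU' sub xU' hg] by blast
qed

lemma extend_linear:
  assumes T: "right_module K T" and U: "submodule U K V" and f: "f \<in> mod_hom K (V\<lparr>carrier := U\<rparr>) T"
    and fg: "finitely_generated K V"
  obtains g where "g \<in> mod_hom K V T" "\<And>u. u \<in> U \<Longrightarrow> g u = f u"
proof -
  obtain S where S: "finite S" "generates K V S" using fg by (auto simp: finitely_generated_iff)
  have "\<exists>U' g. submodule U' K V \<and> U \<subseteq> U' \<and> F \<subseteq> U' \<and> g \<in> mod_hom K (V\<lparr>carrier := U'\<rparr>) T \<and>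
      (\<forall>u\<in>U. g u = f u)" if "finite F" "F \<subseteq> carrier V" for F
    using that
  proof induction
    case empty
    then show ?case using U f by (intro exI[of _ U] exI[of _ f]) auto
  next
    case (insert x F)
    then obtain U' g where *: "submodule U' K V" "U \<subseteq> U'" "F \<subseteq> U'" "g \<in> mod_hom K (V\<lparr>carrier := U'\<rparr>) T"
      "\<forall>u\<in>U. g u = f u" by auto
    interpret T: right_module K T by fact
    \<comment> \<open>Any value at \<open>x\<close> would do; zero is taken.\<close>
    obtain U'' g' where "submodule U'' K V" "U' \<subseteq> U''" "x \<in> U''" "g' \<in> mod_hom K (V\<lparr>carrier := U''\<rparr>) T"
      "\<And>u. u \<in> U' \<Longrightarrow> g' u = g u"
      using extend_linear_one[OF T *(1,4) _ T.M.zero_closed, of x] insert.prems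
      by (metis insert_subset)
    then show ?case using * by (intro exI[of _ U''] exI[of _ g']) auto
  qed
  from this[OF S(1) generatesD(1)[OF S(2)]] obtain U' g where
    *: "submodule U' K V" "S \<subseteq> U'" "g \<in> mod_hom K (V\<lparr>carrier := U'\<rparr>) T" "\<forall>u\<in>U. g u = f u" by auto
  have "U' = carrier V" by (rule generatesD(2)[OF S(2) *(1,2)])
  then show ?thesis using * that[of g] by (simp add: mod_hom_def)
qed

text \<open>The identity of \<open>U\<close>, extended to a map from \<open>V\<close> to
  \<open>U\<close>. It presents a subspace as a quotient, so that results on images apply to
  subspaces.\<close>

lemma obtain_retraction:
  assumes U: "submodule U K V" and fg: "finitely_generated K V"
  obtains r where "r \<in> mod_hom K V V" "r ` carrier V = U" "\<And>u. u \<in> U \<Longrightarrow> r u = u"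
proof -
  have "(\<lambda>x. x) \<in> mod_hom K (V\<lparr>carrier := U\<rparr>) (V\<lparr>carrier := U\<rparr>)" by (auto simp: mod_hom_def)
  from extend_linear[OF right_module_sub[OF U] U this fg]
  obtain r where r: "r \<in> mod_hom K V (V\<lparr>carrier := U\<rparr>)" "\<And>u. u \<in> U \<Longrightarrow> r u = u" by blast
  have "r ` carrier V = U"
  proof
    show "r ` carrier V \<subseteq> U" using mod_homD(1)[OF r(1)] by auto
    show "U \<subseteq> r ` carrier V" using r(2) submoduleD(1)[OF U] by force
  qed
  then show ?thesis using that[of r] r mod_hom_codomain_sub(1)[OF r(1) submoduleD(1)[OF U]] by blast
qed

lemma obtain_functional:
  assumes U: "submodule U K V" and fg: "finitely_generated K V" and x: "x \<in> carrier V" "x \<notin> U"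
  obtains \<psi> where "\<psi> \<in> mod_hom K V (regular_module K)" "\<And>u. u \<in> U \<Longrightarrow> \<psi> u = \<zero>\<^bsub>K\<^esub>" "\<psi> x = \<one>\<^bsub>K\<^esub>"
proof -
  have T: "right_module K (regular_module K)" by (rule K.right_module_regular)
  have z: "(\<lambda>x. \<zero>\<^bsub>K\<^esub>) \<in> mod_hom K (V\<lparr>carrier := U\<rparr>) (regular_module K)"
    by (auto simp: mod_hom_def)
  obtain U' g where *: "submodule U' K V" "U \<subseteq> U'" "x \<in> U'"
    "g \<in> mod_hom K (V\<lparr>carrier := U'\<rparr>) (regular_module K)"
    "\<And>u. u \<in> U \<Longrightarrow> g u = \<zero>\<^bsub>K\<^esub>" "g x = \<one>\<^bsub>K\<^esub>"
    using extend_linear_one[OF T U z x(1), of "\<one>\<^bsub>K\<^esub>"] x(2) by auto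
  obtain \<psi> where "\<psi> \<in> mod_hom K V (regular_module K)" "\<And>u. u \<in> U' \<Longrightarrow> \<psi> u = g u"
    using extend_linear[OF T *(1,4) fg] by blast
  then show ?thesis using * by (intro that[of \<psi>]) auto
qed

lemma finitely_generated_sub:
  assumes "submodule U K V" and fg: "finitely_generated K V"
  shows "finitely_generated K (V\<lparr>carrier := U\<rparr>)"
proof -
  obtain r where r: "r \<in> mod_hom K V V" "r ` carrier V = U"
    using obtain_retraction[OF assms] by blast
  interpret right_module_hom K V "V\<lparr>carrier := U\<rparr>" r
    by (intro right_module_hom_intro right_module_axioms right_module_sub assms
        mod_hom_codomain_sub(2) r(1)) (simp add: r(2))
  show ?thesis by (rule finitely_generated_image) (use fg r in auto)
qed

end

section \<open>Dimension and dual bases\<close>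

definition vdim :: "('r, 'b) ring_scheme \<Rightarrow> ('r, 'x) module \<Rightarrow> nat" where
  "vdim R M = (LEAST n. \<exists>S. finite S \<and> card S = n \<and> generates R M S)"

lemma vdim_le: "finite S \<Longrightarrow> generates R M S \<Longrightarrow> vdim R M \<le> card S"
  unfolding vdim_def by (rule Least_le) auto

lemma obtain_minimal_generators:
  assumes "finitely_generated R M"
  obtains S where "finite S" "generates R M S" "card S = vdim R M"
proof -
  have "\<exists>n S. finite S \<and> card S = n \<and> generates R M S"
    using assms by (auto simp: finitely_generated_iff)
  from LeastI_ex[OF this] show ?thesis using that by (auto simp: vdim_def)
qed

context vspace
begin

lemma smult_finsum:
  assumes "c \<in> carrier K" "g \<in> S \<rightarrow> carrier V" "finite S"
  shows "c \<odot>\<^bsub>V\<^esub> finsum V g S = finsum V (\<lambda>s. c \<odot>\<^bsub>V\<^esub> g s) S"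
proof -
  interpret h: right_module_hom K V V "\<lambda>x. c \<odot>\<^bsub>V\<^esub> x"
    by (intro right_module_hom_intro right_module_axioms smult_hom assms)
  show ?thesis by (rule h.finsum[OF assms(2,3)])
qed

text \<open>A generating set of least size is a basis: no \<open>s\<close> in it lies in the span of
  the others, so some functional is one at \<open>s\<close> and zero at the others. These
  functionals are the coordinates.\<close>

lemma obtain_dual_basis:
  assumes fg: "finitely_generated K V"
  obtains S \<psi> where "finite S" "generates K V S" "card S = vdim K V"
    "\<And>s. s \<in> S \<Longrightarrow> \<psi> s \<in> mod_hom K V (regular_module K)"
    "\<And>x. x \<in> carrier V \<Longrightarrow> x = (\<Oplus>\<^bsub>V\<^esub>s\<in>S. \<psi> s x \<odot>\<^bsub>V\<^esub> s)"
proof -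
  obtain S where S: "finite S" "generates K V S" "card S = vdim K V"
    using obtain_minimal_generators[OF fg] by blast
  have SV: "S \<subseteq> carrier V" by (rule generatesD(1)[OF S(2)])
  have "\<exists>\<psi>. \<psi> \<in> mod_hom K V (regular_module K) \<and> \<psi> s = \<one>\<^bsub>K\<^esub> \<and> (\<forall>t\<in>S - {s}. \<psi> t = \<zero>\<^bsub>K\<^esub>)" if s: "s \<in> S" for s
  proof -
    \<comment> \<open>The span of the other generators. It misses \<open>s\<close>, since otherwise
      \<open>s\<close> could be dropped from \<open>S\<close>.\<close>
    define U where "U = \<Inter>{H. submodule H K V \<and> S - {s} \<subseteq> H}"
    have U: "submodule U K V"
      unfolding U_def by (rule submodule_Inter) (use SV submodule_carrier in auto)
    have SU: "S - {s} \<subseteq> U" by (auto simp: U_def)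
    have "s \<notin> U"
    proof
      assume "s \<in> U"
      have "generates K V (S - {s})"
        unfolding generates_def
      proof (intro conjI allI impI)
        fix H assume H: "submodule H K V \<and> S - {s} \<subseteq> H"
        then have "U \<subseteq> H" by (auto simp: U_def)
        then show "H = carrier V" using \<open>s \<in> U\<close> H by (intro generatesD(2)[OF S(2)]) auto
      qed (use SV in auto)
      then have "vdim K V \<le> card (S - {s})" using S(1) by (intro vdim_le) auto
      then show False using S(1,3) s by (metis card_Diff1_less not_le)
    qed
    then show ?thesis using obtain_functional[OF U fg, of s] SU SV s by (metis subsetD)
  qed
  then obtain \<psi> where \<psi>: "\<And>s. s \<in> S \<Longrightarrow> \<psi> s \<in> mod_hom K V (regular_module K)"
    "\<And>s. s \<in> S \<Longrightarrow> \<psi> s s = \<one>\<^bsub>K\<^esub>" "\<And>s t. s \<in> S \<Longrightarrow> t \<in> S \<Longrightarrow> t \<noteq> s \<Longrightarrow> \<psi> s t = \<zero>\<^bsub>K\<^esub>"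
    by (metis DiffI singletonD)
  note \<psi>D = mod_homD[OF \<psi>(1), simplified]
  define P where "P x = (\<Oplus>\<^bsub>V\<^esub>s\<in>S. \<psi> s x \<odot>\<^bsub>V\<^esub> s)" for x
  have term_closed: "\<psi> s x \<odot>\<^bsub>V\<^esub> s \<in> carrier V" if "s \<in> S" "x \<in> carrier V" for s x
    using that SV \<psi>D(1) by (auto intro: smult_closed)
  have P_add: "P (x \<oplus>\<^bsub>V\<^esub> y) = P x \<oplus>\<^bsub>V\<^esub> P y" if "x \<in> carrier V" "y \<in> carrier V" for x y
  proof -
    have "P (x \<oplus>\<^bsub>V\<^esub> y) = (\<Oplus>\<^bsub>V\<^esub>s\<in>S. \<psi> s x \<odot>\<^bsub>V\<^esub> s \<oplus>\<^bsub>V\<^esub> \<psi> s y \<odot>\<^bsub>V\<^esub> s)"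
      unfolding P_def by (rule M.finsum_cong')
        (use that SV term_closed in \<open>auto simp: \<psi>D smult_add_ring subset_iff\<close>)
    also have "\<dots> = P x \<oplus>\<^bsub>V\<^esub> P y"
      unfolding P_def by (rule M.finsum_addf) (use that term_closed in auto)
    finally show ?thesis .
  qed
  have P_smult: "P (c \<odot>\<^bsub>V\<^esub> x) = c \<odot>\<^bsub>V\<^esub> P x" if "x \<in> carrier V" "c \<in> carrier K" for x c
  proof -
    have "P (c \<odot>\<^bsub>V\<^esub> x) = (\<Oplus>\<^bsub>V\<^esub>s\<in>S. c \<odot>\<^bsub>V\<^esub> (\<psi> s x \<odot>\<^bsub>V\<^esub> s))"
      unfolding P_def by (rule M.finsum_cong')
        (use that SV term_closed in \<open>auto simp: \<psi>D smult_assoc smult_closed subset_iff\<close>)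
    also have "\<dots> = c \<odot>\<^bsub>V\<^esub> P x"
      unfolding P_def by (rule smult_finsum[symmetric]) (use that term_closed S(1) in auto)
    finally show ?thesis .
  qed
  have P_S: "P t = t" if t: "t \<in> S" for t
  proof -
    have "P t = (\<Oplus>\<^bsub>V\<^esub>s\<in>S. if t = s then s else \<zero>\<^bsub>V\<^esub>)"
      unfolding P_def by (rule M.finsum_cong') (use t SV \<psi> in \<open>auto simp: smult_one smult_zero_ring subset_iff\<close>)
    also have "\<dots> = t" using M.finsum_singleton[OF t S(1), of "\<lambda>s. s"] SV by auto
    finally show ?thesis .
  qed
  have P_closed: "P x \<in> carrier V" if "x \<in> carrier V" for x
    unfolding P_def using that term_closed by (intro M.finsum_closed) auto
  have P0: "P \<zero>\<^bsub>V\<^esub> = \<zero>\<^bsub>V\<^esub>"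
    using P_smult[of "\<zero>\<^bsub>V\<^esub>" "\<zero>\<^bsub>K\<^esub>"] P_closed[of "\<zero>\<^bsub>V\<^esub>"] by (simp add: smult_zero_ring)
  \<comment> \<open>\<open>P\<close> fixes the generators, and the fixed points of a linear map form
    a subspace.\<close>
  have "submodule {x \<in> carrier V. P x = x} K V"
    by (auto simp: submodule_iff P_add P_smult smult_closed P0)
  then have "{x \<in> carrier V. P x = x} = carrier V"
    by (rule generatesD(2)[OF S(2)]) (use SV P_S in auto)
  then have "\<And>x. x \<in> carrier V \<Longrightarrow> x = P x" by (metis (mono_tags, lifting) mem_Collect_eq)
  then show ?thesis using that[OF S \<psi>(1)] by (simp add: P_def)
qed

end

lemma vdim_image_less:
  fixes K :: "'k ring"
  assumes "field K" "right_module_hom K M N f"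
    and fg: "finitely_generated K M" and surj: "f ` carrier M = carrier N" and ninj: "\<not> inj_on f (carrier M)"
  shows "vdim K N < vdim K M"
proof -
  interpret K: field K by fact
  interpret right_module_hom K M N f by fact
  interpret vspace K M by unfold_locales
  obtain x where x: "x \<in> carrier M" "f x = \<zero>\<^bsub>N\<^esub>" "x \<noteq> \<zero>\<^bsub>M\<^esub>" using ninj inj_iff by auto
  obtain S \<psi> where S: "finite S" "generates K M S" "card S = vdim K M"
    and \<psi>: "\<And>s. s \<in> S \<Longrightarrow> \<psi> s \<in> mod_hom K M (regular_module K)"
    and sum: "\<And>x. x \<in> carrier M \<Longrightarrow> x = (\<Oplus>\<^bsub>M\<^esub>s\<in>S. \<psi> s x \<odot>\<^bsub>M\<^esub> s)"
    using obtain_dual_basis[OF fg] by blast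
  note \<psi>D = mod_homD[OF \<psi>, simplified]
  have SM: "S \<subseteq> carrier M" by (rule generatesD(1)[OF S(2)])
  obtain t where t: "t \<in> S" "\<psi> t x \<noteq> \<zero>\<^bsub>K\<^esub>"
  proof -
    have "\<exists>t\<in>S. \<psi> t x \<noteq> \<zero>\<^bsub>K\<^esub>"
    proof (rule ccontr)
      assume "\<not> ?thesis"
      then have "(\<Oplus>\<^bsub>M\<^esub>s\<in>S. \<psi> s x \<odot>\<^bsub>M\<^esub> s) = (\<Oplus>\<^bsub>M\<^esub>s\<in>S. \<zero>\<^bsub>M\<^esub>)"
        using SM by (intro dom.M.finsum_cong') (auto simp: dom.smult_zero_ring subset_iff)
      then show False using sum[OF x(1)] x(3) by simp
    qed
    then show ?thesis using that by auto
  qed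
  have "generates K N (f ` (S - {t}))"
    unfolding generates_def
  proof (intro conjI allI impI)
    show "f ` (S - {t}) \<subseteq> carrier N" using SM closed by auto
    fix H assume H: "submodule H K N \<and> f ` (S - {t}) \<subseteq> H"
    have "f y \<in> H" if y: "y \<in> carrier M" for y
    proof -
      \<comment> \<open>\<open>c\<close> is chosen so that \<open>z = y - c x\<close> has coordinate
        zero at \<open>t\<close>; as \<open>x\<close> is in the kernel, \<open>z\<close> has the
        same image as \<open>y\<close>.\<close>
      define c where "c = \<psi> t y \<otimes>\<^bsub>K\<^esub> inv\<^bsub>K\<^esub> (\<psi> t x)"
      have tx: "\<psi> t x \<in> Units K" using t x \<psi>D K.field_Units by auto
      have c: "c \<in> carrier K" using \<psi>D(1)[OF t(1)] y x tx by (auto simp: c_def)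
      define z where "z = y \<oplus>\<^bsub>M\<^esub> (\<ominus>\<^bsub>K\<^esub> c) \<odot>\<^bsub>M\<^esub> x"
      have z: "z \<in> carrier M" using c x y by (simp add: z_def dom.smult_closed)
      have "\<psi> t z = \<psi> t y \<oplus>\<^bsub>K\<^esub> (\<psi> t x \<otimes>\<^bsub>K\<^esub> \<ominus>\<^bsub>K\<^esub> c)"
        using c x(1) y t(1) by (simp add: z_def \<psi>D dom.smult_closed)
      also have "\<psi> t x \<otimes>\<^bsub>K\<^esub> \<ominus>\<^bsub>K\<^esub> c = \<ominus>\<^bsub>K\<^esub> (\<psi> t y)"
      proof -
        have "\<psi> t x \<otimes>\<^bsub>K\<^esub> c = \<psi> t y"
          using tx \<psi>D(1)[OF t(1) x(1)] \<psi>D(1)[OF t(1) y] K.m_lcomm[of "\<psi> t x" "\<psi> t y" "inv\<^bsub>K\<^esub> (\<psi> t x)"]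
            by (simp add: c_def)
        then show ?thesis using c \<psi>D(1)[OF t(1)] x(1) by (simp add: K.r_minus)
      qed
      finally have tz: "\<psi> t z = \<zero>\<^bsub>K\<^esub>" using \<psi>D(1)[OF t(1)] y by (simp add: K.r_neg)
      have "f y = f z"
        using c x y by (simp add: z_def add smult dom.smult_closed closed cod.smult_zero_module)
      also have "\<dots> = f (\<Oplus>\<^bsub>M\<^esub>s\<in>S. \<psi> s z \<odot>\<^bsub>M\<^esub> s)" using sum[OF z] by simp
      also have "\<dots> = (\<Oplus>\<^bsub>N\<^esub>s\<in>S. f (\<psi> s z \<odot>\<^bsub>M\<^esub> s))"
        by (rule finsum) (use SM \<psi>D(1) z S(1) dom.smult_closed in \<open>auto simp: subset_iff\<close>)
      also have "\<dots> \<in> H"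
      proof (rule cod.submodule_finsum)
        note HD = cod.submoduleD[OF conjunct1[OF H]]
        show "(\<lambda>s. f (\<psi> s z \<odot>\<^bsub>M\<^esub> s)) \<in> S \<rightarrow> H"
        proof
          fix s assume s: "s \<in> S"
          then have sM: "s \<in> carrier M" using SM by auto
          show "f (\<psi> s z \<odot>\<^bsub>M\<^esub> s) \<in> H"
          proof (cases "s = t")
            case True
            then show ?thesis using tz sM HD(3) by (simp add: dom.smult_zero_ring zero)
          next
            case False
            then show ?thesis using s sM H HD(5) \<psi>D(1)[OF s z] by (auto simp: smult)
          qed
        qed
      qed (use H in auto)
      finally show ?thesis .
    qed
    then have "f ` carrier M \<subseteq> H" by auto
    then show "H = carrier N" using surj cod.submoduleD(1)[OF conjunct1[OF H]] by simp
  qed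
  then have "vdim K N \<le> card (f ` (S - {t}))" using S(1) by (intro vdim_le) auto
  also have "\<dots> \<le> card (S - {t})" using S(1) by (intro card_image_le) auto
  also have "\<dots> < card S" using S(1) t(1) by (rule card_Diff1_less)
  finally show ?thesis using S(3) by simp
qed

text \<open>The case of a retraction onto \<open>U\<close>: it is not injective, as it sends a
  vector \<open>x\<close> outside \<open>U\<close> to the same place as \<open>r x\<close>.\<close>

lemma (in vspace) vdim_sub_less:
  assumes U: "submodule U K V" and fg: "finitely_generated K V" and ne: "U \<noteq> carrier V"
  shows "vdim K (V\<lparr>carrier := U\<rparr>) < vdim K V"
proof -
  obtain r where r: "r \<in> mod_hom K V V" "r ` carrier V = U" "\<And>u. u \<in> U \<Longrightarrow> r u = u"
    using obtain_retraction[OF U fg] by blast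
  obtain x where x: "x \<in> carrier V" "x \<notin> U" using ne submoduleD(1)[OF U] by auto
  have "r x \<in> U" using r(2) x(1) by auto
  then have "r (r x) = r x" "r x \<noteq> x" "r x \<in> carrier V" using r(3) x(2) submoduleD(2)[OF U] by auto
  then have "\<not> inj_on r (carrier V)" using x(1) by (auto simp: inj_on_def)
  moreover have "right_module_hom K V (V\<lparr>carrier := U\<rparr>) r"
    by (intro right_module_hom_intro right_module_axioms right_module_sub assms
        mod_hom_codomain_sub(2) r(1)) (simp add: r(2))
  ultimately show ?thesis by (intro vdim_image_less K.field_axioms fg) (auto simp: r(2))
qed

section \<open>Modules over a finite dimensional algebra\<close>

definition restrict_scalars :: "('k, 'l) module \<Rightarrow> ('l, 'x) module \<Rightarrow> ('k, 'x) module" where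
  "restrict_scalars L M = \<lparr>carrier = carrier M, monoid.mult = monoid.mult M, one = one M,
     ring.zero = ring.zero M, add = add M, smult = (\<lambda>c x. (c \<odot>\<^bsub>L\<^esub> \<one>\<^bsub>L\<^esub>) \<odot>\<^bsub>M\<^esub> x)\<rparr>"

lemma restrict_scalars_simps [simp]:
  "carrier (restrict_scalars L M) = carrier M" "\<zero>\<^bsub>restrict_scalars L M\<^esub> = \<zero>\<^bsub>M\<^esub>"
  "x \<oplus>\<^bsub>restrict_scalars L M\<^esub> y = x \<oplus>\<^bsub>M\<^esub> y"
  "c \<odot>\<^bsub>restrict_scalars L M\<^esub> x = (c \<odot>\<^bsub>L\<^esub> \<one>\<^bsub>L\<^esub>) \<odot>\<^bsub>M\<^esub> x"
  "restrict_scalars L (M\<lparr>carrier := H\<rparr>) = restrict_scalars L M\<lparr>carrier := H\<rparr>"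
  by (simp_all add: restrict_scalars_def)

lemma mod_hom_add:
  assumes "right_module R N" "f \<in> mod_hom R M N" "g \<in> mod_hom R M N"
  shows "(\<lambda>x. f x \<oplus>\<^bsub>N\<^esub> g x) \<in> mod_hom R M N"
proof -
  interpret right_module R N by fact
  show ?thesis using mod_homD[OF assms(2)] mod_homD[OF assms(3)]
    by (intro mod_homI) (auto simp: M.a_ac smult_add_module)
qed

lemma mod_hom_zero: "right_module R N \<Longrightarrow> (\<lambda>x. \<zero>\<^bsub>N\<^esub>) \<in> mod_hom R M N"
proof -
  assume "right_module R N"
  then interpret right_module R N .
  show ?thesis by (intro mod_homI) (auto simp: smult_zero_module)
qed

lemma fg_right_moduleD: "fg_right_module R M \<Longrightarrow> right_module R M"
  "fg_right_module R M \<Longrightarrow> finitely_generated R M"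
  by (auto simp: fg_right_module_def)

lemma essential_submoduleI:
  assumes "submodule H R M" "\<And>N. submodule N R M \<Longrightarrow> N \<inter> H = {\<zero>\<^bsub>M\<^esub>} \<Longrightarrow> N = {\<zero>\<^bsub>M\<^esub>}"
  shows "essential_submodule R H M"
  using assms by (simp add: essential_submodule_def)

lemma injective_moduleI:
  fixes L :: "('k, 'l) module"
  assumes "fg_right_module L E"
    and "\<And>(M :: ('l, nat \<Rightarrow> 'k) module) (N :: ('l, nat \<Rightarrow> 'k) module) f g. fg_right_module L M \<Longrightarrow> fg_right_module L N \<Longrightarrow>
      f \<in> mod_hom L M N \<Longrightarrow> inj_on f (carrier M) \<Longrightarrow> g \<in> mod_hom L M E \<Longrightarrow>
      \<exists>h\<in>mod_hom L N E. \<forall>x\<in>carrier M. h (f x) = g x"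
  shows "injective_module L E"
  unfolding injective_module_def by (intro conjI allI impI assms) auto

lemma projective_moduleI:
  fixes L :: "('k, 'l) module"
  assumes "fg_right_module L P"
    and "\<And>(M :: ('l, nat \<Rightarrow> 'k) module) (N :: ('l, nat \<Rightarrow> 'k) module) f g. fg_right_module L M \<Longrightarrow> fg_right_module L N \<Longrightarrow>
      f \<in> mod_hom L M N \<Longrightarrow> f ` carrier M = carrier N \<Longrightarrow> g \<in> mod_hom L P N \<Longrightarrow>
      \<exists>h\<in>mod_hom L P M. \<forall>x\<in>carrier P. f (h x) = g x"
  shows "projective_module L P"
  unfolding projective_module_def by (intro conjI allI impI assms) auto

lemma injective_moduleD:
  fixes L :: "('k, 'l) module" and M N :: "('l, nat \<Rightarrow> 'k) module"
  assumes "injective_module L E" "fg_right_module L M" "fg_right_module L N"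
    "f \<in> mod_hom L M N" "inj_on f (carrier M)" "g \<in> mod_hom L M E"
  shows "\<exists>h\<in>mod_hom L N E. \<forall>x\<in>carrier M. h (f x) = g x"
  by (rule assms(1)[unfolded injective_module_def, THEN conjunct2, rule_format]) (intro conjI assms)

lemma projective_moduleD:
  fixes L :: "('k, 'l) module" and M N :: "('l, nat \<Rightarrow> 'k) module"
  assumes "projective_module L P" "fg_right_module L M" "fg_right_module L N"
    "f \<in> mod_hom L M N" "f ` carrier M = carrier N" "g \<in> mod_hom L P N"
  shows "\<exists>h\<in>mod_hom L P M. \<forall>x\<in>carrier P. f (h x) = g x"
  by (rule assms(1)[unfolded projective_module_def, THEN conjunct2, rule_format, of M N f g]) (intro conjI assms)

section \<open>Finite generation over the field and over the algebra\<close>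

locale fd_alg =
  fixes K :: "'k ring" and L :: "('k, 'l) module"
  assumes field_algebra: "field_algebra K L" and fin_dim: "finitely_generated K L"
begin

sublocale K: field K using field_algebra by (simp add: field_algebra_def)
sublocale L: ring L using field_algebra by (simp add: field_algebra_def)
sublocale KL: module K L using field_algebra by (simp add: field_algebra_def)

abbreviation res :: "('l, 'x) module \<Rightarrow> ('k, 'x) module" where
  "res \<equiv> restrict_scalars L"

abbreviation scal :: "'k \<Rightarrow> 'l" where "scal c \<equiv> c \<odot>\<^bsub>L\<^esub> \<one>\<^bsub>L\<^esub>"

lemma smult_mult:
  assumes "c \<in> carrier K" "x \<in> carrier L" "y \<in> carrier L"
  shows "(c \<odot>\<^bsub>L\<^esub> x) \<otimes>\<^bsub>L\<^esub> y = c \<odot>\<^bsub>L\<^esub> (x \<otimes>\<^bsub>L\<^esub> y)" "x \<otimes>\<^bsub>L\<^esub> (c \<odot>\<^bsub>L\<^esub> y) = c \<odot>\<^bsub>L\<^esub> (x \<otimes>\<^bsub>L\<^esub> y)"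
  using field_algebra assms by (auto simp: field_algebra_def)

lemma mult_scal:
  assumes "c \<in> carrier K" "x \<in> carrier L"
  shows "scal c \<otimes>\<^bsub>L\<^esub> x = c \<odot>\<^bsub>L\<^esub> x" "x \<otimes>\<^bsub>L\<^esub> scal c = c \<odot>\<^bsub>L\<^esub> x"
  using assms by (simp_all add: smult_mult)

lemma scal_mult:
  assumes "c \<in> carrier K" "d \<in> carrier K"
  shows "scal (c \<otimes>\<^bsub>K\<^esub> d) = scal c \<otimes>\<^bsub>L\<^esub> scal d"
  using assms by (simp add: mult_scal(1) KL.smult_assoc1)

lemma vspace_res:
  assumes "right_module L M" shows "vspace K (res M)"
proof -
  interpret right_module L M by fact
  have "right_module K (res M)"
  proof (rule right_moduleI)
    show "\<exists>y\<in>carrier (res M). y \<oplus>\<^bsub>res M\<^esub> x = \<zero>\<^bsub>res M\<^esub>" if "x \<in> carrier (res M)" for x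
      using that M.l_neg[of x] by auto
    show "(c \<otimes>\<^bsub>K\<^esub> d) \<odot>\<^bsub>res M\<^esub> x = d \<odot>\<^bsub>res M\<^esub> (c \<odot>\<^bsub>res M\<^esub> x)"
      if "c \<in> carrier K" "d \<in> carrier K" "x \<in> carrier (res M)" for c d x
      using that by (simp add: scal_mult smult_assoc)
  qed (auto simp: M.a_ac K.ring_axioms smult_closed smult_add_module KL.smult_l_distr
      smult_add_ring smult_one)
  then show ?thesis by (simp add: vspace_def K.field_axioms)
qed

lemma right_module_res: "right_module L M \<Longrightarrow> right_module K (res M)"
  using vspace_res by (auto simp: vspace_def)

lemma mod_hom_res: "f \<in> mod_hom L M N \<Longrightarrow> f \<in> mod_hom K (res M) (res N)"
  by (auto simp: mod_hom_def)

lemma submodule_res: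
  assumes "right_module L M" "submodule H L M" shows "submodule H K (res M)"
  using right_module.submodule_iff[OF assms(1), of H] assms(2)
    right_module.submodule_iff[OF right_module_res[OF assms(1)], of H] by auto

lemma right_module_K_L: "right_module K L"
  by (rule right_module_of_module) unfold_locales

lemma regular: "right_module L (regular_module L)"
  by (rule L.right_module_regular)

lemma finitely_generated_res_regular: "finitely_generated K (res (regular_module L))"
proof -
  have "submodule H K L \<longleftrightarrow> submodule H K (res (regular_module L))" for H
    using right_module.submodule_iff[OF right_module_K_L, of H]
      right_module.submodule_iff[OF right_module_res[OF regular], of H]
    by (auto simp: mult_scal subset_iff)
  then show ?thesis using fin_dim by (auto simp: finitely_generated_def)
qed

text \<open>Generators over \<open>K\<close> are the products of the generators of \<open>M\<close>
  over \<open>L\<close> with those of \<open>L\<close> over \<open>K\<close>. The generation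
  principle is used twice: over \<open>K\<close> for the elements \<open>l\<close> of
  \<open>L\<close> that send a fixed generator into \<open>H\<close>, then over \<open>L\<close> for
  \<open>M\<close>.\<close>

lemma finitely_generated_res_iff:
  assumes "right_module L M"
  shows "finitely_generated K (res M) \<longleftrightarrow> finitely_generated L M"
proof
  interpret M: right_module L M by fact
  interpret KM: vspace K "res M" by (rule vspace_res[OF assms])
  {
    assume "finitely_generated K (res M)"
    then obtain S where S: "finite S" "generates K (res M) S" by (auto simp: finitely_generated_iff)
    then have "generates L M S"
      unfolding generates_def using submodule_res[OF assms] generatesD[OF S(2)] by auto
    then show "finitely_generated L M" using S by (auto simp: finitely_generated_iff)
  }
  assume "finitely_generated L M"
  then obtain S where S: "finite S" "generates L M S" by (auto simp: finitely_generated_iff)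
  obtain T where T: "finite T" "generates K (res (regular_module L)) T"
    using finitely_generated_res_regular by (auto simp: finitely_generated_iff)
  note SM = generatesD(1)[OF S(2)] and TL = generatesD(1)[OF T(2), simplified]
  have "generates K (res M) ((\<lambda>(t, s). t \<odot>\<^bsub>M\<^esub> s) ` (T \<times> S))"
    unfolding generates_def
  proof (intro conjI allI impI)
    show "(\<lambda>(t, s). t \<odot>\<^bsub>M\<^esub> s) ` (T \<times> S) \<subseteq> carrier (res M)"
      using SM TL M.smult_closed by auto
    fix H assume H: "submodule H K (res M) \<and> (\<lambda>(t, s). t \<odot>\<^bsub>M\<^esub> s) ` (T \<times> S) \<subseteq> H"
    note HD = KM.submoduleD[OF conjunct1[OF H], simplified]
    have LS: "l \<odot>\<^bsub>M\<^esub> s \<in> H" if "l \<in> carrier L" and s: "s \<in> S" for l s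
    proof -
      have sM: "s \<in> carrier M" using s SM by auto
      interpret f: right_module_hom K "res (regular_module L)" "res M" "\<lambda>l. l \<odot>\<^bsub>M\<^esub> s"
        by (intro right_module_hom_intro right_module_res regular assms mod_homI)
          (auto simp: sM M.smult_closed M.smult_add_ring M.smult_assoc)
      have "{l \<in> carrier (res (regular_module L)). l \<odot>\<^bsub>M\<^esub> s \<in> H} = carrier (res (regular_module L))"
        by (rule generatesD(2)[OF T(2) f.submodule_vimage]) (use H TL s in auto)
      then show ?thesis using that(1) by auto
    qed
    \<comment> \<open>A mere subspace \<open>H\<close> contains a largest
      \<open>L\<close>-submodule, formed by the elements whose whole orbit stays in
      \<open>H\<close>.\<close>
    have "submodule {x \<in> carrier M. \<forall>l\<in>carrier L. l \<odot>\<^bsub>M\<^esub> x \<in> H} L M"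
      using HD by (auto simp: M.submodule_iff M.smult_zero_module M.smult_add_module M.smult_closed
          simp flip: M.smult_assoc)
    then have "{x \<in> carrier M. \<forall>l\<in>carrier L. l \<odot>\<^bsub>M\<^esub> x \<in> H} = carrier M"
      by (rule generatesD(2)[OF S(2)]) (use SM LS in auto)
    then have "x \<in> H" if "x \<in> carrier M" for x
      using that M.smult_one[of x] L.one_closed by (metis (mono_tags, lifting) mem_Collect_eq)
    then show "H = carrier (res M)" using HD(1) by auto
  qed
  moreover have "finite ((\<lambda>(t, s). t \<odot>\<^bsub>M\<^esub> s) ` (T \<times> S))"
    using S(1) T(1) by (intro finite_imageI finite_cartesian_product)
  ultimately show "finitely_generated K (res M)"
    unfolding finitely_generated_iff by (intro exI conjI)
qed

lemma fg_right_module_iff: "fg_right_module L M \<longleftrightarrow> right_module L M \<and> finitely_generated K (res M)"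
  using finitely_generated_res_iff[of M] unfolding fg_right_module_def by blast

lemmas finitely_generated_res = fg_right_module_iff[THEN iffD1, THEN conjunct2]

lemma fg_regular: "fg_right_module L (regular_module L)"
  by (simp add: fg_right_module_iff regular finitely_generated_res_regular)

lemma fg_sub:
  assumes "fg_right_module L M" "submodule H L M"
  shows "fg_right_module L (M\<lparr>carrier := H\<rparr>)"
  using assms right_module.right_module_sub vspace.finitely_generated_sub[OF vspace_res] submodule_res
  unfolding fg_right_module_iff restrict_scalars_simps by blast

lemma fg_image:
  assumes "fg_right_module L M" "right_module L N" "f \<in> mod_hom L M N" "f ` carrier M = carrier N"
  shows "fg_right_module L N"
  using assms right_module_hom.finitely_generated_image[OF right_module_hom_intro]
  by (auto simp: fg_right_module_def)

lemma obtain_fg_quotient: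
  fixes M :: "('l, 'x) module"
  assumes "fg_right_module L M" "submodule H L M"
  obtains g :: "'x \<Rightarrow> 'x" and N :: "('l, 'x) module" where "fg_right_module L N" "g \<in> mod_hom L M N"
    "g ` carrier M = carrier N" "{x \<in> carrier M. g x = \<zero>\<^bsub>N\<^esub>} = H"
proof -
  interpret right_module L M by (rule fg_right_moduleD(1)[OF assms(1)])
  obtain g :: "'x \<Rightarrow> 'x" and N :: "('l, 'x) module" where g: "right_module L N" "g \<in> mod_hom L M N"
    "g ` carrier M = carrier N" "{x \<in> carrier M. g x = \<zero>\<^bsub>N\<^esub>} = H"
    by (rule obtain_quotient[OF assms(2)])
  show ?thesis by (rule that[OF fg_image[OF assms(1) g(1-3)] g(2-4)])
qed

text \<open>Coordinates with respect to a finite basis, numbered by the naturals below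
  \<open>n\<close>, embed \<open>M\<close> in the type in which injectivity and projectivity are
  tested.\<close>

lemma obtain_nat_copy:
  assumes "fg_right_module L M"
  obtains g and N :: "('l, nat \<Rightarrow> 'k) module" where "fg_right_module L N" "g \<in> mod_hom L M N"
    "inj_on g (carrier M)" "g ` carrier M = carrier N"
proof -
  interpret M: right_module L M by (rule fg_right_moduleD(1)[OF assms(1)])
  interpret KM: vspace K "res M" by (rule vspace_res) unfold_locales
  obtain S \<psi> where S: "finite S" and SM: "generates K (res M) S" and "card S = vdim K (res M)"
    and \<psi>: "\<And>s. s \<in> S \<Longrightarrow> \<psi> s \<in> mod_hom K (res M) (regular_module K)"
    and sum: "\<And>x. x \<in> carrier (res M) \<Longrightarrow> x = (\<Oplus>\<^bsub>res M\<^esub>s\<in>S. \<psi> s x \<odot>\<^bsub>res M\<^esub> s)"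
    using KM.obtain_dual_basis[OF finitely_generated_res[OF assms]] by blast
  obtain s n where s: "S = s ` {i::nat. i < n}"
    using finite_imp_nat_seg_image_inj_on[OF S] by blast
  define g where "g x = (\<lambda>i. if i < n then \<psi> (s i) x else undefined)" for x
  have inj: "inj_on g (carrier M)"
  proof (rule inj_onI)
    fix x y assume xy: "x \<in> carrier M" "y \<in> carrier M" "g x = g y"
    have "\<psi> t x = \<psi> t y" if "t \<in> S" for t
      using that s fun_cong[OF xy(3)] by (auto simp: g_def split: if_splits) metis
    moreover have "(\<lambda>s. \<psi> s y \<odot>\<^bsub>res M\<^esub> s) \<in> S \<rightarrow> carrier (res M)"
      using generatesD(1)[OF SM] mod_homD(1)[OF \<psi>] xy KM.smult_closed by (auto simp: subset_iff)
    ultimately have "(\<Oplus>\<^bsub>res M\<^esub>s\<in>S. \<psi> s x \<odot>\<^bsub>res M\<^esub> s) = (\<Oplus>\<^bsub>res M\<^esub>s\<in>S. \<psi> s y \<odot>\<^bsub>res M\<^esub> s)"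
      by (intro KM.M.finsum_cong') auto
    then show "x = y" using sum[of x] sum[of y] xy(1,2) unfolding restrict_scalars_simps by metis
  qed
  obtain N :: "('l, nat \<Rightarrow> 'k) module" where N: "right_module L N" "g \<in> mod_hom L M N" "g ` carrier M = carrier N"
    by (rule M.obtain_copy[OF inj])
  show ?thesis by (rule that[OF fg_image[OF assms N] N(2) inj N(3)])
qed

text \<open>Injective and projective modules are defined by tests against modules in one fixed type, but
  they can be tested against modules in every type.\<close>

lemma injective_extend:
  assumes E: "injective_module L E" and M: "fg_right_module L M" and N: "fg_right_module L N"
    and f: "f \<in> mod_hom L M N" "inj_on f (carrier M)" and g: "g \<in> mod_hom L M E"
  shows "\<exists>h\<in>mod_hom L N E. \<forall>x\<in>carrier M. h (f x) = g x"
proof -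
  obtain a and M' :: "('l, nat \<Rightarrow> 'k) module" where M': "fg_right_module L M'" "a \<in> mod_hom L M M'"
    "inj_on a (carrier M)" "a ` carrier M = carrier M'" using obtain_nat_copy[OF M] .
  obtain b and N' :: "('l, nat \<Rightarrow> 'k) module" where N': "fg_right_module L N'" "b \<in> mod_hom L N N'"
    "inj_on b (carrier N)" "b ` carrier N = carrier N'" using obtain_nat_copy[OF N] .
  define c where "c = inv_into (carrier M) a"
  have "c \<in> mod_hom L (M'\<lparr>carrier := a ` carrier M\<rparr>) M"
    unfolding c_def by (rule mod_hom_inv_into[OF fg_right_moduleD(1)[OF M] M'(2,3)])
  then have c: "c \<in> mod_hom L M' M" using M'(4) by simp
  have ca: "c (a x) = x" if "x \<in> carrier M" for x unfolding c_def using M'(3) that by simp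
  define f' where "f' = (\<lambda>x. b (f (c x)))"
  define g' where "g' = (\<lambda>x. g (c x))"
  have f': "f' \<in> mod_hom L M' N'" unfolding f'_def by (rule mod_hom_comp[OF mod_hom_comp[OF c f(1)] N'(2)])
  have g': "g' \<in> mod_hom L M' E" unfolding g'_def by (rule mod_hom_comp[OF c g])
  have "inj_on f' (carrier M')"
  proof (rule inj_onI)
    fix x y assume "x \<in> carrier M'" "y \<in> carrier M'" "f' x = f' y"
    then have "f (c x) = f (c y)" unfolding f'_def
      using N'(3) mod_homD(1)[OF c] mod_homD(1)[OF f(1)] by (meson inj_onD)
    then have "c x = c y" using f(2) mod_homD(1)[OF c] \<open>x \<in> carrier M'\<close> \<open>y \<in> carrier M'\<close> by (meson inj_onD)
    then show "x = y" using \<open>x \<in> carrier M'\<close> \<open>y \<in> carrier M'\<close> M'(4)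
      unfolding c_def by (metis inv_into_injective)
  qed
  from injective_moduleD[OF E M'(1) N'(1) f' this g']
  obtain h where h: "h \<in> mod_hom L N' E" "\<forall>x\<in>carrier M'. h (f' x) = g' x" by (elim bexE)
  have eq: "h (b (f x)) = g x" if "x \<in> carrier M" for x
    using h(2)[rule_format, OF mod_homD(1)[OF M'(2) that]] ca[OF that] by (simp add: f'_def g'_def)
  show ?thesis by (intro bexI[OF _ mod_hom_comp[OF N'(2) h(1)]] ballI) (rule eq)
qed

section \<open>Retracts and biproducts of injective and projective modules\<close>

lemma injective_retract:
  assumes E: "injective_module L E" and P: "fg_right_module L P"
    and i: "i \<in> mod_hom L P E" and r: "r \<in> mod_hom L E P" and ri: "\<And>x. x \<in> carrier P \<Longrightarrow> r (i x) = x"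
  shows "injective_module L P"
proof (rule injective_moduleI)
  fix M N :: "('l, nat \<Rightarrow> 'k) module" and f g
  assume M: "fg_right_module L M" "fg_right_module L N" and f: "f \<in> mod_hom L M N" "inj_on f (carrier M)"
    and g: "g \<in> mod_hom L M P"
  from injective_extend[OF E M f mod_hom_comp[OF g i]]
  obtain h where "h \<in> mod_hom L N E" "\<forall>x\<in>carrier M. h (f x) = i (g x)" by (elim bexE)
  then show "\<exists>h\<in>mod_hom L N P. \<forall>x\<in>carrier M. h (f x) = g x"
    using mod_hom_comp[OF _ r, of h N] ri mod_homD(1)[OF g] by (intro bexI[of _ "\<lambda>x. r (h x)"]) auto
qed (rule P)

lemma projective_retract:
  fixes E :: "('l, 'x) module" and P :: "('l, 'y) module"
  assumes E: "projective_module L E" and P: "fg_right_module L P"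
    and i: "i \<in> mod_hom L P E" and r: "r \<in> mod_hom L E P" and ri: "\<And>x. x \<in> carrier P \<Longrightarrow> r (i x) = x"
  shows "projective_module L P"
proof (rule projective_moduleI)
  fix M N :: "('l, nat \<Rightarrow> 'k) module" and f g
  assume M: "fg_right_module L M" "fg_right_module L N" and f: "f \<in> mod_hom L M N" "f ` carrier M = carrier N"
    and g: "g \<in> mod_hom L P N"
  from projective_moduleD[OF E M f mod_hom_comp[OF r g]]
  obtain h where "h \<in> mod_hom L E M" "\<forall>x\<in>carrier E. f (h x) = g (r x)" by (elim bexE)
  then show "\<exists>h\<in>mod_hom L P M. \<forall>x\<in>carrier P. f (h x) = g x"
    using mod_hom_comp[OF i, of h M] ri mod_homD(1)[OF i] by (intro bexI[of _ "\<lambda>x. h (i x)"]) auto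
qed (rule P)

lemma projective_regular: "projective_module L (regular_module L)"
proof (rule projective_moduleI)
  fix M N :: "('l, nat \<Rightarrow> 'k) module" and f g
  assume M: "fg_right_module L M" "fg_right_module L N" and f: "f \<in> mod_hom L M N" "f ` carrier M = carrier N"
    and g: "g \<in> mod_hom L (regular_module L) N"
  interpret M: right_module L M by (rule fg_right_moduleD(1)[OF M(1)])
  have "g \<one>\<^bsub>L\<^esub> \<in> carrier N" using mod_homD(1)[OF g] by simp
  then obtain x where x: "x \<in> carrier M" "f x = g \<one>\<^bsub>L\<^esub>" using f(2) by (metis imageE)
  have "(\<lambda>l. l \<odot>\<^bsub>M\<^esub> x) \<in> mod_hom L (regular_module L) M"
    by (intro mod_homI) (auto simp: x M.smult_closed M.smult_add_ring M.smult_assoc)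
  moreover have "f (l \<odot>\<^bsub>M\<^esub> x) = g l" if "l \<in> carrier L" for l
    using that mod_homD(3)[OF f(1), of l x] x mod_homD(3)[OF g, of l "\<one>\<^bsub>L\<^esub>"] by simp
  ultimately show "\<exists>h\<in>mod_hom L (regular_module L) M. \<forall>x\<in>carrier (regular_module L). f (h x) = g x"
    by (intro bexI[of _ "\<lambda>l. l \<odot>\<^bsub>M\<^esub> x"]) auto
qed (rule fg_regular)

text \<open>The direct sum is described by its four maps, not as a product type, because the module
  itself has to be in the test type: only then can the formation of direct sums be iterated.\<close>

lemma obtain_biproduct:
  fixes E :: "('l, 'x) module" and F :: "('l, 'y) module"
  assumes E: "fg_right_module L E" and F: "fg_right_module L F"
  obtains P :: "('l, nat \<Rightarrow> 'k) module" and p q i j where "fg_right_module L P"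
    "p \<in> mod_hom L P E" "q \<in> mod_hom L P F" "i \<in> mod_hom L E P" "j \<in> mod_hom L F P"
    "\<And>x. x \<in> carrier E \<Longrightarrow> p (i x) = x" "\<And>x. x \<in> carrier F \<Longrightarrow> q (j x) = x"
    "\<And>x. x \<in> carrier E \<Longrightarrow> q (i x) = \<zero>\<^bsub>F\<^esub>" "\<And>x. x \<in> carrier F \<Longrightarrow> p (j x) = \<zero>\<^bsub>E\<^esub>"
    "\<And>x. x \<in> carrier P \<Longrightarrow> i (p x) \<oplus>\<^bsub>P\<^esub> j (q x) = x"
proof -
  interpret E: right_module L E by (rule fg_right_moduleD(1)[OF E])
  interpret F: right_module L F by (rule fg_right_moduleD(1)[OF F])
  define Q :: "('l, 'x \<times> 'y) module" where "Q = \<lparr>carrier = carrier E \<times> carrier F, monoid.mult = undefined, one = undefined,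
    ring.zero = (\<zero>\<^bsub>E\<^esub>, \<zero>\<^bsub>F\<^esub>), add = (\<lambda>p q. (fst p \<oplus>\<^bsub>E\<^esub> fst q, snd p \<oplus>\<^bsub>F\<^esub> snd q)),
    smult = (\<lambda>r p. (r \<odot>\<^bsub>E\<^esub> fst p, r \<odot>\<^bsub>F\<^esub> snd p))\<rparr>"
  interpret Q: right_module L Q
    unfolding Q_def by (rule right_module_product) unfold_locales
  have i: "(\<lambda>x. (x, \<zero>\<^bsub>F\<^esub>)) \<in> mod_hom L E Q" and j: "(\<lambda>x. (\<zero>\<^bsub>E\<^esub>, x)) \<in> mod_hom L F Q"
    and p: "fst \<in> mod_hom L Q E" and q: "snd \<in> mod_hom L Q F"
    by (auto intro!: mod_homI simp: Q_def E.smult_zero_module F.smult_zero_module)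
  interpret i: right_module_hom L E Q "\<lambda>x. (x, \<zero>\<^bsub>F\<^esub>)" by (intro right_module_hom_intro i) unfold_locales
  interpret j: right_module_hom L F Q "\<lambda>x. (\<zero>\<^bsub>E\<^esub>, x)" by (intro right_module_hom_intro j) unfold_locales
  obtain S where S: "finite S" "generates L E S"
    using fg_right_moduleD(2)[OF E] by (auto simp: finitely_generated_iff)
  obtain T where T: "finite T" "generates L F T"
    using fg_right_moduleD(2)[OF F] by (auto simp: finitely_generated_iff)
  have "generates L Q ((\<lambda>x. (x, \<zero>\<^bsub>F\<^esub>)) ` S \<union> (\<lambda>x. (\<zero>\<^bsub>E\<^esub>, x)) ` T)"
    unfolding generates_def
  proof (intro conjI allI impI)
    show "(\<lambda>x. (x, \<zero>\<^bsub>F\<^esub>)) ` S \<union> (\<lambda>x. (\<zero>\<^bsub>E\<^esub>, x)) ` T \<subseteq> carrier Q"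
      using generatesD(1)[OF S(2)] generatesD(1)[OF T(2)] by (auto simp: Q_def)
    fix H assume H: "submodule H L Q \<and> (\<lambda>x. (x, \<zero>\<^bsub>F\<^esub>)) ` S \<union> (\<lambda>x. (\<zero>\<^bsub>E\<^esub>, x)) ` T \<subseteq> H"
    have 1: "{x \<in> carrier E. (x, \<zero>\<^bsub>F\<^esub>) \<in> H} = carrier E"
      by (rule generatesD(2)[OF S(2) i.submodule_vimage]) (use H generatesD(1)[OF S(2)] in auto)
    have 2: "{x \<in> carrier F. (\<zero>\<^bsub>E\<^esub>, x) \<in> H} = carrier F"
      by (rule generatesD(2)[OF T(2) j.submodule_vimage]) (use H generatesD(1)[OF T(2)] in auto)
    have "(x, y) \<in> H" if "x \<in> carrier E" "y \<in> carrier F" for x y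
    proof -
      have "(x, \<zero>\<^bsub>F\<^esub>) \<in> H" "(\<zero>\<^bsub>E\<^esub>, y) \<in> H" using 1 2 that by auto
      then have "(x, \<zero>\<^bsub>F\<^esub>) \<oplus>\<^bsub>Q\<^esub> (\<zero>\<^bsub>E\<^esub>, y) \<in> H" using Q.submoduleD(4) H by blast
      then show ?thesis using that by (simp add: Q_def)
    qed
    then show "H = carrier Q" using Q.submoduleD(1)[OF conjunct1[OF H]] by (auto simp: Q_def)
  qed
  moreover have "finite ((\<lambda>x. (x, \<zero>\<^bsub>F\<^esub>)) ` S \<union> (\<lambda>x. (\<zero>\<^bsub>E\<^esub>, x)) ` T)"
    using S(1) T(1) by (intro finite_UnI finite_imageI)
  ultimately have "finitely_generated L Q" unfolding finitely_generated_iff by (intro exI conjI)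
  then have fgQ: "fg_right_module L Q" by (simp add: fg_right_module_def Q.right_module_axioms)
  obtain g and P :: "('l, nat \<Rightarrow> 'k) module" where P: "fg_right_module L P" "g \<in> mod_hom L Q P"
    "inj_on g (carrier Q)" "g ` carrier Q = carrier P" using obtain_nat_copy[OF fgQ] .
  define c where "c = inv_into (carrier Q) g"
  have "c \<in> mod_hom L (P\<lparr>carrier := g ` carrier Q\<rparr>) Q"
    unfolding c_def by (rule mod_hom_inv_into[OF Q.right_module_axioms P(2,3)])
  then have c: "c \<in> mod_hom L P Q" using P(4) by simp
  have cg: "c (g x) = x" if "x \<in> carrier Q" for x unfolding c_def using P(3) that by simp
  have ij: "(fst z, \<zero>\<^bsub>F\<^esub>) \<oplus>\<^bsub>Q\<^esub> (\<zero>\<^bsub>E\<^esub>, snd z) = z" "(fst z, \<zero>\<^bsub>F\<^esub>) \<in> carrier Q" "(\<zero>\<^bsub>E\<^esub>, snd z) \<in> carrier Q"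
    if "z \<in> carrier Q" for z using that by (auto simp: Q_def)
  show ?thesis
  proof (rule that[OF P(1) mod_hom_comp[OF c p] mod_hom_comp[OF c q] mod_hom_comp[OF i P(2)] mod_hom_comp[OF j P(2)]])
    fix x assume "x \<in> carrier P"
    then obtain z where z: "z \<in> carrier Q" "x = g z" unfolding P(4)[symmetric] by (elim imageE)
    have cx: "c x = z" unfolding z(2) by (rule cg[OF z(1)])
    have "g (fst z, \<zero>\<^bsub>F\<^esub>) \<oplus>\<^bsub>P\<^esub> g (\<zero>\<^bsub>E\<^esub>, snd z) = g z"
      using mod_homD(2)[OF P(2) ij(2,3)[OF z(1)]] unfolding ij(1)[OF z(1)] by (rule sym)
    then show "g (fst (c x), \<zero>\<^bsub>F\<^esub>) \<oplus>\<^bsub>P\<^esub> g (\<zero>\<^bsub>E\<^esub>, snd (c x)) = x"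
      by (simp only: cx z(2)[symmetric])
  next
    fix x assume "x \<in> carrier E"
    then have "c (g (x, \<zero>\<^bsub>F\<^esub>)) = (x, \<zero>\<^bsub>F\<^esub>)" by (intro cg i.closed)
    then show "fst (c (g (x, \<zero>\<^bsub>F\<^esub>))) = x" "snd (c (g (x, \<zero>\<^bsub>F\<^esub>))) = \<zero>\<^bsub>F\<^esub>" by simp_all
  next
    fix x assume "x \<in> carrier F"
    then have "c (g (\<zero>\<^bsub>E\<^esub>, x)) = (\<zero>\<^bsub>E\<^esub>, x)" by (intro cg j.closed)
    then show "snd (c (g (\<zero>\<^bsub>E\<^esub>, x))) = x" "fst (c (g (\<zero>\<^bsub>E\<^esub>, x))) = \<zero>\<^bsub>E\<^esub>" by simp_all
  qed
qed

lemma injective_biproduct: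
  assumes E: "injective_module L E" and F: "injective_module L F" and P: "fg_right_module L P"
    "p \<in> mod_hom L P E" "q \<in> mod_hom L P F" "i \<in> mod_hom L E P" "j \<in> mod_hom L F P"
    "\<And>x. x \<in> carrier P \<Longrightarrow> i (p x) \<oplus>\<^bsub>P\<^esub> j (q x) = x"
  shows "injective_module L P"
proof (rule injective_moduleI)
  fix M N :: "('l, nat \<Rightarrow> 'k) module" and f g
  assume M: "fg_right_module L M" "fg_right_module L N" and f: "f \<in> mod_hom L M N" "inj_on f (carrier M)"
    and g: "g \<in> mod_hom L M P"
  from injective_extend[OF E M f mod_hom_comp[OF g P(2)]]
  obtain h where h: "h \<in> mod_hom L N E" "\<forall>x\<in>carrier M. h (f x) = p (g x)" by (elim bexE)
  from injective_extend[OF F M f mod_hom_comp[OF g P(3)]]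
  obtain h' where h': "h' \<in> mod_hom L N F" "\<forall>x\<in>carrier M. h' (f x) = q (g x)" by (elim bexE)
  have "(\<lambda>x. i (h x) \<oplus>\<^bsub>P\<^esub> j (h' x)) \<in> mod_hom L N P"
    by (intro mod_hom_add mod_hom_comp[OF h(1) P(4)] mod_hom_comp[OF h'(1) P(5)] fg_right_moduleD(1) P(1))
  moreover have "\<forall>x\<in>carrier M. i (h (f x)) \<oplus>\<^bsub>P\<^esub> j (h' (f x)) = g x"
    by (simp add: h h' P(6) mod_homD(1)[OF g])
  ultimately show "\<exists>h\<in>mod_hom L N P. \<forall>x\<in>carrier M. h (f x) = g x" by (intro bexI)
qed (rule P(1))

lemma projective_biproduct:
  fixes E :: "('l, 'x) module" and F :: "('l, 'y) module" and P :: "('l, 'z) module"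
  assumes E: "projective_module L E" and F: "projective_module L F" and P: "fg_right_module L P"
    "p \<in> mod_hom L P E" "q \<in> mod_hom L P F" "i \<in> mod_hom L E P" "j \<in> mod_hom L F P"
    "\<And>x. x \<in> carrier P \<Longrightarrow> i (p x) \<oplus>\<^bsub>P\<^esub> j (q x) = x"
  shows "projective_module L P"
proof (rule projective_moduleI)
  fix M N :: "('l, nat \<Rightarrow> 'k) module" and f g
  assume M: "fg_right_module L M" "fg_right_module L N" and f: "f \<in> mod_hom L M N" "f ` carrier M = carrier N"
    and g: "g \<in> mod_hom L P N"
  from projective_moduleD[OF E M f mod_hom_comp[OF P(4) g]]
  obtain h where h: "h \<in> mod_hom L E M" "\<forall>x\<in>carrier E. f (h x) = g (i x)" by (elim bexE)
  from projective_moduleD[OF F M f mod_hom_comp[OF P(5) g]]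
  obtain h' where h': "h' \<in> mod_hom L F M" "\<forall>x\<in>carrier F. f (h' x) = g (j x)" by (elim bexE)
  have H: "(\<lambda>x. h (p x) \<oplus>\<^bsub>M\<^esub> h' (q x)) \<in> mod_hom L P M"
    by (intro mod_hom_add mod_hom_comp[OF P(2) h(1)] mod_hom_comp[OF P(3) h'(1)] fg_right_moduleD(1) M(1))
  have "f (h (p x) \<oplus>\<^bsub>M\<^esub> h' (q x)) = g x" if x: "x \<in> carrier P" for x
  proof -
    have px: "p x \<in> carrier E" "q x \<in> carrier F" using x mod_homD(1)[OF P(2)] mod_homD(1)[OF P(3)] by auto
    then have "f (h (p x) \<oplus>\<^bsub>M\<^esub> h' (q x)) = g (i (p x)) \<oplus>\<^bsub>N\<^esub> g (j (q x))"
      using mod_homD(2)[OF f(1)] mod_homD(1)[OF h(1)] mod_homD(1)[OF h'(1)] h(2) h'(2) by simp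
    also have "\<dots> = g (i (p x) \<oplus>\<^bsub>P\<^esub> j (q x))"
      using mod_homD(2)[OF g] mod_homD(1)[OF P(4)] mod_homD(1)[OF P(5)] px by simp
    finally show ?thesis using P(6)[OF x] by simp
  qed
  then have "\<forall>x\<in>carrier P. f (h (p x) \<oplus>\<^bsub>M\<^esub> h' (q x)) = g x" by simp
  then show "\<exists>h\<in>mod_hom L P M. \<forall>x\<in>carrier P. f (h x) = g x" using H by (intro bexI)
qed (rule P(1))


subsection \<open>Injective envelopes\<close>

lemma vdim_image_res_less:
  assumes M: "fg_right_module L M" and N: "right_module L N" and f: "f \<in> mod_hom L M N"
    and C: "submodule C L M" and ninj: "\<not> inj_on f C"
  shows "vdim K (res (N\<lparr>carrier := f ` C\<rparr>)) < vdim K (res (M\<lparr>carrier := C\<rparr>))"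
proof (rule vdim_image_less[OF K.field_axioms])
  interpret right_module_hom L M N f
    by (intro right_module_hom_intro fg_right_moduleD(1) M N f)
  have fC: "f \<in> mod_hom L (M\<lparr>carrier := C\<rparr>) (N\<lparr>carrier := f ` C\<rparr>)"
    by (rule mod_hom_codomain_sub(2)[OF mod_hom_restrict[OF f dom.submoduleD(1)[OF C]]]) simp
  show "right_module_hom K (res (M\<lparr>carrier := C\<rparr>)) (res (N\<lparr>carrier := f ` C\<rparr>)) f"
    by (rule right_module_hom_intro[OF right_module_res[OF dom.right_module_sub[OF C]]
          right_module_res[OF cod.right_module_sub[OF submodule_image[OF C]]] mod_hom_res[OF fC]])
  show "finitely_generated K (res (M\<lparr>carrier := C\<rparr>))"
    by (rule finitely_generated_res[OF fg_sub[OF M C]])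
qed (use ninj in simp_all)

text \<open>The envelope is the image of an endomorphism fixing \<open>M\<close> with image of minimal dimension.\<close>

lemma obtain_envelope_in_injective:
  fixes E :: "('l, 'x) module"
  assumes E: "injective_module L E" and M: "submodule M L E"
  obtains r C where "r \<in> mod_hom L E E" "r ` carrier E = C" "submodule C L E" "M \<subseteq> C"
    "\<And>x. x \<in> C \<Longrightarrow> r x = x" "essential_submodule L M (E\<lparr>carrier := C\<rparr>)"
proof -
  have fgE: "fg_right_module L E" using E by (simp add: injective_module_def)
  interpret E: right_module L E by (rule fg_right_moduleD(1)[OF fgE])
  define fixing where "fixing p \<longleftrightarrow> p \<in> mod_hom L E E \<and> (\<forall>x\<in>M. p x = x)" for p
  define \<mu> where "\<mu> p = vdim K (res (E\<lparr>carrier := p ` carrier E\<rparr>))" for p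
  have "fixing (\<lambda>x. x)" by (auto simp: fixing_def mod_hom_def)
  then obtain p where p: "fixing p" and min: "\<And>q. fixing q \<Longrightarrow> \<mu> p \<le> \<mu> q"
    using ex_has_least_nat[of fixing "\<lambda>x. x" \<mu>] by auto
  define C where "C = p ` carrier E"
  have hp: "p \<in> mod_hom L E E" and pM: "\<And>x. x \<in> M \<Longrightarrow> p x = x" using p by (auto simp: fixing_def)
  interpret p: right_module_hom L E E p by (intro right_module_hom_intro hp) unfold_locales
  have C: "submodule C L E" unfolding C_def by (rule p.submodule_image[OF E.submodule_carrier])
  note CD = E.submoduleD[OF C] and MD = E.submoduleD[OF M]
  have MC: "M \<subseteq> C"
  proof
    fix x assume x: "x \<in> M"
    then have "p x \<in> C" unfolding C_def by (intro imageI MD(2))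
    then show "x \<in> C" using pM[OF x] by simp
  qed
  have comp: "fixing (\<lambda>x. q (p x))" if "fixing q" for q
    using that p mod_hom_comp[of p L E E q E] by (auto simp: fixing_def)
  \<comment> \<open>If \<open>q\<close> collapsed part of \<open>C\<close>, then \<open>q\<close>
    after \<open>p\<close> would still fix \<open>M\<close> but have an image of smaller
    dimension.\<close>
  have inj: "inj_on q C" if q: "fixing q" for q
  proof (rule ccontr)
    assume "\<not> inj_on q C"
    then have "\<mu> (\<lambda>x. q (p x)) < \<mu> p"
      using vdim_image_res_less[OF fgE E.right_module_axioms _ C, of q] q
      by (simp add: \<mu>_def C_def image_image fixing_def)
    then show False using min[OF comp[OF q]] by simp
  qed
  \<comment> \<open>Otherwise \<open>p\<close> after \<open>p\<close> would contradict
    minimality.\<close>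
  have pC: "p ` C = C"
  proof (rule ccontr)
    assume ne: "p ` C \<noteq> C"
    have sub: "p ` C \<subseteq> C" using CD(1) by (auto simp: C_def)
    have "submodule (p ` C) K (res (E\<lparr>carrier := C\<rparr>))"
      by (intro submodule_res E.right_module_sub C)
        (simp add: E.submodule_sub[OF C] p.submodule_image[OF C] sub)
    then have "vdim K (res (E\<lparr>carrier := C\<rparr>)\<lparr>carrier := p ` C\<rparr>) < vdim K (res (E\<lparr>carrier := C\<rparr>))"
      by (rule vspace.vdim_sub_less[OF vspace_res[OF E.right_module_sub[OF C]] _
            finitely_generated_res[OF fg_sub[OF fgE C]]]) (simp add: ne)
    then have "\<mu> (\<lambda>x. p (p x)) < \<mu> p" by (simp add: \<mu>_def C_def image_image)
    then show False using min[OF comp[OF p]] by simp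
  qed
  \<comment> \<open>\<open>p\<close> permutes \<open>C\<close>, but need not fix it pointwise.
    Undoing this permutation gives a retraction of \<open>E\<close> onto \<open>C\<close>.\<close>
  define s where "s = inv_into C p"
  have "s \<in> mod_hom L (E\<lparr>carrier := p ` carrier (E\<lparr>carrier := C\<rparr>)\<rparr>) (E\<lparr>carrier := C\<rparr>)"
    using mod_hom_inv_into[of L "E\<lparr>carrier := C\<rparr>" p E] E.right_module_sub[OF C]
      mod_hom_restrict[OF hp CD(1)] inj[OF p] by (simp add: s_def)
  then have s: "s \<in> mod_hom L (E\<lparr>carrier := C\<rparr>) E"
    using pC mod_hom_codomain_sub(1)[OF _ CD(1)] by simp
  have r: "(\<lambda>x. s (p x)) \<in> mod_hom L E E"
    by (rule mod_hom_comp[OF mod_hom_codomain_sub(2)[OF hp] s]) (simp add: C_def)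
  have rC: "s (p x) = x" if "x \<in> C" for x using that inj[OF p] by (simp add: s_def)
  have rE: "(\<lambda>x. s (p x)) ` carrier E = C"
  proof
    show "(\<lambda>x. s (p x)) ` carrier E \<subseteq> C"
      using pC by (auto simp: s_def C_def intro!: inv_into_into)
    show "C \<subseteq> (\<lambda>x. s (p x)) ` carrier E" using rC CD(1) by force
  qed
  have ess: "essential_submodule L M (E\<lparr>carrier := C\<rparr>)"
  proof (rule essential_submoduleI)
    show "submodule M L (E\<lparr>carrier := C\<rparr>)" using M MC by (simp add: E.submodule_sub[OF C])
    fix N assume "submodule N L (E\<lparr>carrier := C\<rparr>)"
      and N': "N \<inter> M = {\<zero>\<^bsub>E\<lparr>carrier := C\<rparr>\<^esub>}"
    then have N: "submodule N L E" "N \<subseteq> C" "N \<inter> M = {\<zero>\<^bsub>E\<^esub>}" by (simp_all add: E.submodule_sub[OF C])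
    \<comment> \<open>\<open>M\<close> embeds in \<open>E / N\<close> since \<open>N\<close> meets
      it only in zero. By injectivity its inclusion in \<open>E\<close> extends over
      \<open>E / N\<close>, which gives an endomorphism that fixes \<open>M\<close> and kills
      \<open>N\<close>. It is injective on \<open>C\<close> by minimality, so \<open>N\<close> is
      zero.\<close>
    obtain \<pi> :: "'x \<Rightarrow> 'x" and Q :: "('l, 'x) module" where Q: "fg_right_module L Q" "\<pi> \<in> mod_hom L E Q"
      "{x \<in> carrier E. \<pi> x = \<zero>\<^bsub>Q\<^esub>} = N"
      by (rule obtain_fg_quotient[OF fgE N(1)])
    interpret \<pi>: right_module_hom L E Q \<pi>
      by (rule right_module_hom_intro[OF E.right_module_axioms fg_right_moduleD(1)[OF Q(1)] Q(2)])
    have "inj_on \<pi> M"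
      unfolding \<pi>.inj_on_iff[OF M] using Q(3) N(3) MD(2) by auto
    then have "inj_on \<pi> (carrier (E\<lparr>carrier := M\<rparr>))" by simp
    from injective_extend[OF E fg_sub[OF fgE M] Q(1) mod_hom_restrict[OF Q(2) MD(1)] this mod_hom_sub_id[OF MD(1)]]
    obtain h where h: "h \<in> mod_hom L Q E" "\<And>x. x \<in> M \<Longrightarrow> h (\<pi> x) = x" by auto
    have "fixing (\<lambda>x. h (\<pi> x))" using mod_hom_comp[OF Q(2) h(1)] h(2) by (simp add: fixing_def)
    then have inj': "inj_on (\<lambda>x. h (\<pi> x)) C" by (rule inj)
    have z: "\<zero>\<^bsub>E\<^esub> \<in> N" by (rule E.submoduleD(3)[OF N(1)])
    have "x = \<zero>\<^bsub>E\<^esub>" if "x \<in> N" for x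
    proof -
      have "\<pi> x = \<pi> \<zero>\<^bsub>E\<^esub>" using that z Q(3) by (metis (mono_tags, lifting) mem_Collect_eq)
      then show ?thesis using inj_onD[OF inj', of x "\<zero>\<^bsub>E\<^esub>"] that z N(2) by auto
    qed
    then have "N = {\<zero>\<^bsub>E\<^esub>}" using z by blast
    then show "N = {\<zero>\<^bsub>E\<lparr>carrier := C\<rparr>\<^esub>}" by simp
  qed
  define r where "r = (\<lambda>x. s (p x))"
  have "r \<in> mod_hom L E E" "r ` carrier E = C" "\<And>x. x \<in> C \<Longrightarrow> r x = x"
    unfolding r_def by (fact r, fact rE, fact rC)
  from that[OF this(1,2) C MC this(3) ess] show ?thesis .
qed

end

subsection \<open>Duality\<close>

lemma (in vspace) dual_space_iff:
  "f \<in> carrier (dual_space K V) \<longleftrightarrow> f \<in> extensional (carrier V) \<and> f \<in> mod_hom K V (regular_module K)"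
  by (auto simp: dual_space_def mod_hom_def PiE_def K.m_comm Pi_iff)

lemma dual_space_simps [simp]:
  "\<zero>\<^bsub>dual_space K V\<^esub> = (\<lambda>x\<in>carrier V. \<zero>\<^bsub>K\<^esub>)"
  "f \<oplus>\<^bsub>dual_space K V\<^esub> g = (\<lambda>x\<in>carrier V. f x \<oplus>\<^bsub>K\<^esub> g x)"
  "c \<odot>\<^bsub>dual_space K V\<^esub> f = (\<lambda>x\<in>carrier V. c \<otimes>\<^bsub>K\<^esub> f x)"
  by (simp_all add: dual_space_def)

context vspace
begin

lemma dualI:
  assumes "\<psi> \<in> mod_hom K V (regular_module K)"
  shows "restrict \<psi> (carrier V) \<in> carrier (dual_space K V)"
  using mod_hom_cong[OF assms _ right_module_axioms, of "restrict \<psi> (carrier V)"]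
  by (simp add: dual_space_iff)

lemma dualD:
  assumes "f \<in> carrier (dual_space K V)"
  shows "f \<in> extensional (carrier V)" "f \<in> mod_hom K V (regular_module K)"
    "\<And>x. x \<in> carrier V \<Longrightarrow> f x \<in> carrier K"
    "\<And>x y. x \<in> carrier V \<Longrightarrow> y \<in> carrier V \<Longrightarrow> f (x \<oplus>\<^bsub>V\<^esub> y) = f x \<oplus>\<^bsub>K\<^esub> f y"
    "\<And>c x. c \<in> carrier K \<Longrightarrow> x \<in> carrier V \<Longrightarrow> f (c \<odot>\<^bsub>V\<^esub> x) = c \<otimes>\<^bsub>K\<^esub> f x"
proof -
  show f: "f \<in> extensional (carrier V)" "f \<in> mod_hom K V (regular_module K)"
    using assms unfolding dual_space_iff by auto
  note fD = mod_homD[OF f(2), simplified]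
  show "\<And>x. x \<in> carrier V \<Longrightarrow> f x \<in> carrier K"
    "\<And>x y. x \<in> carrier V \<Longrightarrow> y \<in> carrier V \<Longrightarrow> f (x \<oplus>\<^bsub>V\<^esub> y) = f x \<oplus>\<^bsub>K\<^esub> f y"
    by (rule fD(1) fD(2); assumption)+
  show "f (c \<odot>\<^bsub>V\<^esub> x) = c \<otimes>\<^bsub>K\<^esub> f x" if "c \<in> carrier K" "x \<in> carrier V" for c x
    using that fD(1)[of x] fD(3)[of c x] K.m_comm[of "f x" c] by simp
qed

lemma dual_eqI:
  assumes "f \<in> carrier (dual_space K V)" "g \<in> carrier (dual_space K V)"
    "\<And>x. x \<in> carrier V \<Longrightarrow> f x = g x"
  shows "f = g"
  by (rule extensionalityI[OF dualD(1)[OF assms(1)] dualD(1)[OF assms(2)] assms(3)])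

lemma dual_zero: "f \<in> carrier (dual_space K V) \<Longrightarrow> f \<zero>\<^bsub>V\<^esub> = \<zero>\<^bsub>K\<^esub>"
  using dualD(5)[of f "\<zero>\<^bsub>K\<^esub>" "\<zero>\<^bsub>V\<^esub>"] dualD(3)[of f "\<zero>\<^bsub>V\<^esub>"] by (simp add: smult_zero_ring)

lemma dual_closed:
  "(\<lambda>x\<in>carrier V. \<zero>\<^bsub>K\<^esub>) \<in> carrier (dual_space K V)"
  "f \<in> carrier (dual_space K V) \<Longrightarrow> g \<in> carrier (dual_space K V) \<Longrightarrow>
    (\<lambda>x\<in>carrier V. f x \<oplus>\<^bsub>K\<^esub> g x) \<in> carrier (dual_space K V)"
  "c \<in> carrier K \<Longrightarrow> f \<in> carrier (dual_space K V) \<Longrightarrow>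
    (\<lambda>x\<in>carrier V. c \<otimes>\<^bsub>K\<^esub> f x) \<in> carrier (dual_space K V)"
proof -
  show "(\<lambda>x\<in>carrier V. \<zero>\<^bsub>K\<^esub>) \<in> carrier (dual_space K V)"
    by (rule dualI, rule mod_homI) auto
  show "(\<lambda>x\<in>carrier V. f x \<oplus>\<^bsub>K\<^esub> g x) \<in> carrier (dual_space K V)"
    if "f \<in> carrier (dual_space K V)" "g \<in> carrier (dual_space K V)"
    by (rule dualI, rule mod_homI)
      (auto simp: dualD(3-5)[OF that(1)] dualD(3-5)[OF that(2)] K.a_ac K.r_distr K.m_comm)
  show "(\<lambda>x\<in>carrier V. c \<otimes>\<^bsub>K\<^esub> f x) \<in> carrier (dual_space K V)"
    if "c \<in> carrier K" "f \<in> carrier (dual_space K V)"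
    by (rule dualI, rule mod_homI)
      (auto simp: that(1) dualD(3-5)[OF that(2)] K.r_distr K.m_ac)
qed

lemma right_module_dual: "right_module K (dual_space K V)"
proof (rule right_moduleI)
  fix f assume f: "f \<in> carrier (dual_space K V)"
  have "(\<lambda>x\<in>carrier V. (\<ominus>\<^bsub>K\<^esub> \<one>\<^bsub>K\<^esub>) \<otimes>\<^bsub>K\<^esub> f x) \<oplus>\<^bsub>dual_space K V\<^esub> f = \<zero>\<^bsub>dual_space K V\<^esub>"
    by (auto simp: dualD(3)[OF f] K.l_minus K.l_neg)
  then show "\<exists>g\<in>carrier (dual_space K V). g \<oplus>\<^bsub>dual_space K V\<^esub> f = \<zero>\<^bsub>dual_space K V\<^esub>"
    using dual_closed(3)[OF _ f, of "\<ominus>\<^bsub>K\<^esub> \<one>\<^bsub>K\<^esub>"] by (intro bexI) auto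
qed (auto intro!: dual_closed dual_closed[unfolded restrict_def] dual_eqI simp: K.ring_axioms dualD(3) K.a_ac K.l_distr K.r_distr K.m_ac)

lemma eval_hom:
  assumes "x \<in> carrier V"
  shows "(\<lambda>f. f x) \<in> mod_hom K (dual_space K V) (regular_module K)"
  using assms by (intro mod_homI) (auto simp: dualD(3) K.m_comm)

text \<open>Applying \<open>f\<close> to the expansion of \<open>x\<close> shows that the coordinate
  functionals span the dual space, the coefficients of \<open>f\<close> being its values on the
  basis. Both expansions are needed with the same \<open>S\<close> and
  \<open>\<psi>\<close>.\<close>

lemma dual_generators:
  assumes fg: "finitely_generated K V"
  shows "\<exists>S \<psi>. finite S \<and> S \<subseteq> carrier V \<and> (\<forall>s\<in>S. \<psi> s \<in> carrier (dual_space K V)) \<and>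
    (\<forall>x\<in>carrier V. x = (\<Oplus>\<^bsub>V\<^esub>s\<in>S. \<psi> s x \<odot>\<^bsub>V\<^esub> s)) \<and>
    (\<forall>f\<in>carrier (dual_space K V). f = (\<Oplus>\<^bsub>dual_space K V\<^esub>s\<in>S. f s \<odot>\<^bsub>dual_space K V\<^esub> \<psi> s))"
proof -
  obtain S \<psi>0 where S: "finite S" "generates K V S" "card S = vdim K V"
    and \<psi>0: "\<And>s. s \<in> S \<Longrightarrow> \<psi>0 s \<in> mod_hom K V (regular_module K)"
    and sum0: "\<And>x. x \<in> carrier V \<Longrightarrow> x = (\<Oplus>\<^bsub>V\<^esub>s\<in>S. \<psi>0 s x \<odot>\<^bsub>V\<^esub> s)"
    using obtain_dual_basis[OF fg] by blast
  note SV = generatesD(1)[OF S(2)]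
  define \<psi> where "\<psi> s = restrict (\<psi>0 s) (carrier V)" for s
  have \<psi>: "\<psi> s \<in> carrier (dual_space K V)" if "s \<in> S" for s
    unfolding \<psi>_def by (rule dualI[OF \<psi>0[OF that]])
  have sum: "x = (\<Oplus>\<^bsub>V\<^esub>s\<in>S. \<psi> s x \<odot>\<^bsub>V\<^esub> s)" if "x \<in> carrier V" for x
    using sum0[OF that] that by (simp add: \<psi>_def)
  interpret D: right_module K "dual_space K V" by (rule right_module_dual)
  have dual: "f = (\<Oplus>\<^bsub>dual_space K V\<^esub>s\<in>S. f s \<odot>\<^bsub>dual_space K V\<^esub> \<psi> s)" (is "f = ?g")
    if f: "f \<in> carrier (dual_space K V)" for f
  proof (rule dual_eqI[OF f])
    have trm: "f s \<odot>\<^bsub>dual_space K V\<^esub> \<psi> s \<in> carrier (dual_space K V)" if "s \<in> S" for s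
      using that SV \<psi>[OF that] dualD(3)[OF f] by (intro D.smult_closed) auto
    show "?g \<in> carrier (dual_space K V)" by (intro D.M.finsum_closed Pi_I trm)
    fix x assume x: "x \<in> carrier V"
    interpret f: right_module_hom K V "regular_module K" f
      by (rule right_module_hom_intro[OF right_module_axioms K.right_module_regular dualD(2)[OF f]])
    \<comment> \<open>Evaluation at \<open>x\<close> is linear, so a sum of functionals can be
      evaluated term by term.\<close>
    interpret e: right_module_hom K "dual_space K V" "regular_module K" "\<lambda>f. f x"
      by (rule right_module_hom_intro[OF right_module_dual K.right_module_regular eval_hom[OF x]])
    have "f x = f (\<Oplus>\<^bsub>V\<^esub>s\<in>S. \<psi> s x \<odot>\<^bsub>V\<^esub> s)" using sum[OF x] by simp
    also have "\<dots> = (\<Oplus>\<^bsub>regular_module K\<^esub>s\<in>S. f (\<psi> s x \<odot>\<^bsub>V\<^esub> s))"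
      by (rule f.finsum) (use SV \<psi> x S(1) in \<open>auto intro!: smult_closed dualD(3)\<close>)
    also have "\<dots> = (\<Oplus>\<^bsub>regular_module K\<^esub>s\<in>S. (f s \<odot>\<^bsub>dual_space K V\<^esub> \<psi> s) x)"
    proof (rule f.cod.M.finsum_cong')
      fix s assume s: "s \<in> S"
      then show "f (\<psi> s x \<odot>\<^bsub>V\<^esub> s) = (f s \<odot>\<^bsub>dual_space K V\<^esub> \<psi> s) x"
        using SV x dualD(3)[OF \<psi>[OF s] x] dualD(3)[OF f, of s] dualD(5)[OF f, of "\<psi> s x" s]
        by (auto simp: K.m_comm subset_iff)
    qed (use SV x dualD(3)[OF \<psi>] dualD(3)[OF f] in \<open>auto simp: subset_iff\<close>)
    also have "\<dots> = ?g x"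
      by (rule e.finsum[symmetric, OF _ S(1)]) (intro Pi_I trm)
    finally show "f x = ?g x" .
  qed
  show ?thesis by (intro exI conjI ballI) (fact S(1), fact SV, erule \<psi>, erule sum, erule dual)
qed

lemma finitely_generated_dual:
  assumes fg: "finitely_generated K V"
  shows "finitely_generated K (dual_space K V)"
proof -
  from dual_generators[OF fg] obtain S \<psi> where S: "finite S" "S \<subseteq> carrier V"
    and \<psi>': "\<forall>s\<in>S. \<psi> s \<in> carrier (dual_space K V)"
    and sum': "\<forall>f\<in>carrier (dual_space K V). f = (\<Oplus>\<^bsub>dual_space K V\<^esub>s\<in>S. f s \<odot>\<^bsub>dual_space K V\<^esub> \<psi> s)"
    by (elim exE conjE)
  note \<psi> = \<psi>'[rule_format] and sum = sum'[rule_format]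
  interpret D: right_module K "dual_space K V" by (rule right_module_dual)
  have "generates K (dual_space K V) (\<psi> ` S)"
    unfolding generates_def
  proof (intro conjI allI impI)
    fix H assume H: "submodule H K (dual_space K V) \<and> \<psi> ` S \<subseteq> H"
    note HD = D.submoduleD[OF conjunct1[OF H]]
    have "f \<in> H" if f: "f \<in> carrier (dual_space K V)" for f
    proof -
      have "(\<Oplus>\<^bsub>dual_space K V\<^esub>s\<in>S. f s \<odot>\<^bsub>dual_space K V\<^esub> \<psi> s) \<in> H"
        using H S(2) dualD(3)[OF f] by (intro D.submodule_finsum Pi_I HD(5)) auto
      then show ?thesis using sum[OF f] by simp
    qed
    then show "H = carrier (dual_space K V)" using HD(1) by blast
  qed (use \<psi> in auto)
  moreover have "finite (\<psi> ` S)" using S(1) by simp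
  ultimately show ?thesis unfolding finitely_generated_iff by (intro exI conjI)
qed

text \<open>Reflexivity: the vector whose coordinates are the values \<open>F (\<psi> s)\<close>
  does it, as both sides are linear in \<open>f\<close>.\<close>

lemma double_dual:
  assumes fg: "finitely_generated K V" and F: "F \<in> mod_hom K (dual_space K V) (regular_module K)"
  shows "\<exists>x\<in>carrier V. \<forall>f\<in>carrier (dual_space K V). F f = f x"
proof -
  from dual_generators[OF fg] obtain S \<psi> where S: "finite S" "S \<subseteq> carrier V"
    and \<psi>': "\<forall>s\<in>S. \<psi> s \<in> carrier (dual_space K V)"
    and sum': "\<forall>f\<in>carrier (dual_space K V). f = (\<Oplus>\<^bsub>dual_space K V\<^esub>s\<in>S. f s \<odot>\<^bsub>dual_space K V\<^esub> \<psi> s)"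
    by (elim exE conjE)
  note \<psi> = \<psi>'[rule_format] and sum = sum'[rule_format]
  interpret F: right_module_hom K "dual_space K V" "regular_module K" F
    by (rule right_module_hom_intro[OF right_module_dual K.right_module_regular F])
  note FD = mod_homD[OF F, simplified]
  define x where "x = (\<Oplus>\<^bsub>V\<^esub>s\<in>S. F (\<psi> s) \<odot>\<^bsub>V\<^esub> s)"
  have trm: "F (\<psi> s) \<odot>\<^bsub>V\<^esub> s \<in> carrier V" if "s \<in> S" for s
    using that S(2) FD(1)[OF \<psi>[OF that]] by (intro smult_closed) auto
  have x: "x \<in> carrier V" unfolding x_def using trm by (intro M.finsum_closed) auto
  have "F f = f x" if f: "f \<in> carrier (dual_space K V)" for f
  proof -
    interpret f: right_module_hom K V "regular_module K" f
      by (rule right_module_hom_intro[OF right_module_axioms K.right_module_regular dualD(2)[OF f]])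
    have fs: "f s \<in> carrier K" if "s \<in> S" for s using that S(2) dualD(3)[OF f] by auto
    have "F f = F (\<Oplus>\<^bsub>dual_space K V\<^esub>s\<in>S. f s \<odot>\<^bsub>dual_space K V\<^esub> \<psi> s)" using sum[OF f] by simp
    also have "\<dots> = (\<Oplus>\<^bsub>regular_module K\<^esub>s\<in>S. F (f s \<odot>\<^bsub>dual_space K V\<^esub> \<psi> s))"
      using S(1) fs \<psi> by (intro F.finsum Pi_I F.dom.smult_closed)
    also have "\<dots> = (\<Oplus>\<^bsub>regular_module K\<^esub>s\<in>S. f (F (\<psi> s) \<odot>\<^bsub>V\<^esub> s))"
    proof (rule F.cod.M.finsum_cong')
      fix s assume s: "s \<in> S"
      then have sV: "s \<in> carrier V" using S(2) by auto
      have "F (f s \<odot>\<^bsub>dual_space K V\<^esub> \<psi> s) = F (\<psi> s) \<otimes>\<^bsub>K\<^esub> f s"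
        using F.smult[OF fs[OF s] \<psi>[OF s]] by simp
      then show "F (f s \<odot>\<^bsub>dual_space K V\<^esub> \<psi> s) = f (F (\<psi> s) \<odot>\<^bsub>V\<^esub> s)"
        using dualD(5)[OF f FD(1)[OF \<psi>[OF s]] sV] by simp
    next
      show "(\<lambda>s. f (F (\<psi> s) \<odot>\<^bsub>V\<^esub> s)) \<in> S \<rightarrow> carrier (regular_module K)"
        using dualD(3)[OF f] trm by auto
    qed simp
    also have "\<dots> = f x"
      unfolding x_def by (rule f.finsum[symmetric]) (use trm S(1) in auto)
    finally show ?thesis .
  qed
  then show ?thesis using x by (intro bexI ballI)
qed

lemma dual_separates:
  assumes fg: "finitely_generated K V" and x: "x \<in> carrier V"
    and "\<And>f. f \<in> carrier (dual_space K V) \<Longrightarrow> f x = \<zero>\<^bsub>K\<^esub>"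
  shows "x = \<zero>\<^bsub>V\<^esub>"
proof (rule ccontr)
  assume "x \<noteq> \<zero>\<^bsub>V\<^esub>"
  then have "x \<notin> {\<zero>\<^bsub>V\<^esub>}" by simp
  from obtain_functional[OF submodule_zero fg x this]
  obtain \<psi> where \<psi>: "\<psi> \<in> mod_hom K V (regular_module K)" "\<psi> x = \<one>\<^bsub>K\<^esub>" by blast
  then show False using assms(3)[OF dualI[OF \<psi>(1)]] x by simp
qed

end

section \<open>Functionals and modules dual to left modules\<close>

context fd_alg
begin

abbreviation functionals :: "('l, 'x) module \<Rightarrow> ('x \<Rightarrow> 'k) set" where
  "functionals M \<equiv> mod_hom K (res M) (regular_module K)"

lemma minus_res [simp]: "x \<ominus>\<^bsub>res M\<^esub> y = x \<ominus>\<^bsub>M\<^esub> y"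
  by (simp add: a_minus_def a_inv_def m_inv_def restrict_scalars_def)

lemma minus_regular [simp]: "x \<ominus>\<^bsub>regular_module R\<^esub> y = x \<ominus>\<^bsub>R\<^esub> y"
  by (simp add: a_minus_def a_inv_def m_inv_def regular_module_def)

lemma orbit_hom:
  assumes "right_module L M" "x \<in> carrier M"
  shows "(\<lambda>l. l \<odot>\<^bsub>M\<^esub> x) \<in> mod_hom L (regular_module L) M"
proof -
  interpret right_module L M by fact
  show ?thesis by (intro mod_homI) (auto simp: assms(2) smult_closed smult_add_ring smult_assoc)
qed

lemma functional_orbit:
  assumes "right_module L M" "\<psi> \<in> functionals M" "x \<in> carrier M"
  shows "(\<lambda>l. \<psi> (l \<odot>\<^bsub>M\<^esub> x)) \<in> functionals (regular_module L)"
  by (rule mod_hom_comp[OF mod_hom_res[OF orbit_hom[OF assms(1,3)]] assms(2)])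

text \<open>The action of \<open>l\<close> need not be \<open>L\<close>-linear, but it is
  \<open>K\<close>-linear because scalars are central.\<close>

lemma functional_smult:
  assumes "right_module L M" "\<psi> \<in> functionals M" "l \<in> carrier L"
  shows "(\<lambda>x. \<psi> (l \<odot>\<^bsub>M\<^esub> x)) \<in> functionals M"
proof (rule mod_hom_comp[OF mod_homI assms(2)])
  interpret right_module L M by fact
  fix c x y assume x: "x \<in> carrier (res M)" and y: "y \<in> carrier (res M)" and c: "c \<in> carrier K"
  show "l \<odot>\<^bsub>M\<^esub> (c \<odot>\<^bsub>res M\<^esub> x) = c \<odot>\<^bsub>res M\<^esub> (l \<odot>\<^bsub>M\<^esub> x)"
    using x c assms(3) smult_assoc[of "scal c" l x] smult_assoc[of l "scal c" x] by (simp add: mult_scal)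
qed (use assms(3) right_module.smult_closed[OF assms(1)] right_module.smult_add_module[OF assms(1)] in auto)

end

text \<open>The hypotheses say that \<open>W\<close> is isomorphic to the dual of the left module \<open>L \<epsilon>\<close>, the functional
  \<open>\<phi>\<close> corresponding to the evaluation at \<open>\<epsilon>\<close>. So homomorphisms into \<open>W\<close> correspond to functionals
  that are invariant under \<open>\<epsilon>\<close>.\<close>

locale corepresenting = fd_alg K L for K :: "'k ring" and L :: "('k, 'l) module" +
  fixes W :: "('l, 'w) module" and \<phi> :: "'w \<Rightarrow> 'k" and \<epsilon> :: 'l
  assumes fgW: "fg_right_module L W" and \<phi>: "\<phi> \<in> functionals W"
    and \<epsilon>: "\<epsilon> \<in> carrier L" "\<epsilon> \<otimes>\<^bsub>L\<^esub> \<epsilon> = \<epsilon>" and \<phi>_\<epsilon>: "w \<in> carrier W \<Longrightarrow> \<phi> (\<epsilon> \<odot>\<^bsub>W\<^esub> w) = \<phi> w"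
    and represents: "\<theta> \<in> functionals (regular_module L) \<Longrightarrow>
      (\<And>l. l \<in> carrier L \<Longrightarrow> \<theta> (l \<otimes>\<^bsub>L\<^esub> \<epsilon>) = \<theta> l) \<Longrightarrow>
      \<exists>w\<in>carrier W. \<forall>l\<in>carrier L. \<phi> (l \<odot>\<^bsub>W\<^esub> w) = \<theta> l"
    and faithful: "w \<in> carrier W \<Longrightarrow> (\<And>l. l \<in> carrier L \<Longrightarrow> \<phi> (l \<odot>\<^bsub>W\<^esub> w) = \<zero>\<^bsub>K\<^esub>) \<Longrightarrow> w = \<zero>\<^bsub>W\<^esub>"
begin

sublocale W: right_module L W by (rule fg_right_moduleD(1)[OF fgW])

lemma eqI:
  assumes "v \<in> carrier W" "w \<in> carrier W" "\<And>l. l \<in> carrier L \<Longrightarrow> \<phi> (l \<odot>\<^bsub>W\<^esub> v) = \<phi> (l \<odot>\<^bsub>W\<^esub> w)"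
  shows "v = w"
proof -
  have "v \<ominus>\<^bsub>W\<^esub> w = \<zero>\<^bsub>W\<^esub>"
  proof (rule faithful)
    fix l assume l: "l \<in> carrier L"
    interpret h: right_module_hom K "res W" "regular_module K" "\<lambda>x. \<phi> (l \<odot>\<^bsub>W\<^esub> x)"
      by (rule right_module_hom_intro[OF right_module_res[OF W.right_module_axioms]
            K.right_module_regular functional_smult[OF W.right_module_axioms \<phi> l]])
    show "\<phi> (l \<odot>\<^bsub>W\<^esub> (v \<ominus>\<^bsub>W\<^esub> w)) = \<zero>\<^bsub>K\<^esub>"
      using h.minus[of v w] h.closed[of v] assms by (simp add: l K.r_right_minus_eq)
  qed (use assms in simp)
  then show ?thesis using W.minus_eq_zero[OF assms(1,2)] by simp
qed

lemma hom_eqI: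
  assumes f: "f \<in> mod_hom L N W" "right_module L N" and g: "g \<in> mod_hom L N W"
    and eq: "\<And>x. x \<in> carrier N \<Longrightarrow> \<phi> (f x) = \<phi> (g x)" and x: "x \<in> carrier N"
  shows "f x = g x"
proof (rule eqI)
  fix l assume l: "l \<in> carrier L"
  have "l \<odot>\<^bsub>N\<^esub> x \<in> carrier N" by (rule right_module.smult_closed[OF f(2) l x])
  from eq[OF this] show "\<phi> (l \<odot>\<^bsub>W\<^esub> f x) = \<phi> (l \<odot>\<^bsub>W\<^esub> g x)"
    using mod_homD(3)[OF f(1) l x] mod_homD(3)[OF g(1) l x] by simp
qed (use mod_homD(1)[OF f(1) x] mod_homD(1)[OF g x] in auto)

text \<open>The adjunction between functionals and homomorphisms into a dual: \<open>h x\<close> is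
  the element of \<open>W\<close> that represents the functional sending \<open>l\<close> to
  \<open>\<psi> (l \<odot> x)\<close>. Invariance of \<open>\<psi>\<close> makes this functional
  representable, and uniqueness of the representing element, \<open>eqI\<close>, makes
  \<open>h\<close> linear.\<close>

lemma hom_of_functional:
  assumes N: "right_module L N" and \<psi>: "\<psi> \<in> functionals N"
    and inv: "\<And>x. x \<in> carrier N \<Longrightarrow> \<psi> (\<epsilon> \<odot>\<^bsub>N\<^esub> x) = \<psi> x"
  shows "\<exists>h\<in>mod_hom L N W. \<forall>x\<in>carrier N. \<phi> (h x) = \<psi> x"
proof -
  interpret N: right_module L N by fact
  have "\<exists>w\<in>carrier W. \<forall>l\<in>carrier L. \<phi> (l \<odot>\<^bsub>W\<^esub> w) = \<psi> (l \<odot>\<^bsub>N\<^esub> x)" if x: "x \<in> carrier N" for x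
    by (rule represents[OF functional_orbit[OF N \<psi> x]])
      (simp add: N.smult_assoc[OF _ \<epsilon>(1) x] inv N.smult_closed x)
  then have "\<forall>x. \<exists>w. x \<in> carrier N \<longrightarrow> w \<in> carrier W \<and> (\<forall>l\<in>carrier L. \<phi> (l \<odot>\<^bsub>W\<^esub> w) = \<psi> (l \<odot>\<^bsub>N\<^esub> x))"
    by auto
  then obtain h where "\<forall>x. x \<in> carrier N \<longrightarrow> h x \<in> carrier W \<and> (\<forall>l\<in>carrier L. \<phi> (l \<odot>\<^bsub>W\<^esub> h x) = \<psi> (l \<odot>\<^bsub>N\<^esub> x))"
    by (rule choice[THEN exE])
  then have h: "\<And>x. x \<in> carrier N \<Longrightarrow> h x \<in> carrier W"
    "\<And>x l. x \<in> carrier N \<Longrightarrow> l \<in> carrier L \<Longrightarrow> \<phi> (l \<odot>\<^bsub>W\<^esub> h x) = \<psi> (l \<odot>\<^bsub>N\<^esub> x)" by auto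
  note \<phi>D = mod_homD[OF \<phi>, simplified] and \<psi>D = mod_homD[OF \<psi>, simplified]
  have "h \<in> mod_hom L N W"
  proof (rule mod_homI)
    fix x y assume xy: "x \<in> carrier N" "y \<in> carrier N"
    show "h (x \<oplus>\<^bsub>N\<^esub> y) = h x \<oplus>\<^bsub>W\<^esub> h y"
      by (rule eqI) (use xy in \<open>auto simp: h W.smult_add_module N.smult_add_module \<phi>D \<psi>D W.smult_closed N.smult_closed\<close>)
  next
    fix r x assume r: "r \<in> carrier L" and x: "x \<in> carrier N"
    show "h (r \<odot>\<^bsub>N\<^esub> x) = r \<odot>\<^bsub>W\<^esub> h x"
    proof (rule eqI)
      fix l assume l: "l \<in> carrier L"
      have "\<phi> (l \<odot>\<^bsub>W\<^esub> h (r \<odot>\<^bsub>N\<^esub> x)) = \<psi> (l \<odot>\<^bsub>N\<^esub> (r \<odot>\<^bsub>N\<^esub> x))"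
        by (intro h(2) N.smult_closed r x l)
      also have "\<dots> = \<psi> ((r \<otimes>\<^bsub>L\<^esub> l) \<odot>\<^bsub>N\<^esub> x)" by (simp add: N.smult_assoc r l x)
      also have "\<dots> = \<phi> ((r \<otimes>\<^bsub>L\<^esub> l) \<odot>\<^bsub>W\<^esub> h x)" by (intro h(2)[symmetric] x L.m_closed r l)
      also have "\<dots> = \<phi> (l \<odot>\<^bsub>W\<^esub> (r \<odot>\<^bsub>W\<^esub> h x))" by (simp add: W.smult_assoc r l h(1) x)
      finally show "\<phi> (l \<odot>\<^bsub>W\<^esub> h (r \<odot>\<^bsub>N\<^esub> x)) = \<phi> (l \<odot>\<^bsub>W\<^esub> (r \<odot>\<^bsub>W\<^esub> h x))" .
    qed (simp_all add: h(1) N.smult_closed W.smult_closed r x)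
  qed (rule h(1))
  moreover have "\<phi> (h x) = \<psi> x" if x: "x \<in> carrier N" for x
    using h(2)[OF x L.one_closed] by (simp add: W.smult_one N.smult_one h(1) x)
  ultimately show ?thesis by (intro bexI ballI)
qed

text \<open>Precomposition with the idempotent \<open>\<epsilon>\<close> makes an arbitrary
  functional invariant.\<close>

lemma functional_\<epsilon>:
  assumes N: "right_module L N" and \<psi>: "\<psi> \<in> functionals N"
  shows "\<exists>h\<in>mod_hom L N W. \<forall>x\<in>carrier N. \<phi> (h x) = \<psi> (\<epsilon> \<odot>\<^bsub>N\<^esub> x)"
proof (rule hom_of_functional[OF N functional_smult[OF N \<psi> \<epsilon>(1)]])
  fix x assume "x \<in> carrier N"
  then show "\<psi> (\<epsilon> \<odot>\<^bsub>N\<^esub> (\<epsilon> \<odot>\<^bsub>N\<^esub> x)) = \<psi> (\<epsilon> \<odot>\<^bsub>N\<^esub> x)"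
    using right_module.smult_assoc[OF N \<epsilon>(1) \<epsilon>(1), of x] by (simp add: \<epsilon>(2))
qed

text \<open>Through \<open>\<phi>\<close> the extension problem becomes one for functionals, which
  linear algebra solves; the extended functional is then turned back into a homomorphism. Making it
  invariant under \<open>\<epsilon>\<close> does not change it on the image of \<open>f\<close>,
  where it comes from the invariant \<open>\<phi>\<close>.\<close>

lemma injective: "injective_module L W"
proof (rule injective_moduleI[OF fgW])
  fix M N :: "('l, nat \<Rightarrow> 'k) module" and f g
  assume M: "fg_right_module L M" and N: "fg_right_module L N" and f: "f \<in> mod_hom L M N"
    and inj: "inj_on f (carrier M)" and g: "g \<in> mod_hom L M W"
  interpret f: right_module_hom L M N f
    by (rule right_module_hom_intro[OF fg_right_moduleD(1)[OF M] fg_right_moduleD(1)[OF N] f])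
  interpret KN: vspace K "res N" by (rule vspace_res[OF fg_right_moduleD(1)[OF N]])
  define U where "U = f ` carrier M"
  have U: "submodule U L N" unfolding U_def by (rule f.submodule_image[OF f.dom.submodule_carrier])
  have "inv_into (carrier M) f \<in> mod_hom L (N\<lparr>carrier := U\<rparr>) M"
    unfolding U_def by (rule mod_hom_inv_into[OF fg_right_moduleD(1)[OF M] f inj])
  from mod_hom_comp[OF mod_hom_res[OF mod_hom_comp[OF this g]] \<phi>]
  have "(\<lambda>y. \<phi> (g (inv_into (carrier M) f y))) \<in> mod_hom K (res N\<lparr>carrier := U\<rparr>) (regular_module K)"
    by simp
  from KN.extend_linear[OF K.right_module_regular submodule_res[OF fg_right_moduleD(1)[OF N] U] this
      finitely_generated_res[OF N]]
  obtain \<psi> where \<psi>: "\<psi> \<in> functionals N" "\<And>y. y \<in> U \<Longrightarrow> \<psi> y = \<phi> (g (inv_into (carrier M) f y))"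
    by blast
  obtain h where h: "h \<in> mod_hom L N W" "\<forall>x\<in>carrier N. \<phi> (h x) = \<psi> (\<epsilon> \<odot>\<^bsub>N\<^esub> x)"
    using functional_\<epsilon>[OF fg_right_moduleD(1)[OF N] \<psi>(1)] by (elim bexE)
  have "h (f x) = g x" if "x \<in> carrier M" for x
  proof (rule hom_eqI[OF mod_hom_comp[OF f h(1)] fg_right_moduleD(1)[OF M] g _ that])
    fix x assume x: "x \<in> carrier M"
    have ex: "\<epsilon> \<odot>\<^bsub>M\<^esub> x \<in> carrier M" by (rule f.dom.smult_closed[OF \<epsilon>(1) x])
    have "\<phi> (h (f x)) = \<psi> (f (\<epsilon> \<odot>\<^bsub>M\<^esub> x))"
      using h(2) f.closed[OF x] f.smult[OF \<epsilon>(1) x] by simp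
    also have "\<dots> = \<phi> (g (\<epsilon> \<odot>\<^bsub>M\<^esub> x))" using \<psi>(2)[of "f (\<epsilon> \<odot>\<^bsub>M\<^esub> x)"] ex inj by (simp add: U_def)
    also have "\<dots> = \<phi> (g x)" using mod_homD(3)[OF g \<epsilon>(1) x] \<phi>_\<epsilon>[OF mod_homD(1)[OF g x]] by simp
    finally show "\<phi> (h (f x)) = \<phi> (g x)" .
  qed
  then show "\<exists>h\<in>mod_hom L N W. \<forall>x\<in>carrier M. h (f x) = g x" by (intro bexI[OF _ h(1)] ballI)
qed

text \<open>A functional with value one at \<open>x\<close> keeps this value when made invariant,
  because \<open>\<epsilon>\<close> fixes \<open>x\<close>.\<close>

lemma cogenerates:
  assumes N: "fg_right_module L N" and x: "x \<in> carrier N" "x \<noteq> \<zero>\<^bsub>N\<^esub>" "\<epsilon> \<odot>\<^bsub>N\<^esub> x = x"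
  shows "\<exists>h\<in>mod_hom L N W. h x \<noteq> \<zero>\<^bsub>W\<^esub>"
proof -
  interpret KN: vspace K "res N" by (rule vspace_res[OF fg_right_moduleD(1)[OF N]])
  have x': "x \<in> carrier (res N)" "x \<notin> {\<zero>\<^bsub>res N\<^esub>}" using x by auto
  from KN.obtain_functional[OF KN.submodule_zero finitely_generated_res[OF N] x']
  obtain \<psi> where \<psi>: "\<psi> \<in> functionals N" "\<psi> x = \<one>\<^bsub>K\<^esub>" by blast
  obtain h where h: "h \<in> mod_hom L N W" "\<forall>x\<in>carrier N. \<phi> (h x) = \<psi> (\<epsilon> \<odot>\<^bsub>N\<^esub> x)"
    using functional_\<epsilon>[OF fg_right_moduleD(1)[OF N] \<psi>(1)] by (elim bexE)
  interpret \<phi>: right_module_hom K "res W" "regular_module K" \<phi>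
    by (rule right_module_hom_intro[OF right_module_res[OF W.right_module_axioms] K.right_module_regular \<phi>])
  have "h x \<noteq> \<zero>\<^bsub>W\<^esub>" using h(2) x \<psi>(2) \<phi>.zero by auto
  then show ?thesis using h(1) by (intro bexI)
qed

end

section \<open>The dual of the regular module\<close>

context fd_alg
begin

text \<open>The standard injective cogenerator \<open>DL\<close> of right modules.\<close>

definition dual_regular :: "('l, 'l \<Rightarrow> 'k) module" where
  "dual_regular = \<lparr>carrier = carrier (dual_space K L), monoid.mult = undefined, one = undefined,
     ring.zero = ring.zero (dual_space K L), add = add (dual_space K L),
     smult = (\<lambda>r f. dual_right L f r)\<rparr>"

lemma dual_regular_simps [simp]:
  "carrier dual_regular = carrier (dual_space K L)"
  "\<zero>\<^bsub>dual_regular\<^esub> = \<zero>\<^bsub>dual_space K L\<^esub>"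
  "f \<oplus>\<^bsub>dual_regular\<^esub> g = f \<oplus>\<^bsub>dual_space K L\<^esub> g"
  "r \<odot>\<^bsub>dual_regular\<^esub> f = (\<lambda>x\<in>carrier L. f (r \<otimes>\<^bsub>L\<^esub> x))"
  by (simp_all add: dual_regular_def dual_right_def)

sublocale KL': vspace K L
  by (intro vspace.intro right_module_K_L K.field_axioms)

lemma right_module_dual_regular: "right_module L dual_regular"
proof (rule right_moduleI)
  interpret D: right_module K "dual_space K L" by (rule KL'.right_module_dual)
  show "\<exists>g\<in>carrier dual_regular. g \<oplus>\<^bsub>dual_regular\<^esub> f = \<zero>\<^bsub>dual_regular\<^esub>" if "f \<in> carrier dual_regular" for f
    using that D.M.l_neg[of f] D.M.a_inv_closed[of f] unfolding dual_regular_simps by (intro bexI)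
  show "r \<odot>\<^bsub>dual_regular\<^esub> f \<in> carrier dual_regular" if "r \<in> carrier L" "f \<in> carrier dual_regular" for r f
    using that KL'.dualD(3-5)[of f] unfolding dual_regular_simps
    by (intro KL'.dualI mod_homI) (auto simp: L.r_distr smult_mult K.m_comm)
qed (auto simp: L.ring_axioms KL'.dualD(3,4) L.m_assoc K.a_ac L.l_distr KL'.dual_closed
    KL'.dual_closed[unfolded restrict_def] fun_eq_iff extensional_arb[OF KL'.dualD(1)])

text \<open>The case \<open>\<epsilon> = 1\<close>, in which every functional is invariant. A
  functional on \<open>L\<close> is itself an element of \<open>DL\<close>, and it represents itself
  under evaluation at one.\<close>

lemma corepresenting_dual_regular: "corepresenting K L dual_regular (\<lambda>f. f \<one>\<^bsub>L\<^esub>) \<one>\<^bsub>L\<^esub>"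
proof -
  interpret D: right_module L dual_regular by (rule right_module_dual_regular)
  \<comment> \<open>On a linear functional, the action of \<open>c\<close> through \<open>L\<close>
    is multiplication of values by \<open>c\<close>. So both vector space structures have the same
    subspaces, and finite generation carries over.\<close>
  have scal: "c \<odot>\<^bsub>res dual_regular\<^esub> f = c \<odot>\<^bsub>dual_space K L\<^esub> f"
    if "c \<in> carrier K" "f \<in> carrier (dual_space K L)" for c f
    using that KL'.dualD(5)[of f c] by (auto simp: mult_scal intro!: restrict_ext)
  have "submodule H K (dual_space K L) \<longleftrightarrow> submodule H K (res dual_regular)" for H
    unfolding right_module.submodule_iff[OF KL'.right_module_dual, of H]
      right_module.submodule_iff[OF right_module_res[OF right_module_dual_regular], of H]
    using scal by (auto simp: subset_iff simp del: dual_space_simps)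
  then have "finitely_generated K (res dual_regular)"
    using KL'.finitely_generated_dual[OF fin_dim] by (simp add: finitely_generated_def)
  then have fg: "fg_right_module L dual_regular"
    by (simp add: fg_right_module_iff right_module_dual_regular)
  show ?thesis
  proof (intro_locales, rule corepresenting_axioms.intro)
    show "(\<lambda>f. f \<one>\<^bsub>L\<^esub>) \<in> functionals dual_regular"
      by (rule mod_homI) (use KL'.dualD(3,5) in \<open>auto simp: mult_scal K.m_comm\<close>)
    fix \<theta> assume \<theta>: "\<theta> \<in> functionals (regular_module L)"
    have "\<theta> \<in> mod_hom K L (regular_module K)"
      using mod_homD[OF \<theta>] by (intro mod_homI) (auto simp: mult_scal)
    from KL'.dualI[OF this]
    show "\<exists>w\<in>carrier dual_regular. \<forall>l\<in>carrier L. (l \<odot>\<^bsub>dual_regular\<^esub> w) \<one>\<^bsub>L\<^esub> = \<theta> l"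
      by (intro bexI[of _ "restrict \<theta> (carrier L)"]) auto
  next
    fix w assume w: "w \<in> carrier dual_regular"
      and z: "\<And>l. l \<in> carrier L \<Longrightarrow> (l \<odot>\<^bsub>dual_regular\<^esub> w) \<one>\<^bsub>L\<^esub> = \<zero>\<^bsub>K\<^esub>"
    show "w = \<zero>\<^bsub>dual_regular\<^esub>"
      by (rule KL'.dual_eqI) (use w z KL'.dual_closed(1) in auto)
  qed (use fg in \<open>auto\<close>)
qed


subsection \<open>Embeddings into injective modules\<close>

text \<open>The flag lets one construction of envelopes serve for two cogenerators:
  \<open>DL\<close>, which is only known to be injective, and \<open>W\<close>, which is projective
  too.\<close>

definition proj_inj :: "bool \<Rightarrow> ('l, 'x) module \<Rightarrow> bool" where
  "proj_inj b E \<longleftrightarrow> injective_module L E \<and> (b \<longrightarrow> projective_module L E)"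

lemma proj_inj_fg: "proj_inj b E \<Longrightarrow> fg_right_module L E"
  by (simp add: proj_inj_def injective_module_def)

lemma proj_inj_retract:
  assumes "proj_inj b E" "fg_right_module L P" "i \<in> mod_hom L P E" "r \<in> mod_hom L E P"
    "\<And>x. x \<in> carrier P \<Longrightarrow> r (i x) = x"
  shows "proj_inj b P"
  using assms(1) injective_retract[OF _ assms(2-5)] projective_retract[OF _ assms(2-5)]
  unfolding proj_inj_def by simp

lemma obtain_proj_inj_biproduct:
  assumes E: "proj_inj b E" and F: "proj_inj b F"
  obtains P :: "('l, nat \<Rightarrow> 'k) module" and p q i j where "proj_inj b P"
    "p \<in> mod_hom L P E" "q \<in> mod_hom L P F" "i \<in> mod_hom L E P" "j \<in> mod_hom L F P"
    "\<And>x. x \<in> carrier E \<Longrightarrow> p (i x) = x" "\<And>x. x \<in> carrier F \<Longrightarrow> q (j x) = x"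
    "\<And>x. x \<in> carrier E \<Longrightarrow> q (i x) = \<zero>\<^bsub>F\<^esub>" "\<And>x. x \<in> carrier F \<Longrightarrow> p (j x) = \<zero>\<^bsub>E\<^esub>"
proof -
  obtain P :: "('l, nat \<Rightarrow> 'k) module" and p q i j where P: "fg_right_module L P"
    "p \<in> mod_hom L P E" "q \<in> mod_hom L P F" "i \<in> mod_hom L E P" "j \<in> mod_hom L F P"
    and *: "\<And>x. x \<in> carrier E \<Longrightarrow> p (i x) = x" "\<And>x. x \<in> carrier F \<Longrightarrow> q (j x) = x"
    "\<And>x. x \<in> carrier E \<Longrightarrow> q (i x) = \<zero>\<^bsub>F\<^esub>" "\<And>x. x \<in> carrier F \<Longrightarrow> p (j x) = \<zero>\<^bsub>E\<^esub>"
    "\<And>x. x \<in> carrier P \<Longrightarrow> i (p x) \<oplus>\<^bsub>P\<^esub> j (q x) = x"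
    by (rule obtain_biproduct[OF proj_inj_fg[OF E] proj_inj_fg[OF F]]) (rule that, (assumption | simp)+)
  have P': "proj_inj b P"
    using E F injective_biproduct[OF _ _ P *(5)] projective_biproduct[OF _ _ P *(5)]
    unfolding proj_inj_def by simp
  show ?thesis by (rule that[OF P' P(2-5)]) (erule *)+
qed

text \<open>Among all homomorphisms from \<open>M\<close> to modules of the wanted kind, one whose
  kernel has least dimension is injective: if it killed some nonzero \<open>x\<close>, a
  homomorphism to \<open>W\<close> not killing \<open>x\<close> could be added as a further
  component, which shrinks the kernel.\<close>

lemma obtain_embedding:
  fixes M :: "('l, 'x) module" and W :: "('l, 'w) module"
  assumes W: "proj_inj b W" and M: "fg_right_module L M"
    and sep: "\<And>x. x \<in> carrier M \<Longrightarrow> x \<noteq> \<zero>\<^bsub>M\<^esub> \<Longrightarrow> \<exists>h\<in>mod_hom L M W. h x \<noteq> \<zero>\<^bsub>W\<^esub>"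
  obtains E :: "('l, nat \<Rightarrow> 'k) module" and u where "proj_inj b E" "u \<in> mod_hom L M E" "inj_on u (carrier M)"
proof -
  interpret M: right_module L M by (rule fg_right_moduleD(1)[OF M])
  interpret W: right_module L W by (rule fg_right_moduleD(1)[OF proj_inj_fg[OF W]])
  define ker where "ker E u = {x \<in> carrier M. u x = \<zero>\<^bsub>E\<^esub>}" for E :: "('l, nat \<Rightarrow> 'k) module" and u
  define \<mu> where "\<mu> H = vdim K (res (M\<lparr>carrier := H\<rparr>))" for H
  define P where "P n \<longleftrightarrow> (\<exists>(E :: ('l, nat \<Rightarrow> 'k) module) u. proj_inj b E \<and> u \<in> mod_hom L M E \<and> \<mu> (ker E u) = n)" for n
  \<comment> \<open>\<open>W\<close> may live in another type. Its double is a module of the wanted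
    kind in the right type, and the zero map to it starts the minimisation.\<close>
  obtain E0 :: "('l, nat \<Rightarrow> 'k) module" where E0: "proj_inj b E0"
    by (rule obtain_proj_inj_biproduct[OF W W]) (rule that)
  have "P (\<mu> (ker E0 (\<lambda>x. \<zero>\<^bsub>E0\<^esub>)))"
    unfolding P_def
    by (rule exI[of _ E0], rule exI[of _ "\<lambda>x. \<zero>\<^bsub>E0\<^esub>"])
      (simp add: E0 mod_hom_zero[OF fg_right_moduleD(1)[OF proj_inj_fg[OF E0]]])
  then have "P (LEAST n. P n)" by (rule LeastI)
  then obtain E :: "('l, nat \<Rightarrow> 'k) module" and u where E: "proj_inj b E" "u \<in> mod_hom L M E"
    "\<mu> (ker E u) = (LEAST n. P n)" unfolding P_def by (elim exE conjE)
  interpret u: right_module_hom L M E u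
    by (rule right_module_hom_intro[OF M.right_module_axioms fg_right_moduleD(1)[OF proj_inj_fg[OF E(1)]] E(2)])
  have "x = \<zero>\<^bsub>M\<^esub>" if x: "x \<in> carrier M" "u x = \<zero>\<^bsub>E\<^esub>" for x
  proof (rule ccontr)
    assume "x \<noteq> \<zero>\<^bsub>M\<^esub>"
    then obtain h where h: "h \<in> mod_hom L M W" "h x \<noteq> \<zero>\<^bsub>W\<^esub>" using sep[OF x(1)] by blast
    obtain F :: "('l, nat \<Rightarrow> 'k) module" and p q i j where F: "proj_inj b F"
      "p \<in> mod_hom L F E" "q \<in> mod_hom L F W" "i \<in> mod_hom L E F" "j \<in> mod_hom L W F"
      and *: "\<And>x. x \<in> carrier E \<Longrightarrow> p (i x) = x" "\<And>x. x \<in> carrier W \<Longrightarrow> q (j x) = x"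
      "\<And>x. x \<in> carrier E \<Longrightarrow> q (i x) = \<zero>\<^bsub>W\<^esub>" "\<And>x. x \<in> carrier W \<Longrightarrow> p (j x) = \<zero>\<^bsub>E\<^esub>"
      by (rule obtain_proj_inj_biproduct[OF E(1) W]) (rule that, (assumption | simp)+)
    have FM: "right_module L F" by (rule fg_right_moduleD(1)[OF proj_inj_fg[OF F(1)]])
    interpret p: right_module_hom L F E p
      by (rule right_module_hom_intro[OF FM u.cod.right_module_axioms F(2)])
    interpret q: right_module_hom L F W q
      by (rule right_module_hom_intro[OF FM W.right_module_axioms F(3)])
    \<comment> \<open>The map with components \<open>u\<close> and \<open>h\<close>. Its kernel is
      contained in that of \<open>u\<close>, but does not contain \<open>x\<close>.\<close>
    define v where "v = (\<lambda>x. i (u x) \<oplus>\<^bsub>F\<^esub> j (h x))"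
    have v: "v \<in> mod_hom L M F"
      unfolding v_def by (rule mod_hom_add[OF FM mod_hom_comp[OF E(2) F(4)] mod_hom_comp[OF h(1) F(5)]])
    interpret v: right_module_hom L M F v
      by (rule right_module_hom_intro[OF M.right_module_axioms FM v])
    have pq: "p (v y) = u y" "q (v y) = h y" if y: "y \<in> carrier M" for y
    proof -
      have c: "u y \<in> carrier E" "h y \<in> carrier W" using u.closed[OF y] mod_homD(1)[OF h(1) y] by auto
      then have "i (u y) \<in> carrier F" "j (h y) \<in> carrier F" using mod_homD(1)[OF F(4)] mod_homD(1)[OF F(5)] by auto
      then show "p (v y) = u y" "q (v y) = h y" using c * by (simp_all add: v_def p.add q.add)
    qed
    have sub: "ker F v \<subseteq> ker E u" using pq(1) p.zero by (auto simp: ker_def simp flip: pq(1))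
    have "x \<in> ker E u" using x by (simp add: ker_def)
    moreover have "x \<notin> ker F v" using pq(2)[OF x(1)] h(2) q.zero by (auto simp: ker_def)
    ultimately have ne: "ker F v \<noteq> ker E u" by auto
    have kE: "submodule (ker E u) L M" unfolding ker_def by (rule u.submodule_kernel)
    have kF: "submodule (ker F v) L M" unfolding ker_def by (rule v.submodule_kernel)
    have "submodule (ker F v) K (res (M\<lparr>carrier := ker E u\<rparr>))"
      by (rule submodule_res[OF M.right_module_sub[OF kE]]) (simp add: M.submodule_sub[OF kE] kF sub)
    then have "vdim K (res (M\<lparr>carrier := ker E u\<rparr>)\<lparr>carrier := ker F v\<rparr>) < vdim K (res (M\<lparr>carrier := ker E u\<rparr>))"
      by (rule vspace.vdim_sub_less[OF vspace_res[OF M.right_module_sub[OF kE]] _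
            finitely_generated_res[OF fg_sub[OF M kE]]]) (simp add: ne)
    then have "\<mu> (ker F v) < (LEAST n. P n)" using E(3) by (simp add: \<mu>_def)
    moreover have "P (\<mu> (ker F v))"
      unfolding P_def by (rule exI[of _ F], rule exI[of _ v]) (simp add: F(1) v)
    ultimately show False using not_less_Least by blast
  qed
  then have "inj_on u (carrier M)" unfolding u.inj_iff by blast
  then show ?thesis by (rule that[OF E(1,2)])
qed

text \<open>The envelope found inside the target of an embedding is a retract of it, so projectivity
  passes to it together with injectivity.\<close>

lemma obtain_envelope:
  fixes M :: "('l, 'x) module" and W :: "('l, 'w) module"
  assumes W: "proj_inj b W" and M: "fg_right_module L M"
    and sep: "\<And>x. x \<in> carrier M \<Longrightarrow> x \<noteq> \<zero>\<^bsub>M\<^esub> \<Longrightarrow> \<exists>h\<in>mod_hom L M W. h x \<noteq> \<zero>\<^bsub>W\<^esub>"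
  obtains E :: "('l, nat \<Rightarrow> 'k) module" and u where "proj_inj b E" "u \<in> mod_hom L M E" "inj_on u (carrier M)"
    "essential_submodule L (u ` carrier M) E"
proof -
  interpret M: right_module L M by (rule fg_right_moduleD(1)[OF M])
  obtain E :: "('l, nat \<Rightarrow> 'k) module" and u where E: "proj_inj b E" "u \<in> mod_hom L M E" "inj_on u (carrier M)"
    by (rule obtain_embedding[OF W M sep])
  have inj: "injective_module L E" using E(1) by (simp add: proj_inj_def)
  interpret u: right_module_hom L M E u
    by (rule right_module_hom_intro[OF M.right_module_axioms fg_right_moduleD(1)[OF proj_inj_fg[OF E(1)]] E(2)])
  obtain r C where C: "r \<in> mod_hom L E E" "r ` carrier E = C" "submodule C L E" "u ` carrier M \<subseteq> C"
    "\<And>x. x \<in> C \<Longrightarrow> r x = x" "essential_submodule L (u ` carrier M) (E\<lparr>carrier := C\<rparr>)"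
    by (rule obtain_envelope_in_injective[OF inj u.submodule_image[OF M.submodule_carrier]]) (rule that, (assumption | simp)+)
  note CE = u.cod.submoduleD(1)[OF C(3)]
  have "r \<in> mod_hom L E (E\<lparr>carrier := C\<rparr>)"
    by (rule mod_hom_codomain_sub(2)[OF C(1)]) (simp add: C(2))
  then have 1: "proj_inj b (E\<lparr>carrier := C\<rparr>)"
    by (rule proj_inj_retract[OF E(1) fg_sub[OF proj_inj_fg[OF E(1)] C(3)] mod_hom_sub_id[OF CE]]) (simp add: C(5))
  show ?thesis by (rule that[OF 1 mod_hom_codomain_sub(2)[OF E(2) C(4)] E(3) C(6)])
qed

lemma proj_inj_dual_regular: "proj_inj False dual_regular"
  using corepresenting.injective[OF corepresenting_dual_regular] by (simp add: proj_inj_def)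

text \<open>With \<open>\<epsilon> = 1\<close> every element is fixed, so \<open>DL\<close>
  cogenerates all modules. This supplies the terms of the resolution that follow the first
  \<open>m\<close>.\<close>

lemma obtain_injective_envelope:
  fixes M :: "('l, 'x) module"
  assumes M: "fg_right_module L M"
  obtains E :: "('l, nat \<Rightarrow> 'k) module" and u where "proj_inj False E" "u \<in> mod_hom L M E"
    "inj_on u (carrier M)" "essential_submodule L (u ` carrier M) E"
proof -
  have "\<exists>h\<in>mod_hom L M dual_regular. h x \<noteq> \<zero>\<^bsub>dual_regular\<^esub>" if "x \<in> carrier M" "x \<noteq> \<zero>\<^bsub>M\<^esub>" for x
    by (rule corepresenting.cogenerates[OF corepresenting_dual_regular M that])
      (rule right_module.smult_one[OF fg_right_moduleD(1)[OF M] that(1)])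
  from obtain_envelope[OF proj_inj_dual_regular M this] obtain E :: "('l, nat \<Rightarrow> 'k) module" and u
    where "proj_inj False E" "u \<in> mod_hom L M E" "inj_on u (carrier M)"
      "essential_submodule L (u ` carrier M) E" .
  then show ?thesis by (rule that)
qed

end

section \<open>A lower bound for the dominant dimension\<close>

context fd_alg
begin

lemma submodule_orbit:
  assumes "right_module L M" "x \<in> carrier M"
  shows "submodule ((\<lambda>l. l \<odot>\<^bsub>M\<^esub> x) ` carrier L) L M"
proof -
  interpret h: right_module_hom L "regular_module L" M "\<lambda>l. l \<odot>\<^bsub>M\<^esub> x"
    by (rule right_module_hom_intro[OF regular assms(1) orbit_hom[OF assms]])
  show ?thesis using h.submodule_image[OF h.dom.submodule_carrier] by simp
qed

text \<open>Essentiality tested on the cyclic submodule generated by \<open>x\<close>. To show that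
  \<open>x\<close> is zero one only has to study its multiples that lie in \<open>H\<close>.\<close>

lemma essential_orbit:
  assumes M: "right_module L M" and H: "essential_submodule L H M" and x: "x \<in> carrier M"
    and "\<And>l. l \<in> carrier L \<Longrightarrow> l \<odot>\<^bsub>M\<^esub> x \<in> H \<Longrightarrow> l \<odot>\<^bsub>M\<^esub> x = \<zero>\<^bsub>M\<^esub>"
  shows "x = \<zero>\<^bsub>M\<^esub>"
proof -
  interpret right_module L M by fact
  let ?N = "(\<lambda>l. l \<odot>\<^bsub>M\<^esub> x) ` carrier L"
  have N: "submodule ?N L M" by (rule submodule_orbit[OF M x])
  have "\<zero>\<^bsub>M\<^esub> \<in> H" using H submoduleD(3) by (simp add: essential_submodule_def)
  then have "?N \<inter> H = {\<zero>\<^bsub>M\<^esub>}" using assms(4) submoduleD(3)[OF N] by auto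
  then have "?N = {\<zero>\<^bsub>M\<^esub>}" using H N by (simp add: essential_submodule_def)
  moreover have "x \<in> ?N" using smult_one[OF x] L.one_closed by (metis imageI)
  ultimately show ?thesis by simp
qed

end

text \<open>For the replicated algebra, \<open>f i\<close> is the idempotent supported on the vertices above \<open>i\<close>, and
  \<open>Suc n\<close> is the number of copies of \<open>D A\<close>.\<close>

locale layered_algebra = fd_alg K L for K :: "'k ring" and L :: "('k, 'l) module" +
  fixes f :: "nat \<Rightarrow> 'l" and n :: nat and \<phi> :: "'l \<Rightarrow> 'k"
  assumes f_closed: "f i \<in> carrier L"
    and f_shift: "l \<in> carrier L \<Longrightarrow> f (Suc i) \<otimes>\<^bsub>L\<^esub> l \<otimes>\<^bsub>L\<^esub> f i = f (Suc i) \<otimes>\<^bsub>L\<^esub> l"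
    and f_zero: "l \<in> carrier L \<Longrightarrow> f 0 \<otimes>\<^bsub>L\<^esub> l \<otimes>\<^bsub>L\<^esub> f 0 = l \<otimes>\<^bsub>L\<^esub> f 0"
    and f_top: "i \<le> n \<Longrightarrow> f i \<otimes>\<^bsub>L\<^esub> f n = f n"
    and corep: "corepresenting K L (regular_module L\<lparr>carrier := (\<lambda>l. f 0 \<otimes>\<^bsub>L\<^esub> l) ` carrier L\<rparr>) \<phi>
      (\<one>\<^bsub>L\<^esub> \<ominus>\<^bsub>L\<^esub> f n)"
begin

section \<open>Envelopes over a layered algebra\<close>

definition W :: "('l, 'l) module" where
  "W = regular_module L\<lparr>carrier := (\<lambda>l. f 0 \<otimes>\<^bsub>L\<^esub> l) ` carrier L\<rparr>"

lemma W_simps: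
  "carrier W = (\<lambda>l. f 0 \<otimes>\<^bsub>L\<^esub> l) ` carrier L" "\<zero>\<^bsub>W\<^esub> = \<zero>\<^bsub>L\<^esub>" "x \<oplus>\<^bsub>W\<^esub> y = x \<oplus>\<^bsub>L\<^esub> y" "r \<odot>\<^bsub>W\<^esub> x = x \<otimes>\<^bsub>L\<^esub> r"
  by (simp_all add: W_def)

sublocale corepresenting K L W \<phi> "\<one>\<^bsub>L\<^esub> \<ominus>\<^bsub>L\<^esub> f n"
  unfolding W_def by (rule corep)

lemma f0_idem: "f 0 \<otimes>\<^bsub>L\<^esub> f 0 = f 0"
  using f_zero[OF L.one_closed] f_closed[of 0] by simp

lemma W_closed: "w \<in> carrier W \<Longrightarrow> w \<in> carrier L"
  using f_closed[of 0] by (auto simp: W_simps)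

lemma f0_W: "w \<in> carrier W \<Longrightarrow> f 0 \<otimes>\<^bsub>L\<^esub> w = w"
  using f_closed[of 0] by (auto simp: W_simps f0_idem simp flip: L.m_assoc)

lemma f0_hom: "(\<lambda>l. f 0 \<otimes>\<^bsub>L\<^esub> l) \<in> mod_hom L (regular_module L) W"
  using f_closed[of 0] by (intro mod_homI) (auto simp: W_simps L.r_distr L.m_assoc)

lemma W_incl: "(\<lambda>w. w) \<in> mod_hom L W (regular_module L)"
  using W_closed by (intro mod_homI) (auto simp: W_simps(2-4))

lemma proj_inj_W: "proj_inj True W"
  unfolding proj_inj_def
  using injective projective_retract[OF projective_regular fgW W_incl f0_hom f0_W] by simp

lemma fixed_by_\<epsilon>:
  assumes M: "right_module L M" and x: "x \<in> carrier M" "f n \<odot>\<^bsub>M\<^esub> x = \<zero>\<^bsub>M\<^esub>"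
  shows "(\<one>\<^bsub>L\<^esub> \<ominus>\<^bsub>L\<^esub> f n) \<odot>\<^bsub>M\<^esub> x = x"
proof -
  interpret right_module L M by fact
  interpret h: right_module_hom L "regular_module L" M "\<lambda>l. l \<odot>\<^bsub>M\<^esub> x"
    by (rule right_module_hom_intro[OF regular M orbit_hom[OF M x(1)]])
  show ?thesis using h.minus[of "\<one>\<^bsub>L\<^esub>" "f n"] x f_closed[of n] by (simp add: smult_one minus_zero_right)
qed

text \<open>A module killed by \<open>f j\<close> is killed by \<open>f n\<close> too, because
  \<open>f j\<close> times \<open>f n\<close> is \<open>f n\<close>. All its elements are therefore
  fixed by \<open>\<epsilon>\<close>, and \<open>W\<close> cogenerates it.\<close>

lemma obtain_proj_inj_envelope:
  assumes M: "fg_right_module L M" and j: "j \<le> n" and zero: "\<And>x. x \<in> carrier M \<Longrightarrow> f j \<odot>\<^bsub>M\<^esub> x = \<zero>\<^bsub>M\<^esub>"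
  obtains E :: "('l, nat \<Rightarrow> 'k) module" and u where "proj_inj True E" "u \<in> mod_hom L M E"
    "inj_on u (carrier M)" "essential_submodule L (u ` carrier M) E"
proof -
  interpret right_module L M by (rule fg_right_moduleD(1)[OF M])
  have "\<exists>h\<in>mod_hom L M W. h x \<noteq> \<zero>\<^bsub>W\<^esub>" if x: "x \<in> carrier M" "x \<noteq> \<zero>\<^bsub>M\<^esub>" for x
  proof -
    have "f n \<odot>\<^bsub>M\<^esub> x = f n \<odot>\<^bsub>M\<^esub> (f j \<odot>\<^bsub>M\<^esub> x)"
      using smult_assoc[OF f_closed[of j] f_closed[of n] x(1)] f_top[OF j] by simp
    then have "f n \<odot>\<^bsub>M\<^esub> x = \<zero>\<^bsub>M\<^esub>" using zero[OF x(1)] smult_zero_module[OF f_closed[of n]] by simp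
    then show ?thesis
      by (intro cogenerates[OF M x] fixed_by_\<epsilon> x(1) right_module_axioms)
  qed
  from obtain_envelope[OF proj_inj_W M this] obtain E :: "('l, nat \<Rightarrow> 'k) module" and u
    where "proj_inj True E" "u \<in> mod_hom L M E" "inj_on u (carrier M)"
      "essential_submodule L (u ` carrier M) E" .
  then show ?thesis by (rule that)
qed

text \<open>By \<open>f_shift\<close>, \<open>f j\<close> fixes every multiple of
  \<open>f (Suc j) \<odot> x\<close>, whereas it kills the image of \<open>M\<close>. So the cyclic
  submodule of \<open>f (Suc j) \<odot> x\<close> meets this image only in zero.\<close>

lemma f_Suc_envelope:
  assumes M: "right_module L M" and E: "right_module L E" and u: "u \<in> mod_hom L M E"
    and ess: "essential_submodule L (u ` carrier M) E"
    and zero: "\<And>x. x \<in> carrier M \<Longrightarrow> f j \<odot>\<^bsub>M\<^esub> x = \<zero>\<^bsub>M\<^esub>" and x: "x \<in> carrier E"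
  shows "f (Suc j) \<odot>\<^bsub>E\<^esub> x = \<zero>\<^bsub>E\<^esub>"
proof (rule essential_orbit[OF E ess])
  interpret u: right_module_hom L M E u by (rule right_module_hom_intro[OF M E u])
  show x': "f (Suc j) \<odot>\<^bsub>E\<^esub> x \<in> carrier E" by (rule u.cod.smult_closed[OF f_closed x])
  fix l assume l: "l \<in> carrier L" and "l \<odot>\<^bsub>E\<^esub> (f (Suc j) \<odot>\<^bsub>E\<^esub> x) \<in> u ` carrier M"
  then obtain z where z: "z \<in> carrier M" "l \<odot>\<^bsub>E\<^esub> (f (Suc j) \<odot>\<^bsub>E\<^esub> x) = u z" by (elim imageE)
  have "f j \<odot>\<^bsub>E\<^esub> u z = \<zero>\<^bsub>E\<^esub>" using u.smult[OF f_closed z(1), of j] zero[OF z(1)] u.zero by simp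
  moreover have "f j \<odot>\<^bsub>E\<^esub> u z = u z"
    using f_shift[OF l, of j] f_closed[of j] f_closed[of "Suc j"] l x
    by (simp flip: z(2) u.cod.smult_assoc)
  ultimately show "l \<odot>\<^bsub>E\<^esub> (f (Suc j) \<odot>\<^bsub>E\<^esub> x) = \<zero>\<^bsub>E\<^esub>" using z(2) by simp
qed

text \<open>Elements of \<open>L\<close> with a component in \<open>W\<close> are detected by the
  projection to \<open>W\<close>. If \<open>f\<^sub>0 x = 0\<close>, then
  \<open>x f\<^sub>0 = f\<^sub>0 x f\<^sub>0 = 0\<close>, so \<open>f n\<close> kills
  \<open>x\<close> and \<open>cogenerates\<close> applies. In this way \<open>L\<close> can be
  enveloped in one piece, without splitting it first.\<close>

lemma regular_cogenerated:
  assumes x: "x \<in> carrier (regular_module L)" "x \<noteq> \<zero>\<^bsub>regular_module L\<^esub>"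
  shows "\<exists>h\<in>mod_hom L (regular_module L) W. h x \<noteq> \<zero>\<^bsub>W\<^esub>"
proof (cases "f 0 \<otimes>\<^bsub>L\<^esub> x = \<zero>\<^bsub>L\<^esub>")
  case False
  then show ?thesis using f0_hom by (intro bexI[of _ "\<lambda>l. f 0 \<otimes>\<^bsub>L\<^esub> l"]) (auto simp: W_simps)
next
  case True
  have xL: "x \<in> carrier L" using x by simp
  have "x \<otimes>\<^bsub>L\<^esub> f n = x \<otimes>\<^bsub>L\<^esub> f 0 \<otimes>\<^bsub>L\<^esub> f n"
    using f_top[of 0] xL f_closed by (simp add: L.m_assoc)
  also have "x \<otimes>\<^bsub>L\<^esub> f 0 = \<zero>\<^bsub>L\<^esub>"
    using f_zero[OF xL] f_closed[of 0] unfolding True by simp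
  also have "\<zero>\<^bsub>L\<^esub> \<otimes>\<^bsub>L\<^esub> f n = \<zero>\<^bsub>L\<^esub>" using f_closed by simp
  finally have "f n \<odot>\<^bsub>regular_module L\<^esub> x = \<zero>\<^bsub>regular_module L\<^esub>" by simp
  then show ?thesis by (intro cogenerates[OF fg_regular x] fixed_by_\<epsilon>[OF regular x(1)])
qed

text \<open>As \<open>W\<close> is injective, the envelope splits as \<open>u (f 0 L)\<close> plus an envelope of the complement of
  \<open>f 0 L\<close> in \<open>L\<close>, and the latter is killed by \<open>f 1\<close>.\<close>

lemma f_1_envelope_regular:
  assumes E: "fg_right_module L E" and u: "u \<in> mod_hom L (regular_module L) E" "inj_on u (carrier L)"
    and ess: "essential_submodule L (u ` carrier L) E" and x: "x \<in> carrier E"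
  shows "f 1 \<odot>\<^bsub>E\<^esub> x \<in> u ` carrier L"
proof -
  note EM = fg_right_moduleD(1)[OF E]
  interpret u: right_module_hom L "regular_module L" E u by (rule right_module_hom_intro[OF regular EM u(1)])
  have "inj_on u (carrier (regular_module L))" using u(2) by simp
  \<comment> \<open>\<open>h\<close> extends the projection of \<open>L\<close> to \<open>W\<close>.
    Hence \<open>h\<close> after \<open>u\<close> fixes \<open>W\<close>, and \<open>E\<close> is
    the sum of \<open>u W\<close> and the kernel of \<open>h\<close>.\<close>
  from injective_extend[OF injective fg_regular E u(1) this f0_hom]
  obtain h where h: "h \<in> mod_hom L E W" "\<forall>l\<in>carrier L. h (u l) = f 0 \<otimes>\<^bsub>L\<^esub> l" by auto
  interpret h: right_module_hom L E W h by (rule right_module_hom_intro[OF EM W.right_module_axioms h(1)])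
  have uh: "u (h y) \<in> carrier E" "h (u (h y)) = h y" if y: "y \<in> carrier E" for y
    using u.closed[of "h y"] W_closed[OF h.closed[OF y]] h(2) f0_W[OF h.closed[OF y]] by auto
  \<comment> \<open>\<open>c'\<close> is the component of \<open>x\<close> in the kernel of
    \<open>h\<close>. It is enough that \<open>f 1\<close> kills it, for then \<open>f 1\<close>
    acts on \<open>x\<close> as on \<open>u (h x)\<close>, which lies in \<open>u L\<close>.\<close>
  define c' where "c' = x \<ominus>\<^bsub>E\<^esub> u (h x)"
  define c where "c = f 1 \<odot>\<^bsub>E\<^esub> c'"
  have c': "c' \<in> carrier E" unfolding c'_def using uh(1)[OF x] x by (rule u.cod.M.minus_closed[rotated])
  have c: "c \<in> carrier E" unfolding c_def by (rule u.cod.smult_closed[OF f_closed c'])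
  have hc': "h c' = \<zero>\<^bsub>W\<^esub>"
    unfolding c'_def using h.minus[OF x uh(1)[OF x]] uh(2)[OF x] W.minus_eq_zero[OF h.closed[OF x] h.closed[OF x]] by simp
  \<comment> \<open>If a multiple of \<open>c\<close> is \<open>u z\<close>, then
    \<open>z f\<^sub>0 = z\<close> by \<open>f_shift\<close>, and \<open>f\<^sub>0 z = 0\<close>
    because \<open>h\<close> kills it. But then
    \<open>z f\<^sub>0 = f\<^sub>0 z f\<^sub>0 = 0\<close>, so the multiple is zero.\<close>
  have "c = \<zero>\<^bsub>E\<^esub>"
  proof (rule essential_orbit[OF EM ess c])
    fix l assume l: "l \<in> carrier L" and "l \<odot>\<^bsub>E\<^esub> c \<in> u ` carrier L"
    then obtain z where z: "z \<in> carrier L" "l \<odot>\<^bsub>E\<^esub> c = u z" by (elim imageE)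
    have zR: "z \<in> carrier (regular_module L)" using z by simp
    have lc: "l \<odot>\<^bsub>E\<^esub> c = (f 1 \<otimes>\<^bsub>L\<^esub> l) \<odot>\<^bsub>E\<^esub> c'"
      unfolding c_def by (rule u.cod.smult_assoc[symmetric, OF f_closed l c'])
    have fl: "f 1 \<otimes>\<^bsub>L\<^esub> l \<in> carrier L" using f_closed l by simp
    have "h (u z) = \<zero>\<^bsub>W\<^esub>"
      using h.smult[OF fl c'] hc' W.smult_zero_module[OF fl] by (simp flip: z(2) add: lc)
    then have fz: "f 0 \<otimes>\<^bsub>L\<^esub> z = \<zero>\<^bsub>L\<^esub>" using h(2) z(1) by (simp add: W_simps)
    have "u (z \<otimes>\<^bsub>L\<^esub> f 0) = f 0 \<odot>\<^bsub>E\<^esub> u z" using u.smult[OF f_closed[of 0] zR] by simp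
    also have "\<dots> = (f 1 \<otimes>\<^bsub>L\<^esub> l \<otimes>\<^bsub>L\<^esub> f 0) \<odot>\<^bsub>E\<^esub> c'"
      unfolding z(2)[symmetric] lc by (rule u.cod.smult_assoc[symmetric, OF fl f_closed c'])
    also have "\<dots> = u z" using f_shift[OF l, of 0] by (simp flip: z(2) add: lc)
    finally have "z \<otimes>\<^bsub>L\<^esub> f 0 = z" using inj_onD[OF u(2)] z(1) f_closed by simp
    moreover have "z \<otimes>\<^bsub>L\<^esub> f 0 = \<zero>\<^bsub>L\<^esub>" using f_zero[OF z(1)] f_closed[of 0] unfolding fz by simp
    ultimately have "z = \<zero>\<^bsub>L\<^esub>" by simp
    then show "l \<odot>\<^bsub>E\<^esub> c = \<zero>\<^bsub>E\<^esub>" using z(2) u.zero by simp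
  qed
  moreover have "f 1 \<odot>\<^bsub>E\<^esub> x = c \<oplus>\<^bsub>E\<^esub> f 1 \<odot>\<^bsub>E\<^esub> u (h x)"
    unfolding c_def using u.cod.smult_add_module[OF f_closed[of 1] c' uh(1)[OF x]]
    by (simp add: c'_def u.cod.diff_add_cancel[OF x uh(1)[OF x]])
  moreover have "f 1 \<odot>\<^bsub>E\<^esub> u (h x) = u (h x \<otimes>\<^bsub>L\<^esub> f 1)"
    using u.smult[OF f_closed[of 1], of "h x"] W_closed[OF h.closed[OF x]] by simp
  ultimately have "f 1 \<odot>\<^bsub>E\<^esub> x = u (h x \<otimes>\<^bsub>L\<^esub> f 1)"
    using u.closed[of "h x \<otimes>\<^bsub>L\<^esub> f 1"] W_closed[OF h.closed[OF x]] f_closed[of 1] by simp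
  moreover have "h x \<otimes>\<^bsub>L\<^esub> f 1 \<in> carrier L" using W_closed[OF h.closed[OF x]] f_closed[of 1] by simp
  ultimately show ?thesis by (rule image_eqI)
qed

text \<open>\<open>H\<close> is the image in \<open>E\<close> of the preceding term of the resolution.\<close>

definition stage :: "nat \<Rightarrow> ('l, nat \<Rightarrow> 'k) module \<times> (nat \<Rightarrow> 'k) set \<Rightarrow> bool" where
  "stage j = (\<lambda>(E, H). proj_inj (j \<le> Suc n) E \<and> essential_submodule L H E \<and>
     (j \<le> n \<longrightarrow> (\<forall>x\<in>carrier E. f j \<odot>\<^bsub>E\<^esub> x \<in> H)))"

definition next_stage :: "('l, nat \<Rightarrow> 'k) module \<times> (nat \<Rightarrow> 'k) set \<Rightarrow>
    ('l, nat \<Rightarrow> 'k) module \<times> (nat \<Rightarrow> 'k) set \<Rightarrow> ((nat \<Rightarrow> 'k) \<Rightarrow> (nat \<Rightarrow> 'k)) \<Rightarrow> bool" where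
  "next_stage = (\<lambda>(E, H) (E', H') d. d \<in> mod_hom L E E' \<and> d ` carrier E = H' \<and>
     {x \<in> carrier E. d x = \<zero>\<^bsub>E'\<^esub>} = H)"

text \<open>For \<open>j \<le> n\<close> the cokernel \<open>E / H\<close> is killed by
  \<open>f j\<close>, since \<open>f j\<close> maps \<open>E\<close> into \<open>H\<close>. A stage
  asks for this and not for \<open>f j\<close> to kill \<open>E\<close>, because the first term
  contains \<open>L\<close>, on which \<open>f 1\<close> need not act as zero.\<close>

lemma stage_next:
  assumes "stage j s"
  shows "\<exists>s'. stage (Suc j) s' \<and> (\<exists>d. next_stage s s' d)"
proof -
  obtain E H where s: "s = (E, H)" by (cases s)
  have E: "proj_inj (j \<le> Suc n) E" and H: "essential_submodule L H E"
    and fj: "\<And>x. j \<le> n \<Longrightarrow> x \<in> carrier E \<Longrightarrow> f j \<odot>\<^bsub>E\<^esub> x \<in> H"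
    using assms by (auto simp: stage_def s)
  have sH: "submodule H L E" using H by (simp add: essential_submodule_def)
  obtain \<pi> :: "(nat \<Rightarrow> 'k) \<Rightarrow> (nat \<Rightarrow> 'k)" and Q :: "('l, nat \<Rightarrow> 'k) module"
    where Q: "fg_right_module L Q" "\<pi> \<in> mod_hom L E Q" "\<pi> ` carrier E = carrier Q"
      "{x \<in> carrier E. \<pi> x = \<zero>\<^bsub>Q\<^esub>} = H"
    by (rule obtain_fg_quotient[OF proj_inj_fg[OF E] sH])
  interpret \<pi>: right_module_hom L E Q \<pi>
    by (rule right_module_hom_intro[OF fg_right_moduleD(1)[OF proj_inj_fg[OF E]] fg_right_moduleD(1)[OF Q(1)] Q(2)])
  have fQ: "f j \<odot>\<^bsub>Q\<^esub> y = \<zero>\<^bsub>Q\<^esub>" if "j \<le> n" "y \<in> carrier Q" for y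
  proof -
    from that(2)[folded Q(3)] obtain x where x: "x \<in> carrier E" "y = \<pi> x" by (elim imageE)
    have "f j \<odot>\<^bsub>E\<^esub> x \<in> {x \<in> carrier E. \<pi> x = \<zero>\<^bsub>Q\<^esub>}" unfolding Q(4) by (rule fj[OF that(1) x(1)])
    then show ?thesis using \<pi>.smult[OF f_closed x(1), of j] x(2) by simp
  qed
  \<comment> \<open>The flag \<open>j \<le> n\<close> is the same as
    \<open>Suc j \<le> Suc n\<close>, which the next stage demands. Where it fails, any injective
    envelope continues the resolution.\<close>
  obtain E' :: "('l, nat \<Rightarrow> 'k) module" and u where E': "proj_inj (j \<le> n) E'" "u \<in> mod_hom L Q E'"
    "inj_on u (carrier Q)" "essential_submodule L (u ` carrier Q) E'"
  proof (cases "j \<le> n")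
    case True
    obtain E' :: "('l, nat \<Rightarrow> 'k) module" and u where "proj_inj True E'" "u \<in> mod_hom L Q E'"
      "inj_on u (carrier Q)" "essential_submodule L (u ` carrier Q) E'"
      by (rule obtain_proj_inj_envelope[OF Q(1) True fQ[OF True]])
    then show ?thesis using True by (intro that[of E' u]) simp_all
  next
    case False
    obtain E' :: "('l, nat \<Rightarrow> 'k) module" and u where "proj_inj False E'" "u \<in> mod_hom L Q E'"
      "inj_on u (carrier Q)" "essential_submodule L (u ` carrier Q) E'"
      by (rule obtain_injective_envelope[OF Q(1)])
    then show ?thesis using False by (intro that[of E' u]) simp_all
  qed
  note EM' = fg_right_moduleD(1)[OF proj_inj_fg[OF E'(1)]]
  interpret u: right_module_hom L Q E' u
    by (rule right_module_hom_intro[OF fg_right_moduleD(1)[OF Q(1)] EM' E'(2)])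
  \<comment> \<open>From the second term on, \<open>f (Suc j)\<close> kills the whole envelope, and
    zero lies in every submodule.\<close>
  have "f (Suc j) \<odot>\<^bsub>E'\<^esub> x \<in> u ` carrier Q" if "Suc j \<le> n" "x \<in> carrier E'" for x
  proof -
    have "j \<le> n" using that(1) by simp
    have "f (Suc j) \<odot>\<^bsub>E'\<^esub> x = \<zero>\<^bsub>E'\<^esub>"
      by (rule f_Suc_envelope[OF fg_right_moduleD(1)[OF Q(1)] EM' E'(2,4) fQ[OF \<open>j \<le> n\<close>] that(2)])
    then show ?thesis using imageI[OF \<pi>.cod.M.zero_closed, of u] u.zero by simp
  qed
  then have "stage (Suc j) (E', u ` carrier Q)"
    using E'(1,4) by (simp add: stage_def)
  moreover have "next_stage s (E', u ` carrier Q) (\<lambda>x. u (\<pi> x))"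
  proof -
    have "(\<lambda>x. u (\<pi> x)) ` carrier E = u ` carrier Q" unfolding Q(3)[symmetric] by (simp add: image_image)
    moreover have "u (\<pi> x) = \<zero>\<^bsub>E'\<^esub> \<longleftrightarrow> \<pi> x = \<zero>\<^bsub>Q\<^esub>" if "x \<in> carrier E" for x
      using E'(3) u.inj_iff \<pi>.closed[OF that] u.zero by auto
    then have "{x \<in> carrier E. u (\<pi> x) = \<zero>\<^bsub>E'\<^esub>} = H" unfolding Q(4)[symmetric] by auto
    ultimately show ?thesis
      using mod_hom_comp[OF Q(2) E'(2)] by (simp add: next_stage_def s)
  qed
  ultimately show ?thesis by (intro exI conjI)
qed

lemma stage_first:
  "\<exists>s e. stage 1 s \<and> e \<in> mod_hom L (regular_module L) (fst s) \<and> inj_on e (carrier L) \<and> e ` carrier L = snd s"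
proof -
  obtain E :: "('l, nat \<Rightarrow> 'k) module" and u where E: "proj_inj True E" "u \<in> mod_hom L (regular_module L) E"
    "inj_on u (carrier (regular_module L))" "essential_submodule L (u ` carrier (regular_module L)) E"
    by (rule obtain_envelope[OF proj_inj_W fg_regular regular_cogenerated])
  have "stage 1 (E, u ` carrier L)"
    using E f_1_envelope_regular[OF proj_inj_fg[OF E(1)] E(2)] by (simp add: stage_def)
  then show ?thesis using E(2,3)
    by (intro exI[of _ "(E, u ` carrier L)"] exI[of _ u]) simp
qed

theorem dom_dim_ge: "dom_dim L \<ge> enat (Suc n)"
proof -
  obtain s0 e where s0: "stage 1 s0" and e: "e \<in> mod_hom L (regular_module L) (fst s0)"
    "inj_on e (carrier L)" "e ` carrier L = snd s0"
    using stage_first by (elim exE conjE)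
  \<comment> \<open>Dependent choice, with a clause at \<open>i = 0\<close> that pins the start to
    \<open>s0\<close>, the term in which \<open>e\<close> embeds \<open>L\<close>.\<close>
  have "\<exists>s. \<forall>i. (stage (Suc i) (s i) \<and> (i = 0 \<longrightarrow> s i = s0)) \<and> (\<exists>d. next_stage (s i) (s (Suc i)) d)"
  proof (rule dependent_nat_choice)
    show "\<exists>s. stage (Suc 0) s \<and> (0 = (0::nat) \<longrightarrow> s = s0)"
      by (rule exI[of _ s0]) (use s0 in simp)
    fix s and i :: nat assume "stage (Suc i) s \<and> (i = 0 \<longrightarrow> s = s0)"
    then show "\<exists>s'. (stage (Suc (Suc i)) s' \<and> (Suc i = 0 \<longrightarrow> s' = s0)) \<and> (\<exists>d. next_stage s s' d)"
      using stage_next[of "Suc i" s] by simp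
  qed
  then obtain s where s: "\<And>i. stage (Suc i) (s i)" "s 0 = s0" and d: "\<And>i. \<exists>d. next_stage (s i) (s (Suc i)) d"
    by blast
  from d have "\<forall>i. \<exists>d. next_stage (s i) (s (Suc i)) d" by simp
  from choice[OF this] obtain d where d: "\<forall>i. next_stage (s i) (s (Suc i)) (d i)" by (elim exE)
  \<comment> \<open>The resolution starts at index 1 and the sequence of stages at 0, so the map
    leaving \<open>I j\<close> is \<open>d (j - 1)\<close>.\<close>
  define I where "I j = fst (s (j - 1))" for j
  have st: "proj_inj (j \<le> Suc n) (I j)" "essential_submodule L (snd (s (j - 1))) (I j)" if "j \<ge> 1" for j
    using s(1)[of "j - 1"] that by (simp_all add: stage_def I_def split_beta)
  have hd: "d (j - 1) \<in> mod_hom L (I j) (I (j + 1))" "d (j - 1) ` carrier (I j) = snd (s j)"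
    "{x \<in> carrier (I j). d (j - 1) x = \<zero>\<^bsub>I (j + 1)\<^esub>} = snd (s (j - 1))" if "j \<ge> 1" for j
    using d[rule_format, of "j - 1"] that by (simp_all add: next_stage_def I_def split_beta)
  have "minimal_injective_resolution L (regular_module L) I e (\<lambda>j. d (j - 1))"
    unfolding minimal_injective_resolution_def
  proof (intro conjI allI impI)
    fix j :: nat assume j: "1 \<le> j"
    show "injective_module L (I j)" using st(1)[OF j] by (simp add: proj_inj_def)
    show "d (j - 1) \<in> mod_hom L (I j) (I (j + 1))" by (rule hd(1)[OF j])
    show "d (j - 1) ` carrier (I j) = {x \<in> carrier (I (j + 1)). d (j + 1 - 1) x = \<zero>\<^bsub>I (j + 2)\<^esub>}"
      using hd(2)[OF j] hd(3)[of "j + 1"] by simp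
    show "essential_submodule L (d (j - 1) ` carrier (I j)) (I (j + 1))"
      using hd(2)[OF j] st(2)[of "j + 1"] by simp
  next
    show "e \<in> mod_hom L (regular_module L) (I 1)" "inj_on e (carrier (regular_module L))"
      using e s(2) by (simp_all add: I_def)
    show "e ` carrier (regular_module L) = {x \<in> carrier (I 1). d (1 - 1) x = \<zero>\<^bsub>I 2\<^esub>}"
      using e(3) s(2) hd(3)[of 1] by (simp add: numeral_2_eq_2)
    show "essential_submodule L (e ` carrier (regular_module L)) (I 1)"
      using e(3) s(2) st(2)[of 1] by simp
  qed
  moreover have "projective_module L (I j)" if "1 \<le> j" "j \<le> Suc n" for j
    using st(1)[OF that(1)] that(2) by (simp add: proj_inj_def)
  ultimately show ?thesis
    unfolding dom_dim_def by (intro Sup_upper) blast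
qed

end

section \<open>Replicated algebras\<close>

locale replicated = A: fd_alg K A for K :: "'k ring" and A :: "('k, 'a) module" +
  fixes m :: nat
begin

abbreviation D where "D \<equiv> dual_space K A"
abbreviation R where "R \<equiv> replicated_algebra K m A"

section \<open>The replicated algebra is an algebra\<close>

lemma carrier_R: "carrier R = ({..m} \<rightarrow>\<^sub>E carrier A) \<times> ({1..m} \<rightarrow>\<^sub>E carrier D)"
  by (simp add: replicated_algebra_def Let_def)

lemma R_simps [simp]:
  "\<one>\<^bsub>R\<^esub> = (\<lambda>i\<in>{..m}. \<one>\<^bsub>A\<^esub>, \<lambda>i\<in>{1..m}. \<lambda>x\<in>carrier A. \<zero>\<^bsub>K\<^esub>)"
  "\<zero>\<^bsub>R\<^esub> = (\<lambda>i\<in>{..m}. \<zero>\<^bsub>A\<^esub>, \<lambda>i\<in>{1..m}. \<lambda>x\<in>carrier A. \<zero>\<^bsub>K\<^esub>)"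
  "p \<oplus>\<^bsub>R\<^esub> p' = (\<lambda>i\<in>{..m}. fst p i \<oplus>\<^bsub>A\<^esub> fst p' i, \<lambda>i\<in>{1..m}. \<lambda>x\<in>carrier A. snd p i x \<oplus>\<^bsub>K\<^esub> snd p' i x)"
  "c \<odot>\<^bsub>R\<^esub> p = (\<lambda>i\<in>{..m}. c \<odot>\<^bsub>A\<^esub> fst p i, \<lambda>i\<in>{1..m}. \<lambda>x\<in>carrier A. c \<otimes>\<^bsub>K\<^esub> snd p i x)"
  "p \<otimes>\<^bsub>R\<^esub> p' = (\<lambda>i\<in>{..m}. fst p i \<otimes>\<^bsub>A\<^esub> fst p' i, \<lambda>i\<in>{1..m}. \<lambda>x\<in>carrier A.
     snd p i (fst p' (i - 1) \<otimes>\<^bsub>A\<^esub> x) \<oplus>\<^bsub>K\<^esub> snd p' i (x \<otimes>\<^bsub>A\<^esub> fst p i))"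
  by (simp_all add: replicated_algebra_def Let_def split_beta dual_left_def dual_right_def restrict_def fun_eq_iff)

lemma R_closed:
  assumes "p \<in> carrier R"
  shows "i \<le> m \<Longrightarrow> fst p i \<in> carrier A" "\<lbrakk>1 \<le> i; i \<le> m\<rbrakk> \<Longrightarrow> snd p i \<in> carrier D"
  using assms by (auto simp: carrier_R PiE_def Pi_iff)

lemma pred_closed:
  assumes "p \<in> carrier R" "i \<le> m"
  shows "fst p (i - Suc 0) \<in> carrier A"
  using R_closed(1)[OF assms(1), of "i - Suc 0"] assms(2) by simp

lemma snd_closed:
  assumes "p \<in> carrier R" "Suc 0 \<le> i" "i \<le> m"
  shows "x \<in> carrier A \<Longrightarrow> snd p i x \<in> carrier K"
    "\<lbrakk>x \<in> carrier A; y \<in> carrier A\<rbrakk> \<Longrightarrow> snd p i (x \<oplus>\<^bsub>A\<^esub> y) = snd p i x \<oplus>\<^bsub>K\<^esub> snd p i y"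
    "\<lbrakk>c \<in> carrier K; x \<in> carrier A\<rbrakk> \<Longrightarrow> snd p i (c \<odot>\<^bsub>A\<^esub> x) = c \<otimes>\<^bsub>K\<^esub> snd p i x"
    "snd p i \<zero>\<^bsub>A\<^esub> = \<zero>\<^bsub>K\<^esub>"
  using A.KL'.dualD(3-5) A.KL'.dual_zero R_closed(2)[OF assms(1), of i] assms(2,3) by auto

lemma R_eqI:
  assumes "p \<in> carrier R" "p' \<in> carrier R" "\<And>i. i \<le> m \<Longrightarrow> fst p i = fst p' i"
    "\<And>i x. Suc 0 \<le> i \<Longrightarrow> i \<le> m \<Longrightarrow> x \<in> carrier A \<Longrightarrow> snd p i x = snd p' i x"
  shows "p = p'"
proof (rule prod_eqI)
  show "fst p = fst p'"
    by (rule extensionalityI[of _ "{..m}"]) (use assms in \<open>auto simp: carrier_R PiE_def\<close>)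
  show "snd p = snd p'"
  proof (rule extensionalityI[of _ "{1..m}"])
    fix i assume "i \<in> {1..m}"
    then show "snd p i = snd p' i"
      by (intro A.KL'.dual_eqI R_closed assms) auto
  qed (use assms(1,2) in \<open>auto simp: carrier_R PiE_def\<close>)
qed

lemma R_memI:
  assumes "\<And>i. i \<le> m \<Longrightarrow> a i \<in> carrier A" "\<And>i. Suc 0 \<le> i \<Longrightarrow> i \<le> m \<Longrightarrow> q i \<in> carrier D"
  shows "(restrict a {..m}, restrict q {1..m}) \<in> carrier R"
  using assms by (auto simp: carrier_R)

lemma dualI':
  assumes "\<And>x. x \<in> carrier A \<Longrightarrow> f x \<in> carrier K"
    "\<And>x y. x \<in> carrier A \<Longrightarrow> y \<in> carrier A \<Longrightarrow> f (x \<oplus>\<^bsub>A\<^esub> y) = f x \<oplus>\<^bsub>K\<^esub> f y"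
    "\<And>c x. c \<in> carrier K \<Longrightarrow> x \<in> carrier A \<Longrightarrow> f (c \<odot>\<^bsub>A\<^esub> x) = c \<otimes>\<^bsub>K\<^esub> f x"
  shows "restrict f (carrier A) \<in> carrier D"
  by (intro A.KL'.dualI mod_homI) (use assms in \<open>auto simp: A.K.m_comm\<close>)

lemma R_one_closed: "\<one>\<^bsub>R\<^esub> \<in> carrier R" and R_zero_closed: "\<zero>\<^bsub>R\<^esub> \<in> carrier R"
  unfolding R_simps by (intro R_memI A.KL'.dual_closed; simp)+

lemma R_add_closed: "p \<in> carrier R \<Longrightarrow> p' \<in> carrier R \<Longrightarrow> p \<oplus>\<^bsub>R\<^esub> p' \<in> carrier R"
  unfolding R_simps by (intro R_memI A.KL'.dual_closed) (auto intro: R_closed)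

lemma R_smult_closed: "c \<in> carrier K \<Longrightarrow> p \<in> carrier R \<Longrightarrow> c \<odot>\<^bsub>R\<^esub> p \<in> carrier R"
  unfolding R_simps by (intro R_memI A.KL'.dual_closed) (auto intro: R_closed)

lemma R_mult_closed:
  assumes "p \<in> carrier R" "p' \<in> carrier R" shows "p \<otimes>\<^bsub>R\<^esub> p' \<in> carrier R"
  unfolding R_simps
  by (intro R_memI dualI')
    (auto simp: assms R_closed snd_closed pred_closed A.L.r_distr A.L.l_distr A.smult_mult A.K.a_ac A.K.r_distr)

lemmas R_ops_closed = R_one_closed R_zero_closed R_add_closed R_smult_closed R_mult_closed

lemma abelian_group_R: "abelian_group R"
proof (rule abelian_groupI)
  fix p assume p: "p \<in> carrier R"
  have "((\<ominus>\<^bsub>K\<^esub> \<one>\<^bsub>K\<^esub>) \<odot>\<^bsub>R\<^esub> p) \<oplus>\<^bsub>R\<^esub> p = \<zero>\<^bsub>R\<^esub>"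
    by (rule R_eqI) (use p R_ops_closed in \<open>auto simp: R_closed snd_closed A.KL.smult_l_minus A.L.l_neg
        A.K.l_minus A.K.l_neg simp del: R_simps\<close>, auto simp: p R_closed snd_closed A.KL.smult_l_minus A.L.l_neg
        A.K.l_minus A.K.l_neg)
  then show "\<exists>p'\<in>carrier R. p' \<oplus>\<^bsub>R\<^esub> p = \<zero>\<^bsub>R\<^esub>"
    by (rule bexI) (use p in \<open>auto intro: R_smult_closed simp del: R_simps\<close>)
next
  fix p p' p'' assume *: "p \<in> carrier R" "p' \<in> carrier R" "p'' \<in> carrier R"
  show "p \<oplus>\<^bsub>R\<^esub> p' \<oplus>\<^bsub>R\<^esub> p'' = p \<oplus>\<^bsub>R\<^esub> (p' \<oplus>\<^bsub>R\<^esub> p'')"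
    by (rule R_eqI[OF R_add_closed[OF R_add_closed] R_add_closed[OF _ R_add_closed]])
      (auto simp: * R_closed snd_closed A.L.a_assoc A.K.a_assoc simp del: R_simps,
        auto simp: * R_closed snd_closed A.L.a_assoc A.K.a_assoc)
  show "p \<oplus>\<^bsub>R\<^esub> p' = p' \<oplus>\<^bsub>R\<^esub> p"
    by (rule R_eqI[OF R_add_closed R_add_closed])
      (auto simp: * simp del: R_simps, auto simp: * R_closed snd_closed A.L.a_comm A.K.a_comm)
  show "\<zero>\<^bsub>R\<^esub> \<oplus>\<^bsub>R\<^esub> p = p"
    by (rule R_eqI[OF R_add_closed[OF R_zero_closed]])
      (auto simp: * simp del: R_simps, auto simp: * R_closed snd_closed)
  show "p \<oplus>\<^bsub>R\<^esub> p' \<in> carrier R" by (intro R_add_closed *)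
qed (rule R_zero_closed)

text \<open>For associativity, the subdiagonal entry of a triple product is a sum of three terms,
  one for each factor that contributes its own subdiagonal entry. The terms agree because
  \<open>DA\<close> is a bimodule.\<close>

lemma ring_R: "ring R"
proof (rule ringI[OF abelian_group_R monoidI])
  fix p p' p'' assume *: "p \<in> carrier R" "p' \<in> carrier R" "p'' \<in> carrier R"
  show "p \<otimes>\<^bsub>R\<^esub> p' \<in> carrier R" by (intro R_mult_closed *)
  show "(p \<otimes>\<^bsub>R\<^esub> p') \<otimes>\<^bsub>R\<^esub> p'' = p \<otimes>\<^bsub>R\<^esub> (p' \<otimes>\<^bsub>R\<^esub> p'')"
    by (rule R_eqI[OF R_mult_closed[OF R_mult_closed] R_mult_closed[OF _ R_mult_closed]])
      (auto simp: * simp del: R_simps,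
        auto simp: * R_closed snd_closed pred_closed A.L.m_assoc A.K.a_assoc)
  show "\<one>\<^bsub>R\<^esub> \<otimes>\<^bsub>R\<^esub> p = p"
    by (rule R_eqI[OF R_mult_closed[OF R_one_closed]])
      (auto simp: * simp del: R_simps, auto simp: * R_closed snd_closed pred_closed)
  show "p \<otimes>\<^bsub>R\<^esub> \<one>\<^bsub>R\<^esub> = p"
    by (rule R_eqI[OF R_mult_closed[OF _ R_one_closed]])
      (auto simp: * simp del: R_simps, auto simp: * R_closed snd_closed pred_closed)
  show "(p \<oplus>\<^bsub>R\<^esub> p') \<otimes>\<^bsub>R\<^esub> p'' = p \<otimes>\<^bsub>R\<^esub> p'' \<oplus>\<^bsub>R\<^esub> p' \<otimes>\<^bsub>R\<^esub> p''"
    by (rule R_eqI[OF R_mult_closed[OF R_add_closed] R_add_closed[OF R_mult_closed R_mult_closed]])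
      (auto simp: * simp del: R_simps,
        auto simp: * R_closed snd_closed pred_closed A.L.l_distr A.L.r_distr A.K.a_ac)
  show "p'' \<otimes>\<^bsub>R\<^esub> (p \<oplus>\<^bsub>R\<^esub> p') = p'' \<otimes>\<^bsub>R\<^esub> p \<oplus>\<^bsub>R\<^esub> p'' \<otimes>\<^bsub>R\<^esub> p'"
    by (rule R_eqI[OF R_mult_closed[OF _ R_add_closed] R_add_closed[OF R_mult_closed R_mult_closed]])
      (auto simp: * simp del: R_simps,
        auto simp: * R_closed snd_closed pred_closed A.L.l_distr A.L.r_distr A.K.a_ac)
qed (rule R_one_closed)

lemma module_R: "module K R"
proof (rule moduleI[OF A.K.cring_axioms abelian_group_R])
  fix c d p p' assume c: "c \<in> carrier K" "d \<in> carrier K" and p: "p \<in> carrier R" "p' \<in> carrier R"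
  show "c \<odot>\<^bsub>R\<^esub> p \<in> carrier R" by (intro R_smult_closed c p)
  show "(c \<oplus>\<^bsub>K\<^esub> d) \<odot>\<^bsub>R\<^esub> p = c \<odot>\<^bsub>R\<^esub> p \<oplus>\<^bsub>R\<^esub> d \<odot>\<^bsub>R\<^esub> p"
    by (rule R_eqI[OF R_smult_closed R_add_closed[OF R_smult_closed R_smult_closed]])
      (auto simp: c p simp del: R_simps, auto simp: c p R_closed snd_closed A.KL.smult_l_distr A.K.l_distr)
  show "c \<odot>\<^bsub>R\<^esub> (p \<oplus>\<^bsub>R\<^esub> p') = c \<odot>\<^bsub>R\<^esub> p \<oplus>\<^bsub>R\<^esub> c \<odot>\<^bsub>R\<^esub> p'"
    by (rule R_eqI[OF R_smult_closed[OF _ R_add_closed] R_add_closed[OF R_smult_closed R_smult_closed]])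
      (auto simp: c p simp del: R_simps, auto simp: c p R_closed snd_closed A.KL.smult_r_distr A.K.r_distr)
  show "(c \<otimes>\<^bsub>K\<^esub> d) \<odot>\<^bsub>R\<^esub> p = c \<odot>\<^bsub>R\<^esub> (d \<odot>\<^bsub>R\<^esub> p)"
    by (rule R_eqI[OF R_smult_closed R_smult_closed[OF _ R_smult_closed]])
      (auto simp: c p simp del: R_simps, auto simp: c p R_closed snd_closed A.KL.smult_assoc1 A.K.m_assoc)
next
  fix p assume p: "p \<in> carrier R"
  show "\<one>\<^bsub>K\<^esub> \<odot>\<^bsub>R\<^esub> p = p"
    by (rule R_eqI[OF R_smult_closed])
      (auto simp: p simp del: R_simps, auto simp: p R_closed snd_closed)
qed

lemma field_algebra_R: "field_algebra K R"
  unfolding field_algebra_def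
proof (intro conjI ballI A.K.field_axioms ring_R module_R)
  fix c p p' assume c: "c \<in> carrier K" and p: "p \<in> carrier R" "p' \<in> carrier R"
  show "(c \<odot>\<^bsub>R\<^esub> p) \<otimes>\<^bsub>R\<^esub> p' = c \<odot>\<^bsub>R\<^esub> (p \<otimes>\<^bsub>R\<^esub> p')"
    by (rule R_eqI[OF R_mult_closed[OF R_smult_closed] R_smult_closed[OF _ R_mult_closed]])
      (auto simp: c p simp del: R_simps,
        auto simp: c p R_closed snd_closed pred_closed A.smult_mult A.K.r_distr)
  show "p \<otimes>\<^bsub>R\<^esub> (c \<odot>\<^bsub>R\<^esub> p') = c \<odot>\<^bsub>R\<^esub> (p \<otimes>\<^bsub>R\<^esub> p')"
    by (rule R_eqI[OF R_mult_closed[OF _ R_smult_closed] R_smult_closed[OF _ R_mult_closed]])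
      (auto simp: c p simp del: R_simps,
        auto simp: c p R_closed snd_closed pred_closed A.smult_mult A.K.r_distr)
qed


lemma right_module_K_R: "right_module K R"
  by (rule right_module_of_module[OF module_R])

section \<open>Elementary matrices and finite dimension\<close>

definition diag_entry :: "nat \<Rightarrow> 'a \<Rightarrow> (nat \<Rightarrow> 'a) \<times> (nat \<Rightarrow> 'a \<Rightarrow> 'k)" where
  "diag_entry j a = (\<lambda>i\<in>{..m}. if i = j then a else \<zero>\<^bsub>A\<^esub>, \<lambda>i\<in>{1..m}. \<lambda>x\<in>carrier A. \<zero>\<^bsub>K\<^esub>)"

definition sub_entry :: "nat \<Rightarrow> ('a \<Rightarrow> 'k) \<Rightarrow> (nat \<Rightarrow> 'a) \<times> (nat \<Rightarrow> 'a \<Rightarrow> 'k)" where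
  "sub_entry j r = (\<lambda>i\<in>{..m}. \<zero>\<^bsub>A\<^esub>, \<lambda>i\<in>{1..m}. if i = j then r else (\<lambda>x\<in>carrier A. \<zero>\<^bsub>K\<^esub>))"

text \<open>Truncation at \<open>k\<close> keeps the columns \<open>0\<close> to
  \<open>k - 1\<close>. The subdiagonal entry of row \<open>i\<close> is in column
  \<open>i - 1\<close>, which explains \<open>i < k\<close> in one component against
  \<open>i \<le> k\<close> in the other. Raising \<open>k\<close> by one adds two entries, except
  that the last column \<open>m\<close> consists of a diagonal entry only.\<close>

definition truncation :: "nat \<Rightarrow> (nat \<Rightarrow> 'a) \<times> (nat \<Rightarrow> 'a \<Rightarrow> 'k) \<Rightarrow> (nat \<Rightarrow> 'a) \<times> (nat \<Rightarrow> 'a \<Rightarrow> 'k)" where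
  "truncation k p = (\<lambda>i\<in>{..m}. if i < k then fst p i else \<zero>\<^bsub>A\<^esub>,
     \<lambda>i\<in>{1..m}. if i \<le> k then snd p i else (\<lambda>x\<in>carrier A. \<zero>\<^bsub>K\<^esub>))"

lemma entries_closed:
  "a \<in> carrier A \<Longrightarrow> diag_entry j a \<in> carrier R"
  "r \<in> carrier D \<Longrightarrow> sub_entry j r \<in> carrier R"
  "p \<in> carrier R \<Longrightarrow> truncation k p \<in> carrier R"
  unfolding diag_entry_def sub_entry_def truncation_def
  by (intro R_memI; auto simp: A.KL'.dual_closed A.KL'.dual_closed[unfolded restrict_def] R_closed)+

lemma diag_entry_hom: "diag_entry j \<in> mod_hom K A R"
proof (rule mod_homI)
  fix a b assume *: "a \<in> carrier A" "b \<in> carrier A"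
  show "diag_entry j (a \<oplus>\<^bsub>A\<^esub> b) = diag_entry j a \<oplus>\<^bsub>R\<^esub> diag_entry j b"
    by (rule R_eqI[OF entries_closed(1) R_add_closed[OF entries_closed(1) entries_closed(1)]])
      (auto simp: * simp del: R_simps, auto simp: * diag_entry_def)
next
  fix c a assume *: "c \<in> carrier K" "a \<in> carrier A"
  show "diag_entry j (c \<odot>\<^bsub>A\<^esub> a) = c \<odot>\<^bsub>R\<^esub> diag_entry j a"
    by (rule R_eqI[OF entries_closed(1) R_smult_closed[OF _ entries_closed(1)]])
      (auto simp: * simp del: R_simps, auto simp: * diag_entry_def)
qed (rule entries_closed(1))

lemma sub_entry_hom: "sub_entry j \<in> mod_hom K D R"
proof (rule mod_homI)
  interpret D: right_module K D by (rule A.KL'.right_module_dual)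
  fix r s assume *: "r \<in> carrier D" "s \<in> carrier D"
  show "sub_entry j (r \<oplus>\<^bsub>D\<^esub> s) = sub_entry j r \<oplus>\<^bsub>R\<^esub> sub_entry j s"
    by (rule R_eqI[OF entries_closed(2)[OF D.M.a_closed] R_add_closed[OF entries_closed(2) entries_closed(2)]])
      (auto simp: * simp del: R_simps dual_space_simps, auto simp: * sub_entry_def)
next
  interpret D: right_module K D by (rule A.KL'.right_module_dual)
  fix c r assume *: "c \<in> carrier K" "r \<in> carrier D"
  show "sub_entry j (c \<odot>\<^bsub>D\<^esub> r) = c \<odot>\<^bsub>R\<^esub> sub_entry j r"
    by (rule R_eqI[OF entries_closed(2)[OF D.smult_closed] R_smult_closed[OF _ entries_closed(2)]])
      (auto simp: * simp del: R_simps dual_space_simps, auto simp: * sub_entry_def)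
qed (rule entries_closed(2))

lemma truncation_0: "p \<in> carrier R \<Longrightarrow> truncation 0 p = \<zero>\<^bsub>R\<^esub>"
  by (rule R_eqI[OF entries_closed(3) R_zero_closed]) (auto simp: truncation_def)

lemma truncation_Suc:
  assumes p: "p \<in> carrier R" and k: "k < m"
  shows "truncation (Suc k) p =
    truncation k p \<oplus>\<^bsub>R\<^esub> (diag_entry k (fst p k) \<oplus>\<^bsub>R\<^esub> sub_entry (Suc k) (snd p (Suc k)))"
proof (rule R_eqI[OF entries_closed(3)[OF p]])
  show "truncation k p \<oplus>\<^bsub>R\<^esub> (diag_entry k (fst p k) \<oplus>\<^bsub>R\<^esub> sub_entry (Suc k) (snd p (Suc k))) \<in> carrier R"
    using p k by (intro R_add_closed entries_closed R_closed) auto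
qed (use p k in \<open>auto simp: entries_closed truncation_def diag_entry_def sub_entry_def R_closed snd_closed Suc_le_eq le_Suc_eq less_Suc_eq\<close>)

lemma truncation_last:
  assumes p: "p \<in> carrier R"
  shows "p = truncation m p \<oplus>\<^bsub>R\<^esub> diag_entry m (fst p m)"
proof (rule R_eqI[OF p])
  show "truncation m p \<oplus>\<^bsub>R\<^esub> diag_entry m (fst p m) \<in> carrier R"
    using p by (intro R_add_closed entries_closed R_closed) auto
qed (use p in \<open>auto simp: truncation_def diag_entry_def R_closed snd_closed\<close>)

text \<open>As a vector space the algebra is a finite sum of copies of \<open>A\<close> and
  \<open>DA\<close>. A matrix is rebuilt from its entries column by column.\<close>

lemma finitely_generated_R: "finitely_generated K R"
proof -
  interpret R: right_module K R by (rule right_module_K_R)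
  obtain S where S: "finite S" "generates K A S" using A.fin_dim by (auto simp: finitely_generated_iff)
  obtain T where T: "finite T" "generates K D T"
    using A.KL'.finitely_generated_dual[OF A.fin_dim] by (auto simp: finitely_generated_iff)
  \<comment> \<open>For \<open>j = 0\<close> the matrix \<open>sub_entry j r\<close> is zero,
    because subdiagonal entries are indexed from 1.\<close>
  let ?G = "(\<lambda>(j, a). diag_entry j a) ` ({..m} \<times> S) \<union> (\<lambda>(j, r). sub_entry j r) ` ({..m} \<times> T)"
  have "generates K R ?G"
    unfolding generates_def
  proof (intro conjI allI impI)
    show "?G \<subseteq> carrier R"
      using generatesD(1)[OF S(2)] generatesD(1)[OF T(2)] by (auto intro!: entries_closed)
    fix H assume H: "submodule H K R \<and> ?G \<subseteq> H"
    note HD = R.submoduleD[OF conjunct1[OF H]]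
    have diag: "diag_entry j a \<in> H" if "j \<le> m" "a \<in> carrier A" for j a
    proof -
      interpret h: right_module_hom K A R "diag_entry j"
        by (rule right_module_hom_intro[OF A.right_module_K_L right_module_K_R diag_entry_hom])
      have "{a \<in> carrier A. diag_entry j a \<in> H} = carrier A"
        by (rule generatesD(2)[OF S(2) h.submodule_vimage]) (use H that(1) generatesD(1)[OF S(2)] in auto)
      then show ?thesis using that(2) by blast
    qed
    have sub: "sub_entry j r \<in> H" if "j \<le> m" "r \<in> carrier D" for j r
    proof -
      interpret h: right_module_hom K D R "sub_entry j"
        by (rule right_module_hom_intro[OF A.KL'.right_module_dual right_module_K_R sub_entry_hom])
      have "{r \<in> carrier D. sub_entry j r \<in> H} = carrier D"
        by (rule generatesD(2)[OF T(2) h.submodule_vimage]) (use H that(1) generatesD(1)[OF T(2)] in auto)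
      then show ?thesis using that(2) by blast
    qed
    have "p \<in> H" if p: "p \<in> carrier R" for p
    proof -
      have "truncation k p \<in> H" if "k \<le> m" for k
        using that
      proof (induction k)
        case 0
        show ?case unfolding truncation_0[OF p] by (rule HD(3))
      next
        case (Suc k)
        then show ?case
          using p unfolding truncation_Suc[OF p Suc_le_lessD[OF Suc.prems]]
          by (intro HD(4) diag sub R_closed) auto
      qed
      then show ?thesis
        using p by (subst truncation_last[OF p]) (intro HD(4) diag R_closed, auto)
    qed
    then show "H = carrier R" using HD(1) by blast
  qed
  moreover have "finite ?G" using S(1) T(1) by (intro finite_UnI finite_imageI finite_cartesian_product) auto
  ultimately show ?thesis unfolding finitely_generated_iff by (intro exI conjI)
qed

sublocale R: fd_alg K R
  by (rule fd_alg.intro[OF field_algebra_R finitely_generated_R])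

end

section \<open>Layer idempotents and the trace pairing\<close>

context replicated
begin

text \<open>This is \<open>f\<^sub>i\<close> of the overview. It is zero for
  \<open>i \<ge> m\<close>, so the family is defined for all naturals.\<close>

definition layer :: "nat \<Rightarrow> (nat \<Rightarrow> 'a) \<times> (nat \<Rightarrow> 'a \<Rightarrow> 'k)" where
  "layer i = (\<lambda>j\<in>{..m}. if j \<le> i then \<zero>\<^bsub>A\<^esub> else \<one>\<^bsub>A\<^esub>, \<lambda>j\<in>{1..m}. \<lambda>x\<in>carrier A. \<zero>\<^bsub>K\<^esub>)"

text \<open>This is \<open>1 - e\<^sub>m\<close> of the overview; multiplication by it on the right
  deletes the last column.\<close>

definition colayer :: "(nat \<Rightarrow> 'a) \<times> (nat \<Rightarrow> 'a \<Rightarrow> 'k)" where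
  "colayer = (\<lambda>j\<in>{..m}. if j < m then \<one>\<^bsub>A\<^esub> else \<zero>\<^bsub>A\<^esub>, \<lambda>j\<in>{1..m}. \<lambda>x\<in>carrier A. \<zero>\<^bsub>K\<^esub>)"

text \<open>The pairing of \<open>layer 0 R\<close> with \<open>R colayer\<close> by the trace of the product identifies the former
  with the dual of the latter.\<close>

definition trace :: "(nat \<Rightarrow> 'a) \<times> (nat \<Rightarrow> 'a \<Rightarrow> 'k) \<Rightarrow> 'k" where
  "trace p = (\<Oplus>\<^bsub>K\<^esub>i\<in>{1..m}. snd p i \<one>\<^bsub>A\<^esub>)"

lemma layer_closed: "layer i \<in> carrier R" and colayer_closed: "colayer \<in> carrier R"
  unfolding layer_def colayer_def by (intro R_memI A.KL'.dual_closed; simp)+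

lemma mult_colayer: "p \<in> carrier R \<Longrightarrow> p \<otimes>\<^bsub>R\<^esub> colayer = truncation m p"
  by (rule R_eqI[OF R_mult_closed[OF _ colayer_closed] entries_closed(3)])
    (auto simp: colayer_def truncation_def R_closed snd_closed pred_closed)

text \<open>Row \<open>j\<close> has entries only in the columns \<open>j - 1\<close> and
  \<open>j\<close>, so the rows from \<open>i + 2\<close> on have none in the columns up to
  \<open>i\<close>.\<close>

lemma layer_shift:
  assumes "p \<in> carrier R"
  shows "layer (Suc i) \<otimes>\<^bsub>R\<^esub> p \<otimes>\<^bsub>R\<^esub> layer i = layer (Suc i) \<otimes>\<^bsub>R\<^esub> p"
  by (rule R_eqI[OF R_mult_closed[OF R_mult_closed] R_mult_closed])
    (auto simp: layer_closed assms simp del: R_simps,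
      auto simp: layer_def assms R_closed snd_closed pred_closed)

text \<open>The only entry of row \<open>0\<close> is in column \<open>0\<close>, which
  \<open>layer 0\<close> deletes when multiplied on the right. The product then has a zero row
  \<open>0\<close>, so \<open>layer 0\<close> fixes it on the left.\<close>

lemma layer_zero:
  assumes "p \<in> carrier R"
  shows "layer 0 \<otimes>\<^bsub>R\<^esub> p \<otimes>\<^bsub>R\<^esub> layer 0 = p \<otimes>\<^bsub>R\<^esub> layer 0"
  by (rule R_eqI[OF R_mult_closed[OF R_mult_closed] R_mult_closed])
    (auto simp: layer_closed assms simp del: R_simps,
      auto simp: layer_def assms R_closed snd_closed pred_closed)

lemma layer_top:
  assumes "i \<le> k" shows "layer i \<otimes>\<^bsub>R\<^esub> layer k = layer k"
  by (rule R_eqI[OF R_mult_closed])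
    (use assms in \<open>auto simp: layer_closed simp del: R_simps\<close>, use assms in \<open>auto simp: layer_def\<close>)

text \<open>The only vertex above \<open>n = m - 1\<close> is \<open>m\<close>, so
  \<open>layer n\<close> is \<open>e\<^sub>m\<close>.\<close>

lemma one_minus_layer:
  assumes "m = Suc n" shows "\<one>\<^bsub>R\<^esub> \<ominus>\<^bsub>R\<^esub> layer n = colayer"
proof -
  have less_m: "i < m \<longleftrightarrow> i \<le> n" for i using assms by auto
  have "colayer \<oplus>\<^bsub>R\<^esub> layer n = \<one>\<^bsub>R\<^esub>"
    by (rule R_eqI[OF R_add_closed[OF colayer_closed layer_closed] R_one_closed])
      (auto simp: layer_def colayer_def less_m)
  then show ?thesis
    using R.L.add.inv_solve_right'[OF colayer_closed R_one_closed layer_closed[of n]]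
    by (simp add: a_minus_def del: R_simps)
qed

lemma colayer_idem: "colayer \<otimes>\<^bsub>R\<^esub> colayer = colayer"
  by (rule R_eqI[OF R_mult_closed])
    (auto simp: colayer_closed simp del: R_simps, auto simp: colayer_def)

text \<open>Row \<open>0\<close> consists of the entry \<open>(0, 0)\<close> alone, so belonging to
  \<open>W\<close> is a condition on one entry.\<close>

lemma layer_0_mult:
  assumes "p \<in> carrier R"
  shows "layer 0 \<otimes>\<^bsub>R\<^esub> p = p \<longleftrightarrow> fst p 0 = \<zero>\<^bsub>A\<^esub>"
proof
  assume "layer 0 \<otimes>\<^bsub>R\<^esub> p = p"
  then have "fst (layer 0 \<otimes>\<^bsub>R\<^esub> p) 0 = fst p 0" by (rule arg_cong)
  then show "fst p 0 = \<zero>\<^bsub>A\<^esub>" using R_closed(1)[OF assms, of 0] by (simp add: layer_def)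
next
  assume "fst p 0 = \<zero>\<^bsub>A\<^esub>"
  then show "layer 0 \<otimes>\<^bsub>R\<^esub> p = p"
    by (intro R_eqI[OF R_mult_closed])
      (auto simp: layer_closed assms simp del: R_simps,
        auto simp: layer_def assms R_closed snd_closed pred_closed)
qed

lemma trace_term: "p \<in> carrier R \<Longrightarrow> (\<lambda>i. snd p i \<one>\<^bsub>A\<^esub>) \<in> {1..m} \<rightarrow> carrier K"
  by (auto intro: snd_closed)

lemma trace_functional: "trace \<in> R.functionals (regular_module R)"
proof (rule mod_homI)
  fix p p' assume p: "p \<in> carrier (R.res (regular_module R))" "p' \<in> carrier (R.res (regular_module R))"
  then show "trace p \<in> carrier (regular_module K)"
    using trace_term[of p] unfolding trace_def by (simp add: A.K.finsum_closed)
  have "trace (p \<oplus>\<^bsub>R\<^esub> p') = (\<Oplus>\<^bsub>K\<^esub>i\<in>{1..m}. snd p i \<one>\<^bsub>A\<^esub> \<oplus>\<^bsub>K\<^esub> snd p' i \<one>\<^bsub>A\<^esub>)"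
    unfolding trace_def by (rule A.K.finsum_cong') (use p in \<open>auto simp: snd_closed\<close>)
  also have "\<dots> = trace p \<oplus>\<^bsub>K\<^esub> trace p'"
    unfolding trace_def by (rule A.K.finsum_addf) (use p trace_term in auto)
  finally show "trace (p \<oplus>\<^bsub>R.res (regular_module R)\<^esub> p') = trace p \<oplus>\<^bsub>regular_module K\<^esub> trace p'"
    by (simp del: R_simps)
next
  fix c p assume c: "c \<in> carrier K" and p: "p \<in> carrier (R.res (regular_module R))"
  then have pR: "p \<in> carrier R" by simp
  have "trace (c \<odot>\<^bsub>R\<^esub> p) = (\<Oplus>\<^bsub>K\<^esub>i\<in>{1..m}. c \<otimes>\<^bsub>K\<^esub> snd p i \<one>\<^bsub>A\<^esub>)"
    unfolding trace_def by (rule A.K.finsum_cong') (use pR c in \<open>auto simp: snd_closed\<close>)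
  also have "\<dots> = c \<otimes>\<^bsub>K\<^esub> trace p"
    unfolding trace_def by (rule A.K.finsum_rdistr[symmetric]) (use c trace_term[OF pR] in auto)
  finally show "trace (c \<odot>\<^bsub>R.res (regular_module R)\<^esub> p) = c \<odot>\<^bsub>regular_module K\<^esub> trace p"
    using c pR A.K.finsum_closed[OF trace_term[OF pR]]
    by (simp add: R.mult_scal(2) A.K.m_comm trace_def del: R_simps)
qed

text \<open>The pairing breaks up into evaluations between \<open>DA\<close> and \<open>A\<close>:
  each subdiagonal entry of one factor is matched with a diagonal entry of the other. The entry
  \<open>(0, 0)\<close> of \<open>w\<close> and the entry \<open>(m, m)\<close> of \<open>p\<close>
  are not seen.\<close>

lemma trace_mult:
  assumes "w \<in> carrier R" "p \<in> carrier R"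
  shows "trace (w \<otimes>\<^bsub>R\<^esub> p) = (\<Oplus>\<^bsub>K\<^esub>i\<in>{1..m}. snd w i (fst p (i - 1)) \<oplus>\<^bsub>K\<^esub> snd p i (fst w i))"
  unfolding trace_def
  by (rule A.K.finsum_cong') (use assms in \<open>auto simp: snd_closed pred_closed R_closed\<close>)

lemma finsum_single:
  assumes "j \<in> {1..m}" "g j \<in> carrier K" "\<And>i. i \<in> {1..m} \<Longrightarrow> i \<noteq> j \<Longrightarrow> g i = \<zero>\<^bsub>K\<^esub>"
  shows "(\<Oplus>\<^bsub>K\<^esub>i\<in>{1..m}. g i) = g j"
proof -
  have "(\<Oplus>\<^bsub>K\<^esub>i\<in>{1..m}. g i) = (\<Oplus>\<^bsub>K\<^esub>i\<in>{1..m}. if j = i then g j else \<zero>\<^bsub>K\<^esub>)"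
    by (rule A.K.finsum_cong') (use assms in auto)
  also have "\<dots> = g j"
    using A.K.finsum_singleton[OF assms(1), of "\<lambda>_. g j"] assms(2) by simp
  finally show ?thesis .
qed

text \<open>Pairing with elementary matrices reads off the entries of \<open>w\<close>: those with a
  diagonal entry give the values of its subdiagonal entries, those with a subdiagonal entry
  \<open>r\<close> give the values of \<open>r\<close> on its diagonal entries, and functionals
  separate points. The entry \<open>(0, 0)\<close>, invisible to the pairing, is zero by
  assumption.\<close>

lemma trace_faithful:
  assumes w: "w \<in> carrier R" "fst w 0 = \<zero>\<^bsub>A\<^esub>"
    and zero: "\<And>p. p \<in> carrier R \<Longrightarrow> trace (w \<otimes>\<^bsub>R\<^esub> p) = \<zero>\<^bsub>K\<^esub>"
  shows "w = \<zero>\<^bsub>R\<^esub>"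
proof (rule R_eqI[OF w(1) R_zero_closed])
  fix i x assume i: "Suc 0 \<le> i" "i \<le> m" and x: "x \<in> carrier A"
  let ?p = "diag_entry (i - 1) x"
  have "snd w i x = (\<Oplus>\<^bsub>K\<^esub>k\<in>{1..m}. snd w k (fst ?p (k - 1)) \<oplus>\<^bsub>K\<^esub> snd ?p k (fst w k))"
    by (subst finsum_single[of i])
      (use i x w R_closed(1)[OF w(1)] in \<open>auto simp: diag_entry_def snd_closed\<close>)
  also have "\<dots> = trace (w \<otimes>\<^bsub>R\<^esub> ?p)" by (rule trace_mult[symmetric, OF w(1) entries_closed(1)[OF x]])
  also have "\<dots> = \<zero>\<^bsub>K\<^esub>" by (rule zero[OF entries_closed(1)[OF x]])
  finally show "snd w i x = snd \<zero>\<^bsub>R\<^esub> i x" using i x by simp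
next
  fix i assume i: "i \<le> m"
  show "fst w i = fst \<zero>\<^bsub>R\<^esub> i"
  proof (cases "i = 0")
    case True
    then show ?thesis using w(2) by simp
  next
    case False
    have "fst w i = \<zero>\<^bsub>A\<^esub>"
    proof (rule A.KL'.dual_separates[OF A.fin_dim R_closed(1)[OF w(1) i]])
      fix r assume r: "r \<in> carrier D"
      let ?p = "sub_entry i r"
      have "r (fst w i) = (\<Oplus>\<^bsub>K\<^esub>k\<in>{1..m}. snd w k (fst ?p (k - 1)) \<oplus>\<^bsub>K\<^esub> snd ?p k (fst w k))"
        by (subst finsum_single[of i])
          (use i False r w R_closed(1)[OF w(1)] A.KL'.dualD(3)[OF r] in \<open>auto simp: sub_entry_def snd_closed\<close>)
      also have "\<dots> = trace (w \<otimes>\<^bsub>R\<^esub> ?p)" by (rule trace_mult[symmetric, OF w(1) entries_closed(2)[OF r]])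
      also have "\<dots> = \<zero>\<^bsub>K\<^esub>" by (rule zero[OF entries_closed(2)[OF r]])
      finally show "r (fst w i) = \<zero>\<^bsub>K\<^esub>" .
    qed
    then show ?thesis using i by simp
  qed
qed

text \<open>The entries of \<open>w\<close> are forced by the values of \<open>\<theta>\<close> on
  elementary matrices. These values determine \<open>\<theta>\<close>: the one elementary position
  that the pairing misses, \<open>(m, m)\<close>, is deleted by \<open>colayer\<close>, under which
  \<open>\<theta>\<close> is invariant.\<close>

lemma trace_represents:
  assumes \<theta>: "\<theta> \<in> R.functionals (regular_module R)"
    and inv: "\<And>p. p \<in> carrier R \<Longrightarrow> \<theta> (p \<otimes>\<^bsub>R\<^esub> colayer) = \<theta> p"
  shows "\<exists>w\<in>carrier R. fst w 0 = \<zero>\<^bsub>A\<^esub> \<and> (\<forall>p\<in>carrier R. trace (w \<otimes>\<^bsub>R\<^esub> p) = \<theta> p)"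
proof -
  have \<theta>': "\<theta> \<in> mod_hom K R (regular_module K)"
    using mod_homD[OF \<theta>] by (intro mod_homI) (auto simp: R.mult_scal simp del: R_simps)
  interpret \<theta>: right_module_hom K R "regular_module K" \<theta>
    by (rule right_module_hom_intro[OF right_module_K_R A.K.right_module_regular \<theta>'])
  have \<theta>_closed: "\<theta> p \<in> carrier K" if "p \<in> carrier R" for p
    using \<theta>.closed[OF that] by simp
  \<comment> \<open>On the subdiagonal entries in row \<open>i\<close>, \<open>\<theta>\<close> is a
    functional on \<open>DA\<close>, hence by reflexivity evaluation at an element of
    \<open>A\<close>. That element becomes the diagonal entry of \<open>w\<close> in row
    \<open>i\<close>.\<close>
  have "\<exists>b\<in>carrier A. \<forall>r\<in>carrier D. \<theta> (sub_entry i r) = r b" for i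
    by (rule A.KL'.double_dual[OF A.fin_dim mod_hom_comp[OF sub_entry_hom \<theta>']])
  then have "\<forall>i. \<exists>b. b \<in> carrier A \<and> (\<forall>r\<in>carrier D. \<theta> (sub_entry i r) = r b)" by blast
  from choice[OF this] obtain b where b: "\<forall>i. b i \<in> carrier A \<and> (\<forall>r\<in>carrier D. \<theta> (sub_entry i r) = r (b i))"
    by (elim exE)
  define w where "w = (\<lambda>i\<in>{..m}. if i = 0 then \<zero>\<^bsub>A\<^esub> else b i,
    \<lambda>i\<in>{1..m}. \<lambda>x\<in>carrier A. \<theta> (diag_entry (i - 1) x))"
  have w: "w \<in> carrier R"
    unfolding w_def using b by (intro R_memI A.KL'.dualI mod_hom_comp[OF diag_entry_hom \<theta>']) auto
  have "trace (w \<otimes>\<^bsub>R\<^esub> p) = \<theta> p" if p: "p \<in> carrier R" for p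
  proof -
    let ?t = "\<lambda>i. \<theta> (diag_entry (i - 1) (fst p (i - 1))) \<oplus>\<^bsub>K\<^esub> \<theta> (sub_entry i (snd p i))"
    have t: "?t i \<in> carrier K" if "i \<in> {1..m}" for i
      by (intro A.K.add.m_closed \<theta>_closed entries_closed R_closed[OF p]) (use that in auto)
    \<comment> \<open>Each of the columns \<open>0\<close> to \<open>m - 1\<close> contributes one
      summand, made of its diagonal entry and the subdiagonal entry below it.\<close>
    have "\<theta> (truncation k p) = (\<Oplus>\<^bsub>K\<^esub>i\<in>{1..k}. ?t i)" if "k \<le> m" for k
      using that
    proof (induction k)
      case 0
      show ?case unfolding truncation_0[OF p] using \<theta>.zero by simp
    next
      case (Suc k)
      have c: "diag_entry k (fst p k) \<in> carrier R" "sub_entry (Suc k) (snd p (Suc k)) \<in> carrier R"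
        using p Suc.prems by (auto intro!: entries_closed R_closed)
      have "{1..Suc k} = insert (Suc k) {1..k}" by auto
      then have "(\<Oplus>\<^bsub>K\<^esub>i\<in>{1..Suc k}. ?t i) = ?t (Suc k) \<oplus>\<^bsub>K\<^esub> (\<Oplus>\<^bsub>K\<^esub>i\<in>{1..k}. ?t i)"
        using t[of "Suc k"] t Suc.prems by (simp add: A.K.finsum_insert Pi_iff)
      also have "\<dots> = \<theta> (truncation (Suc k) p)"
        unfolding truncation_Suc[OF p Suc_le_lessD[OF Suc.prems]]
        using \<theta>.add[OF entries_closed(3)[OF p] R_add_closed[OF c]] \<theta>.add[OF c] Suc
          \<theta>_closed[OF c(1)] \<theta>_closed[OF c(2)] \<theta>_closed[OF entries_closed(3)[OF p, of k]]
        by (simp add: A.K.a_ac del: R_simps)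
      finally show ?case by (rule sym)
    qed
    \<comment> \<open>Truncation at \<open>m\<close> is multiplication by \<open>colayer\<close>, so
      invariance replaces the truncated matrix by \<open>p\<close>.\<close>
    from this[of m] have "\<theta> p = (\<Oplus>\<^bsub>K\<^esub>i\<in>{1..m}. ?t i)"
      using inv[OF p] mult_colayer[OF p] by simp
    also have "\<dots> = (\<Oplus>\<^bsub>K\<^esub>i\<in>{1..m}. snd w i (fst p (i - 1)) \<oplus>\<^bsub>K\<^esub> snd p i (fst w i))"
    proof (rule A.K.finsum_cong'[OF refl])
      have eq: "snd w i (fst p (i - 1)) \<oplus>\<^bsub>K\<^esub> snd p i (fst w i) = ?t i" if "i \<in> {1..m}" for i
        using that b pred_closed[OF p, of i] R_closed(2)[OF p, of i] by (auto simp: w_def)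
      show "?t i = snd w i (fst p (i - 1)) \<oplus>\<^bsub>K\<^esub> snd p i (fst w i)" if "i \<in> {1..m}" for i
        by (rule eq[OF that, symmetric])
      show "(\<lambda>i. snd w i (fst p (i - 1)) \<oplus>\<^bsub>K\<^esub> snd p i (fst w i)) \<in> {1..m} \<rightarrow> carrier K"
        by (rule Pi_I, subst eq, assumption, erule t)
    qed
    finally show ?thesis using trace_mult[OF w p] by simp
  qed
  then show ?thesis using w by (intro bexI[of _ w]) (auto simp: w_def)
qed

lemma corepresenting_R:
  assumes m: "m = Suc n"
  shows "corepresenting K R (regular_module R\<lparr>carrier := (\<lambda>p. layer 0 \<otimes>\<^bsub>R\<^esub> p) ` carrier R\<rparr>) trace
    (\<one>\<^bsub>R\<^esub> \<ominus>\<^bsub>R\<^esub> layer n)"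
proof -
  let ?W = "regular_module R\<lparr>carrier := (\<lambda>p. layer 0 \<otimes>\<^bsub>R\<^esub> p) ` carrier R\<rparr>"
  have W_iff: "w \<in> (\<lambda>p. layer 0 \<otimes>\<^bsub>R\<^esub> p) ` carrier R \<longleftrightarrow> w \<in> carrier R \<and> fst w 0 = \<zero>\<^bsub>A\<^esub>" for w
  proof
    assume "w \<in> (\<lambda>p. layer 0 \<otimes>\<^bsub>R\<^esub> p) ` carrier R"
    then obtain p where p: "p \<in> carrier R" "w = layer 0 \<otimes>\<^bsub>R\<^esub> p" by (elim imageE)
    have "fst w 0 = \<zero>\<^bsub>A\<^esub>" unfolding p(2) using R_closed(1)[OF p(1), of 0] by (simp add: layer_def)
    then show "w \<in> carrier R \<and> fst w 0 = \<zero>\<^bsub>A\<^esub>" using p R_mult_closed[OF layer_closed p(1)] by (simp del: R_simps)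
  next
    assume w: "w \<in> carrier R \<and> fst w 0 = \<zero>\<^bsub>A\<^esub>"
    then have "w = layer 0 \<otimes>\<^bsub>R\<^esub> w" using layer_0_mult[of w] by (simp del: R_simps)
    then show "w \<in> (\<lambda>p. layer 0 \<otimes>\<^bsub>R\<^esub> p) ` carrier R" using w by (intro image_eqI[of _ _ w]) simp_all
  qed
  then have W_sub: "(\<lambda>p. layer 0 \<otimes>\<^bsub>R\<^esub> p) ` carrier R \<subseteq> carrier R" by blast
  have sub: "submodule (carrier ?W) R (regular_module R)"
  proof -
    have "(\<lambda>p. layer 0 \<otimes>\<^bsub>R\<^esub> p) \<in> mod_hom R (regular_module R) (regular_module R)"
      by (rule mod_homI) (simp_all add: layer_closed R_mult_closed R.L.r_distr R.L.m_assoc del: R_simps)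
    from right_module_hom_intro[OF R.regular R.regular this]
    interpret h: right_module_hom R "regular_module R" "regular_module R" "\<lambda>p. layer 0 \<otimes>\<^bsub>R\<^esub> p" .
    show ?thesis using h.submodule_image[OF h.dom.submodule_carrier] by (simp del: R_simps)
  qed
  show ?thesis
    unfolding one_minus_layer[OF m]
  proof (intro_locales, rule corepresenting_axioms.intro)
    show "fg_right_module R ?W" using R.fg_sub[OF R.fg_regular sub] by (simp del: R_simps)
    show "trace \<in> R.functionals ?W"
      using mod_hom_restrict[OF trace_functional, of "(\<lambda>p. layer 0 \<otimes>\<^bsub>R\<^esub> p) ` carrier R"] W_sub
      by (simp del: R_simps)
    show "colayer \<in> carrier R" by (rule colayer_closed)
    show "colayer \<otimes>\<^bsub>R\<^esub> colayer = colayer" by (rule colayer_idem)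
    show "trace (colayer \<odot>\<^bsub>?W\<^esub> w) = trace w" if "w \<in> carrier ?W" for w
    proof -
      have w: "w \<in> carrier R" using that W_iff[of w] by (simp del: R_simps)
      \<comment> \<open>The trace depends only on subdiagonal entries, and the deleted column
        \<open>m\<close> has none.\<close>
      have "trace (truncation m w) = trace w"
        unfolding trace_def by (rule A.K.finsum_cong') (use w in \<open>auto simp: truncation_def snd_closed\<close>)
      then show ?thesis using mult_colayer[OF w] by (simp del: R_simps)
    qed
    show "\<exists>w\<in>carrier ?W. \<forall>p\<in>carrier R. trace (p \<odot>\<^bsub>?W\<^esub> w) = \<theta> p"
      if "\<theta> \<in> R.functionals (regular_module R)" "\<And>p. p \<in> carrier R \<Longrightarrow> \<theta> (p \<otimes>\<^bsub>R\<^esub> colayer) = \<theta> p" for \<theta>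
    proof -
      have "\<exists>w\<in>carrier R. fst w 0 = \<zero>\<^bsub>A\<^esub> \<and> (\<forall>p\<in>carrier R. trace (w \<otimes>\<^bsub>R\<^esub> p) = \<theta> p)"
        by (rule trace_represents[OF that])
      then obtain w where "w \<in> carrier R" "fst w 0 = \<zero>\<^bsub>A\<^esub>"
        "\<forall>p\<in>carrier R. trace (w \<otimes>\<^bsub>R\<^esub> p) = \<theta> p" by (elim bexE conjE)
      then show ?thesis using W_iff[of w] by (intro bexI[of _ w]) (simp_all del: R_simps)
    qed
    show "w = \<zero>\<^bsub>?W\<^esub>" if "w \<in> carrier ?W" "\<And>p. p \<in> carrier R \<Longrightarrow> trace (p \<odot>\<^bsub>?W\<^esub> w) = \<zero>\<^bsub>K\<^esub>" for w
      using trace_faithful[of w] that W_iff[of w] by (simp del: R_simps)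
  qed
qed

theorem dom_dim_R:
  assumes "m \<ge> 1" shows "dom_dim R \<ge> enat m"
proof -
  \<comment> \<open>With \<open>n = m - 1\<close>, \<open>layer n\<close> is
    \<open>e\<^sub>m\<close>. The cosyzygies \<open>1\<close> to \<open>n\<close> are killed by it
    and have projective envelopes; together with the envelope of the algebra itself this makes
    \<open>Suc n = m\<close> terms.\<close>
  obtain n where n: "m = Suc n" using assms by (cases m) auto
  have "layered_algebra K R layer n trace"
    by (intro layered_algebra.intro R.fd_alg_axioms layered_algebra_axioms.intro layer_closed layer_shift
        layer_zero layer_top corepresenting_R n)
  from layered_algebra.dom_dim_ge[OF this] show ?thesis by (simp add: n)
qed

end

theorem theorem2:
  fixes K :: "'k ring" and A :: "('k, 'a) module" and m :: nat
  assumes "algebraically_closed K"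
    and "field_algebra K A" and "finitely_generated K A"
    and "hereditary A"
    and "m \<ge> 1"
  shows "dom_dim (replicated_algebra K m A) \<ge> enat m"
  by (rule replicated.dom_dim_R[OF replicated.intro[OF fd_alg.intro[OF assms(2,3)]] assms(5)])

end
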